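(* Let $\mathfrak{H}$ and $\mathfrak{H}_n$, $n\in\mathbb{N}$, be separable Hilbert spaces, let $J_n\in\mathcal{B}(\mathfrak{H},\mathfrak{H}_n)$ be bounded operators, and let $A$ in $\mathfrak{H}$ and $A_n$ in $\mathfrak{H}_n$ be self-adjoint operators. Suppose $A_n$ converges to $A$ in generalized strong resolvent sense. Then $$J_n^*\mathrm{e}^{\mathrm{i}tA_n}J_n\to\mathrm{e}^{\mathrm{i}tA}\ \text{ strongly},\qquad t\in\mathbb{R},$$ and, if all operators $A$, $A_n$ are semi-bounded by the same bound (i.e. there is $\gamma\in\mathbb{R}$ with $A\ge\gamma$ and $A_n\ge\gamma$ for all $n$), $$J_n^*\mathrm{e}^{-tA_n}J_n\to\mathrm{e}^{-tA}\ \text{ strongly},\qquad t\ge0.$$ The last claim (convergence of $J_n^*\mathrm{e}^{-tA_n}J_n$ to $\mathrm{e}^{-tA}$ for $t\ge0$, for operators semi-bounded by the same bound) also holds in operator norm, provided $A_n$ converges to $A$ in generalized norm resolvent sense.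
   Context: Resolvent: $R_A(z)=(A-z)^{-1}$. Put $\Gamma:=\mathbb{C}\setminus\overline{\sigma(A)\cup\bigcup_n\sigma(A_n)}$. Generalized norm resolvent convergence of $A_n$ to $A$ means: $\|J_n\|\le C$ for some constant $C>0$ and all $n$, $\|J_n^*J_n-\mathbb{I}\|=\|J_nJ_n^*-\mathbb{I}\|\to0$, and $\lim_{n\to\infty}\|J_n^*R_{A_n}(z)J_n-R_A(z)\|=0$ for one $z\in\Gamma$. Generalized strong resolvent convergence of $A_n$ to $A$ means: $\|J_n\|\le C$ for some constant $C>0$ and all $n$, $\|J_n^*J_n\psi-\psi\|\to0$ for all $\psi\in\mathfrak{H}$, and $\lim_{n\to\infty}\|J_n^*R_{A_n}(z)J_n\psi-R_A(z)\psi\|=0$ for all $\psi\in\mathfrak{H}$, for one $z\in\Gamma$.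
   Formalization: In generalized strong resolvent convergence the one point z in Γ is required to be non-real; with a real z in Γ the claim fails (H=C, A=1, H_n=C^2, J_n c=(c,0), A_n the inverse of [[1,1],[1,5]], z=0). The norm version still allows any z in Γ. *)

theory Defs
  imports "HOL-Analysis.Analysis"
begin

section \<open>Hilbert spaces with explicit carrier\<close>

text \<open>
  A sequence of Hilbert spaces has to live in a single type, so a Hilbert space is a linear
  subspace \<open>hcarrier\<close> of a complex vector space, equipped with an inner product of its own that is
  only meaningful on the carrier. Different members of a family have unrelated inner products and
  scalar multiplications, and the carrier need not be complete in any ambient sense. Every
  separable Hilbert space is isometrically isomorphic to one of this form over the type
  \<^typ>\<open>nat \<Rightarrow> complex\<close> with pointwise operations, so every sequence of separable Hilbert spaces is covered. The inner product
  is linear in its second argument.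
\<close>

record 'a hilbert =
  hcarrier :: "'a set"
  hscale :: "complex \<Rightarrow> 'a \<Rightarrow> 'a"
  hinner :: "'a \<Rightarrow> 'a \<Rightarrow> complex"

definition hnorm :: "'a hilbert \<Rightarrow> 'a \<Rightarrow> real" where
  "hnorm H x = sqrt (Re (hinner H x x))"

locale hilbert_space =
  fixes H :: "'a::ab_group_add hilbert"
  assumes vector_space_scale: "vector_space (hscale H)"
    and subspace_carrier: "module.subspace (hscale H) (hcarrier H)"
    and inner_add_right: "\<And>x y z. x \<in> hcarrier H \<Longrightarrow> y \<in> hcarrier H \<Longrightarrow> z \<in> hcarrier H \<Longrightarrow>
          hinner H x (y + z) = hinner H x y + hinner H x z"
    and inner_scale_right: "\<And>c x y. x \<in> hcarrier H \<Longrightarrow> y \<in> hcarrier H \<Longrightarrow>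
          hinner H x (hscale H c y) = c * hinner H x y"
    and inner_commute: "\<And>x y. x \<in> hcarrier H \<Longrightarrow> y \<in> hcarrier H \<Longrightarrow>
          hinner H x y = cnj (hinner H y x)"
    and inner_pos: "\<And>x. x \<in> hcarrier H \<Longrightarrow> x \<noteq> 0 \<Longrightarrow> Re (hinner H x x) > 0"
    and complete_carrier: "\<And>X :: nat \<Rightarrow> 'a. (\<And>n. X n \<in> hcarrier H) \<Longrightarrow>
          (\<And>e. e > 0 \<Longrightarrow> \<exists>N. \<forall>m\<ge>N. \<forall>n\<ge>N. hnorm H (X m - X n) < e) \<Longrightarrow>
          \<exists>x\<in>hcarrier H. (\<lambda>n. hnorm H (X n - x)) \<longlonglongrightarrow> 0"

definition hdense :: "'a::ab_group_add hilbert \<Rightarrow> 'a set \<Rightarrow> bool" where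
  "hdense H D \<longleftrightarrow> D \<subseteq> hcarrier H \<and> (\<forall>x\<in>hcarrier H. \<forall>e>0. \<exists>d\<in>D. hnorm H (x - d) < e)"

locale separable_hilbert_space = hilbert_space +
  assumes separable: "\<exists>D. countable D \<and> hdense H D"

section \<open>Bounded operators\<close>

text \<open>The values of a bounded operator outside the carrier are irrelevant.\<close>

definition bounded_operator ::
    "'a::ab_group_add hilbert \<Rightarrow> 'b::ab_group_add hilbert \<Rightarrow> ('a \<Rightarrow> 'b) \<Rightarrow> bool" where
  "bounded_operator H K T \<longleftrightarrow>
     (\<forall>x\<in>hcarrier H. T x \<in> hcarrier K) \<and>
     (\<forall>x\<in>hcarrier H. \<forall>y\<in>hcarrier H. T (x + y) = T x + T y) \<and>
     (\<forall>c. \<forall>x\<in>hcarrier H. T (hscale H c x) = hscale K c (T x)) \<and>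
     (\<exists>M. \<forall>x\<in>hcarrier H. hnorm K (T x) \<le> M * hnorm H x)"

definition operator_norm :: "'a hilbert \<Rightarrow> 'b hilbert \<Rightarrow> ('a \<Rightarrow> 'b) \<Rightarrow> real" where
  "operator_norm H K T = (SUP x\<in>{x \<in> hcarrier H. hnorm H x \<le> 1}. hnorm K (T x))"

definition bounded_adjoint :: "'a hilbert \<Rightarrow> 'b hilbert \<Rightarrow> ('a \<Rightarrow> 'b) \<Rightarrow> 'b \<Rightarrow> 'a" where
  "bounded_adjoint H K T y =
     (THE x. x \<in> hcarrier H \<and> (\<forall>u\<in>hcarrier H. hinner H x u = hinner K y (T u)))"

section \<open>Unbounded operators\<close>

record 'a operator =
  op_dom :: "'a set"
  op_app :: "'a \<Rightarrow> 'a"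

definition linear_operator :: "'a::ab_group_add hilbert \<Rightarrow> 'a operator \<Rightarrow> bool" where
  "linear_operator H A \<longleftrightarrow>
     op_dom A \<subseteq> hcarrier H \<and> module.subspace (hscale H) (op_dom A) \<and>
     (\<forall>x\<in>op_dom A. op_app A x \<in> hcarrier H) \<and>
     (\<forall>x\<in>op_dom A. \<forall>y\<in>op_dom A. op_app A (x + y) = op_app A x + op_app A y) \<and>
     (\<forall>c. \<forall>x\<in>op_dom A. op_app A (hscale H c x) = hscale H c (op_app A x))"

definition adjoint_operator :: "'a hilbert \<Rightarrow> 'a operator \<Rightarrow> 'a operator" where
  "adjoint_operator H A =
     \<lparr> op_dom = {y \<in> hcarrier H. \<exists>z\<in>hcarrier H. \<forall>x\<in>op_dom A.
                  hinner H z x = hinner H y (op_app A x)},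
       op_app = (\<lambda>y. THE z. z \<in> hcarrier H \<and>
                  (\<forall>x\<in>op_dom A. hinner H z x = hinner H y (op_app A x))) \<rparr>"

definition self_adjoint :: "'a::ab_group_add hilbert \<Rightarrow> 'a operator \<Rightarrow> bool" where
  "self_adjoint H A \<longleftrightarrow>
     linear_operator H A \<and> hdense H (op_dom A) \<and>
     op_dom (adjoint_operator H A) = op_dom A \<and>
     (\<forall>x\<in>op_dom A. op_app (adjoint_operator H A) x = op_app A x)"

definition bounded_below :: "'a hilbert \<Rightarrow> 'a operator \<Rightarrow> real \<Rightarrow> bool" where
  "bounded_below H A \<gamma> \<longleftrightarrow>
     (\<forall>x\<in>op_dom A. Re (hinner H x (op_app A x)) \<ge> \<gamma> * (hnorm H x)\<^sup>2)"

section \<open>Resolvent and spectrum\<close>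

definition shifted :: "'a::ab_group_add hilbert \<Rightarrow> 'a operator \<Rightarrow> complex \<Rightarrow> 'a \<Rightarrow> 'a" where
  "shifted H A z x = op_app A x - hscale H z x"

definition resolvent_set :: "'a::ab_group_add hilbert \<Rightarrow> 'a operator \<Rightarrow> complex set" where
  "resolvent_set H A =
     {z. bij_betw (shifted H A z) (op_dom A) (hcarrier H) \<and>
         (\<exists>M. \<forall>x\<in>op_dom A. hnorm H x \<le> M * hnorm H (shifted H A z x))}"

definition spectrum :: "'a::ab_group_add hilbert \<Rightarrow> 'a operator \<Rightarrow> complex set" where
  "spectrum H A = - resolvent_set H A"

definition resolvent :: "'a::ab_group_add hilbert \<Rightarrow> 'a operator \<Rightarrow> complex \<Rightarrow> 'a \<Rightarrow> 'a" where
  "resolvent H A z = inv_into (op_dom A) (shifted H A z)"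

section \<open>Spectral measure and functional calculus\<close>

text \<open>
  Projection-valued measures on the Borel sets of the real line. Multiplicativity,
  \<open>E (B \<inter> C) = E B \<circ> E C\<close>, follows from additivity and the projection property.
\<close>

definition projection_valued_measure ::
    "'a::ab_group_add hilbert \<Rightarrow> (real set \<Rightarrow> 'a \<Rightarrow> 'a) \<Rightarrow> bool" where
  "projection_valued_measure H E \<longleftrightarrow>
     (\<forall>B\<in>sets borel. bounded_operator H H (E B) \<and>
        (\<forall>x\<in>hcarrier H. E B (E B x) = E B x) \<and>
        (\<forall>x\<in>hcarrier H. \<forall>y\<in>hcarrier H. hinner H (E B x) y = hinner H x (E B y))) \<and>
     (\<forall>x\<in>hcarrier H. E UNIV x = x) \<and>
     (\<forall>B :: nat \<Rightarrow> real set. range B \<subseteq> sets borel \<longrightarrow> disjoint_family B \<longrightarrow>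
        (\<forall>x\<in>hcarrier H. (\<lambda>N. hnorm H ((\<Sum>n<N. E (B n) x) - E (\<Union>n. B n) x)) \<longlonglongrightarrow> 0))"

definition scalar_spectral_measure ::
    "'a hilbert \<Rightarrow> (real set \<Rightarrow> 'a \<Rightarrow> 'a) \<Rightarrow> 'a \<Rightarrow> real measure" where
  "scalar_spectral_measure H E x =
     measure_of UNIV (sets borel) (\<lambda>B. ennreal (Re (hinner H x (E B x))))"

text \<open>
  \<open>T\<close> is the integral of \<open>f\<close> with respect to \<open>E\<close>, defined as in Reed and Simon through its domain
  and its quadratic form; by polarization this determines a linear \<open>T\<close> on its domain.
\<close>

definition is_spectral_integral ::
    "'a::ab_group_add hilbert \<Rightarrow> (real set \<Rightarrow> 'a \<Rightarrow> 'a) \<Rightarrow> (real \<Rightarrow> complex) \<Rightarrow> 'a operator \<Rightarrow> bool" where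
  "is_spectral_integral H E f T \<longleftrightarrow>
     linear_operator H T \<and>
     op_dom T = {x \<in> hcarrier H.
                   integrable (scalar_spectral_measure H E x) (\<lambda>s. (cmod (f s))\<^sup>2)} \<and>
     (\<forall>x\<in>op_dom T. hinner H x (op_app T x) = (LINT s|scalar_spectral_measure H E x. f s))"

text \<open>
  The spectral theorem states that each self-adjoint operator has exactly one spectral measure;
  the choice operator is needed because \<open>E B x\<close> is unconstrained for non-Borel \<open>B\<close> and for \<open>x\<close>
  outside the carrier. The same applies to \<open>functional_calculus\<close> and values outside the domain.
\<close>

definition spectral_measure ::
    "'a::ab_group_add hilbert \<Rightarrow> 'a operator \<Rightarrow> real set \<Rightarrow> 'a \<Rightarrow> 'a" where
  "spectral_measure H A =
     (SOME E. projection_valued_measure H E \<and> is_spectral_integral H E complex_of_real A)"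

definition functional_calculus ::
    "'a::ab_group_add hilbert \<Rightarrow> 'a operator \<Rightarrow> (real \<Rightarrow> complex) \<Rightarrow> 'a operator" where
  "functional_calculus H A f = (SOME T. is_spectral_integral H (spectral_measure H A) f T)"

definition exp_operator :: "'a::ab_group_add hilbert \<Rightarrow> complex \<Rightarrow> 'a operator \<Rightarrow> 'a \<Rightarrow> 'a" where
  "exp_operator H c A = op_app (functional_calculus H A (\<lambda>s. exp (c * complex_of_real s)))"

section \<open>Generalized resolvent convergence\<close>

definition common_resolvent_set ::
    "'a::ab_group_add hilbert \<Rightarrow> (nat \<Rightarrow> 'b::ab_group_add hilbert) \<Rightarrow>
     (nat \<Rightarrow> 'b operator) \<Rightarrow> 'a operator \<Rightarrow> complex set" where
  "common_resolvent_set H Hn An A =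
     - closure (spectrum H A \<union> (\<Union>n. spectrum (Hn n) (An n)))"

definition generalized_norm_resolvent_convergence ::
    "'a::ab_group_add hilbert \<Rightarrow> (nat \<Rightarrow> 'b::ab_group_add hilbert) \<Rightarrow> (nat \<Rightarrow> 'a \<Rightarrow> 'b) \<Rightarrow>
     (nat \<Rightarrow> 'b operator) \<Rightarrow> 'a operator \<Rightarrow> bool" where
  "generalized_norm_resolvent_convergence H Hn J An A \<longleftrightarrow>
     (\<exists>C>0. \<forall>n. operator_norm H (Hn n) (J n) \<le> C) \<and>
     (\<forall>n. operator_norm H H (\<lambda>x. bounded_adjoint H (Hn n) (J n) (J n x) - x) =
          operator_norm (Hn n) (Hn n) (\<lambda>y. J n (bounded_adjoint H (Hn n) (J n) y) - y)) \<and>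
     (\<lambda>n. operator_norm H H (\<lambda>x. bounded_adjoint H (Hn n) (J n) (J n x) - x)) \<longlonglongrightarrow> 0 \<and>
     (\<exists>z\<in>common_resolvent_set H Hn An A.
        (\<lambda>n. operator_norm H H (\<lambda>x.
           bounded_adjoint H (Hn n) (J n) (resolvent (Hn n) (An n) z (J n x))
             - resolvent H A z x)) \<longlonglongrightarrow> 0)"

text \<open>
  The strong notion requires the point \<open>z\<close> to be non-real. Nothing is assumed here about
  \<open>J n \<circ> (J n)\<^sup>*\<close>, and convergence at a single real point of the common resolvent set carries no
  information about the exponentials. Take \<open>H = \<complex>\<close>, \<open>A = 1\<close>, \<open>z = 0\<close>, and for all \<open>n\<close> let
  \<open>Hn n = \<complex>\<^sup>2\<close>, \<open>J n c = (c, 0)\<close> and \<open>An n\<close> the inverse of the matrix with rows \<open>(1, 1)\<close>, \<open>(1, 5)\<close>: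
  the compressed resolvents at 0 agree with that of \<open>A\<close>, but the compression of \<open>An n\<close>
  itself is \<open>5/4\<close>, so the compressed exponentials do not converge to those of \<open>A\<close>.
\<close>

definition generalized_strong_resolvent_convergence ::
    "'a::ab_group_add hilbert \<Rightarrow> (nat \<Rightarrow> 'b::ab_group_add hilbert) \<Rightarrow> (nat \<Rightarrow> 'a \<Rightarrow> 'b) \<Rightarrow>
     (nat \<Rightarrow> 'b operator) \<Rightarrow> 'a operator \<Rightarrow> bool" where
  "generalized_strong_resolvent_convergence H Hn J An A \<longleftrightarrow>
     (\<exists>C>0. \<forall>n. operator_norm H (Hn n) (J n) \<le> C) \<and>
     (\<forall>x\<in>hcarrier H.
        (\<lambda>n. hnorm H (bounded_adjoint H (Hn n) (J n) (J n x) - x)) \<longlonglongrightarrow> 0) \<and>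
     (\<exists>z\<in>common_resolvent_set H Hn An A. z \<notin> \<real> \<and>
        (\<forall>x\<in>hcarrier H.
           (\<lambda>n. hnorm H (bounded_adjoint H (Hn n) (J n) (resolvent (Hn n) (An n) z (J n x))
             - resolvent H A z x)) \<longlonglongrightarrow> 0))"

end

theory Submission
  imports Defs "HOL-Probability.Probability"
begin

text \<open>
  By the resolvent identity, compressed resolvents that converge strongly at a non-real point also
  satisfy \<open>R\<^sub>n J\<^sub>n x - J\<^sub>n R x \<rightarrow> 0\<close>, because the norms \<open>\<parallel>R\<^sub>n J\<^sub>n x\<parallel>\<^sup>2\<close> are multiples of the imaginary parts
  of \<open>\<langle>J\<^sub>n x, R\<^sub>n J\<^sub>n x\<rangle>\<close>. This intertwining relation and its adjoint pass to polynomials in the resolvent and its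
  adjoint, hence by Stone--Weierstrass to continuous functions vanishing at infinity, and it holds in norm if
  \<open>J\<^sub>n J\<^sub>n\<^sup>* \<rightarrow> 1\<close> in norm. On a half line \<open>exp (- t s)\<close> is such a function; for \<open>exp (\<i> t s)\<close> one multiplies
  by the resolvent, whose range is dense.

  The operators \<open>exp_operator\<close> are defined through a spectral measure, so the spectral theorem is needed first.
  For the Cayley transform \<open>U\<close> of \<open>A\<close>, the measures with Fourier coefficients \<open>\<langle>x, U\<^sup>m x\<rangle>\<close> are weak limits of
  Fejer means. Moved to the line, they represent polynomials in the resolvent, and the functions that
  they represent are closed under bounded pointwise limits, which yields the bounded Borel calculus.
\<close>

section \<open>Geometry of Hilbert spaces\<close>

text \<open>The quantity that is sent to 0 is the intertwining defect
  \<open>f(A_n) J_n - J_n f(A)\<close>, not the error of the compression: compressions are not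
  multiplicative in \<open>f\<close> unless \<open>J_n J_n\<^sup>*\<close> is near the identity, of
  which the strong assumptions say nothing. The defect obeys a product rule, and applying the
  adjoint of \<open>J_n\<close> recovers the compression at the end. In the norm case
  \<open>z\<close> may be real, so \<open>1 / (s - z)\<close> need not be bounded on the line. Since
  \<open>z\<close> keeps a positive distance from the closure of all the spectra, one closed set
  \<open>L\<close> carries every spectral measure, and functions are only compared on
  \<open>L\<close>. For the semigroup \<open>L\<close> moreover lies in a half line.
  \<open>spectral_measure\<close> and \<open>functional_calculus\<close> are choices, so only their
  defining properties can be used. The calculus is therefore built over an abstract family of
  measures and instantiated twice: with measures constructed from the Cayley transform, which shows
  that a spectral measure exists, and with the scalar measures of the one that was chosen.\<close>

context hilbert_space
begin

sublocale vs: vector_space "hscale H"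
  by (rule vector_space_scale)

abbreviation "V \<equiv> hcarrier H"
abbreviation "sc \<equiv> hscale H"
abbreviation "ip \<equiv> hinner H"
abbreviation "nm \<equiv> hnorm H"

lemma zero_in [simp, intro]: "0 \<in> V"
  using subspace_carrier by (rule vs.subspace_0)

lemma add_in [simp, intro]: "x \<in> V \<Longrightarrow> y \<in> V \<Longrightarrow> x + y \<in> V"
  using subspace_carrier by (rule vs.subspace_add)

lemma scale_in [simp, intro]: "x \<in> V \<Longrightarrow> sc c x \<in> V"
  using subspace_carrier by (rule vs.subspace_scale)

lemma uminus_in [simp, intro]: "x \<in> V \<Longrightarrow> - x \<in> V"
  using subspace_carrier by (rule vs.subspace_neg)

lemma diff_in [simp, intro]: "x \<in> V \<Longrightarrow> y \<in> V \<Longrightarrow> x - y \<in> V"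
  using subspace_carrier by (rule vs.subspace_diff)

lemma sum_in [simp, intro]: "(\<And>i. i \<in> I \<Longrightarrow> f i \<in> V) \<Longrightarrow> sum f I \<in> V"
  using subspace_carrier by (rule vs.subspace_sum)

lemma inner_add_left: "x \<in> V \<Longrightarrow> y \<in> V \<Longrightarrow> z \<in> V \<Longrightarrow> ip (x + y) z = ip x z + ip y z"
  by (subst (1 2 3) inner_commute) (auto simp: inner_add_right)

lemma inner_scale_left: "x \<in> V \<Longrightarrow> y \<in> V \<Longrightarrow> ip (sc c x) y = cnj c * ip x y"
  by (subst (1 2) inner_commute) (auto simp: inner_scale_right)

lemma uminus_eq_scale: "- x = sc (- 1) x"
  by simp

lemma inner_minus_right: "x \<in> V \<Longrightarrow> y \<in> V \<Longrightarrow> ip x (- y) = - ip x y"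
  by (simp only: uminus_eq_scale inner_scale_right) simp

lemma inner_minus_left: "x \<in> V \<Longrightarrow> y \<in> V \<Longrightarrow> ip (- x) y = - ip x y"
  by (simp only: uminus_eq_scale inner_scale_left) simp

lemma inner_diff_right: "x \<in> V \<Longrightarrow> y \<in> V \<Longrightarrow> z \<in> V \<Longrightarrow> ip x (y - z) = ip x y - ip x z"
  using inner_add_right[of x y "- z"] by (simp add: inner_minus_right)

lemma inner_diff_left: "x \<in> V \<Longrightarrow> y \<in> V \<Longrightarrow> z \<in> V \<Longrightarrow> ip (x - y) z = ip x z - ip y z"
  using inner_add_left[of x "- y" z] by (simp add: inner_minus_left)

lemma inner_zero_right [simp]: "x \<in> V \<Longrightarrow> ip x 0 = 0"
  using inner_diff_right[of x 0 0] by simp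

lemma inner_zero_left [simp]: "x \<in> V \<Longrightarrow> ip 0 x = 0"
  using inner_diff_left[of 0 0 x] by simp

lemma inner_sum_right: "x \<in> V \<Longrightarrow> (\<And>i. i \<in> I \<Longrightarrow> f i \<in> V) \<Longrightarrow> ip x (sum f I) = (\<Sum>i\<in>I. ip x (f i))"
  by (induction I rule: infinite_finite_induct) (auto simp: inner_add_right)

lemma inner_sum_left: "x \<in> V \<Longrightarrow> (\<And>i. i \<in> I \<Longrightarrow> f i \<in> V) \<Longrightarrow> ip (sum f I) x = (\<Sum>i\<in>I. ip (f i) x)"
  by (induction I rule: infinite_finite_induct) (auto simp: inner_add_left)

lemma inner_sum_sum:
  assumes "\<And>i. i \<in> I \<Longrightarrow> f i \<in> V" "\<And>j. j \<in> K \<Longrightarrow> g j \<in> V"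
  shows "ip (sum f I) (sum g K) = (\<Sum>i\<in>I. \<Sum>j\<in>K. ip (f i) (g j))"
proof -
  have "ip (sum f I) (sum g K) = (\<Sum>i\<in>I. ip (f i) (sum g K))"
    using assms by (intro inner_sum_left) auto
  also have "\<dots> = (\<Sum>i\<in>I. \<Sum>j\<in>K. ip (f i) (g j))"
    using assms by (intro sum.cong refl inner_sum_right) auto
  finally show ?thesis .
qed

lemmas inner_simps = inner_add_left inner_add_right inner_diff_left inner_diff_right
  inner_scale_left inner_scale_right inner_minus_left inner_minus_right

lemma inner_self_nonneg: "x \<in> V \<Longrightarrow> 0 \<le> Re (ip x x)"
  using inner_pos[of x] by (cases "x = 0") auto

lemma hnorm_sq: "x \<in> V \<Longrightarrow> (nm x)\<^sup>2 = Re (ip x x)"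
  by (simp add: hnorm_def inner_self_nonneg)

lemma inner_self: "x \<in> V \<Longrightarrow> ip x x = complex_of_real ((nm x)\<^sup>2)"
proof -
  assume x: "x \<in> V"
  have "Im (ip x x) = 0"
    using arg_cong[OF inner_commute[OF x x], of Im] by simp
  then show ?thesis
    using x by (simp add: hnorm_sq complex_eq_iff)
qed

lemma hnorm_nonneg [simp]: "x \<in> V \<Longrightarrow> 0 \<le> nm x"
  by (simp add: hnorm_def inner_self_nonneg)

lemma hnorm_zero [simp]: "nm 0 = 0"
  by (simp add: hnorm_def)

lemma hnorm_eq_zero: "x \<in> V \<Longrightarrow> nm x = 0 \<longleftrightarrow> x = 0"
  using inner_pos[of x] hnorm_sq[of x] by (cases "x = 0") auto

lemma eq_zero_if_orthogonal:
  assumes "x \<in> V" "\<And>y. y \<in> V \<Longrightarrow> ip y x = 0"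
  shows "x = 0"
  using assms(2)[OF assms(1)] inner_self[OF assms(1)] hnorm_eq_zero[OF assms(1)] by simp

lemma eq_if_inner_eq:
  assumes "x \<in> V" "y \<in> V" "\<And>u. u \<in> V \<Longrightarrow> ip u x = ip u y"
  shows "x = y"
  using eq_zero_if_orthogonal[of "x - y"] assms by (simp add: inner_simps)

lemma hnorm_scale: "x \<in> V \<Longrightarrow> nm (sc c x) = cmod c * nm x"
proof (rule power2_eq_imp_eq)
  assume x: "x \<in> V"
  have "(nm (sc c x))\<^sup>2 = Re ((c * cnj c) * ip x x)"
    using x by (simp only: hnorm_sq inner_simps scale_in) (simp add: mult_ac)
  also have "\<dots> = (cmod c * nm x)\<^sup>2"
    unfolding inner_self[OF x] complex_norm_square[symmetric] by (simp add: power_mult_distrib)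
  finally show "(nm (sc c x))\<^sup>2 = (cmod c * nm x)\<^sup>2" .
qed auto

lemma hnorm_minus [simp]: "x \<in> V \<Longrightarrow> nm (- x) = nm x"
  by (simp only: uminus_eq_scale hnorm_scale) simp

lemma hnorm_diff_commute: "x \<in> V \<Longrightarrow> y \<in> V \<Longrightarrow> nm (x - y) = nm (y - x)"
  using hnorm_minus[of "x - y"] by simp

lemma hnorm_add_sq:
  "x \<in> V \<Longrightarrow> y \<in> V \<Longrightarrow> (nm (x + y))\<^sup>2 = (nm x)\<^sup>2 + (nm y)\<^sup>2 + 2 * Re (ip x y)"
  using inner_commute[of y x] by (simp add: hnorm_sq inner_simps)

lemma hnorm_diff_sq:
  "x \<in> V \<Longrightarrow> y \<in> V \<Longrightarrow> (nm (x - y))\<^sup>2 = (nm x)\<^sup>2 + (nm y)\<^sup>2 - 2 * Re (ip x y)"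
  using hnorm_add_sq[of x "- y"] by (simp add: inner_simps)

lemma Cauchy_Schwarz:
  assumes x: "x \<in> V" and y: "y \<in> V"
  shows "cmod (ip x y) \<le> nm x * nm y"
proof (cases "x = 0")
  case True
  then show ?thesis using y by simp
next
  case False
  then have p: "0 < (nm x)\<^sup>2" using x by (simp add: hnorm_eq_zero)
  define c where "c = ip x y / complex_of_real ((nm x)\<^sup>2)"
  have "(nm (y - sc c x))\<^sup>2 = (nm y)\<^sup>2 + (cmod c * nm x)\<^sup>2 - 2 * Re (c * ip y x)"
    using x y by (simp add: hnorm_diff_sq hnorm_scale inner_simps)
  also have "c * ip y x = complex_of_real ((cmod (ip x y))\<^sup>2 / (nm x)\<^sup>2)"
    unfolding c_def inner_commute[OF y x] times_divide_eq_left complex_norm_square[symmetric]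
    by simp
  also have "(cmod c * nm x)\<^sup>2 = (cmod (ip x y))\<^sup>2 / (nm x)\<^sup>2"
    using p x unfolding c_def norm_divide norm_of_real
    by (simp add: power_mult_distrib power_divide power2_eq_square)
  finally have "0 \<le> (nm y)\<^sup>2 - (cmod (ip x y))\<^sup>2 / (nm x)\<^sup>2"
    using zero_le_power2[of "nm (y - sc c x)"] by simp
  then have "(cmod (ip x y))\<^sup>2 \<le> (nm x * nm y)\<^sup>2"
    using p by (simp add: field_simps power_mult_distrib)
  then show ?thesis
    using x y by (metis power2_le_imp_le mult_nonneg_nonneg hnorm_nonneg)
qed

lemma hnorm_triangle: "x \<in> V \<Longrightarrow> y \<in> V \<Longrightarrow> nm (x + y) \<le> nm x + nm y"
proof (rule power2_le_imp_le)
  assume x: "x \<in> V" and y: "y \<in> V"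
  show "(nm (x + y))\<^sup>2 \<le> (nm x + nm y)\<^sup>2"
    using Cauchy_Schwarz[OF x y] complex_Re_le_cmod[of "ip x y"]
    by (simp add: hnorm_add_sq x y power2_sum)
qed auto

lemma hnorm_diff_le: "x \<in> V \<Longrightarrow> y \<in> V \<Longrightarrow> nm (x - y) \<le> nm x + nm y"
  using hnorm_triangle[of x "- y"] by simp

lemma hnorm_triangle_sub: "x \<in> V \<Longrightarrow> y \<in> V \<Longrightarrow> z \<in> V \<Longrightarrow> nm (x - z) \<le> nm (x - y) + nm (y - z)"
  using hnorm_triangle[of "x - y" "y - z"] by simp

lemma hnorm_triangle_ineq3: "x \<in> V \<Longrightarrow> y \<in> V \<Longrightarrow> \<bar>nm x - nm y\<bar> \<le> nm (x - y)"
  using hnorm_triangle[of "x - y" y] hnorm_triangle[of "y - x" x] hnorm_diff_commute[of x y] by auto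

lemma hnorm_tendsto:
  assumes "\<And>n. X n \<in> V" "x \<in> V" "(\<lambda>n. nm (X n - x)) \<longlonglongrightarrow> 0"
  shows "(\<lambda>n. nm (X n)) \<longlonglongrightarrow> nm x"
proof -
  have "(\<lambda>n. nm (X n) - nm x) \<longlonglongrightarrow> 0"
    by (rule Lim_null_comparison[OF _ assms(3)]) (simp add: hnorm_triangle_ineq3 assms(1,2))
  then show ?thesis by (simp add: LIM_zero_iff)
qed

lemma inner_tendsto:
  assumes X: "\<And>n. X n \<in> V" "x \<in> V" "(\<lambda>n. nm (X n - x)) \<longlonglongrightarrow> 0"
    and Y: "\<And>n. Y n \<in> V" "y \<in> V" "(\<lambda>n. nm (Y n - y)) \<longlonglongrightarrow> 0"
  shows "(\<lambda>n. ip (X n) (Y n)) \<longlonglongrightarrow> ip x y"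
proof -
  have b: "cmod (ip (X n) (Y n) - ip x y) \<le> nm (X n - x) * nm (Y n) + nm x * nm (Y n - y)" for n
  proof -
    have "ip (X n) (Y n) - ip x y = ip (X n - x) (Y n) + ip x (Y n - y)"
      using X(1,2) Y(1,2) by (simp add: inner_simps)
    then show ?thesis
      using Cauchy_Schwarz[of "X n - x" "Y n"] Cauchy_Schwarz[of x "Y n - y"] X(1)[of n] X(2) Y(1)[of n] Y(2)
        norm_triangle_ineq[of "ip (X n - x) (Y n)" "ip x (Y n - y)"] by simp
  qed
  have "(\<lambda>n. nm (X n - x) * nm (Y n) + nm x * nm (Y n - y)) \<longlonglongrightarrow> 0 * nm y + nm x * 0"
    by (intro tendsto_intros X Y hnorm_tendsto)
  then have "(\<lambda>n. ip (X n) (Y n) - ip x y) \<longlonglongrightarrow> 0"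
    using b by (intro Lim_null_comparison[where f = "\<lambda>n. ip (X n) (Y n) - ip x y"]) auto
  then show ?thesis by (simp add: LIM_zero_iff)
qed

lemma limit_unique:
  assumes "\<And>n. X n \<in> V" "x \<in> V" "y \<in> V"
    "(\<lambda>n. nm (X n - x)) \<longlonglongrightarrow> 0" "(\<lambda>n. nm (X n - y)) \<longlonglongrightarrow> 0"
  shows "x = y"
proof -
  have "(\<lambda>n. nm (X n - x) + nm (X n - y)) \<longlonglongrightarrow> 0 + 0"
    by (intro tendsto_intros assms)
  moreover have "nm (x - y) \<le> nm (X n - x) + nm (X n - y)" for n
    using hnorm_triangle_sub[of x "X n" y] hnorm_diff_commute[of x "X n"] assms(1)[of n] assms(2,3) by simp
  ultimately have "nm (x - y) \<le> 0"
    by (intro LIMSEQ_le_const[of _ 0]) auto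
  then have "nm (x - y) = 0" using assms(2,3) by (intro order_antisym) auto
  then show ?thesis using assms(2,3) by (simp add: hnorm_eq_zero)
qed

section \<open>Sesquilinear forms and polarization\<close>

definition sesquilinear :: "('a \<Rightarrow> 'a \<Rightarrow> complex) \<Rightarrow> bool" where
  "sesquilinear B \<longleftrightarrow>
     (\<forall>x\<in>V. \<forall>y\<in>V. \<forall>z\<in>V. B x (y + z) = B x y + B x z \<and> B (x + y) z = B x z + B y z) \<and>
     (\<forall>c. \<forall>x\<in>V. \<forall>y\<in>V. B x (sc c y) = c * B x y \<and> B (sc c x) y = cnj c * B x y)"

text \<open>Defined for an arbitrary \<open>q\<close>, not only for the diagonal of a form: later
  \<open>q x\<close> is an integral with respect to a measure depending on \<open>x\<close>, and
  only a limit argument shows that it is quadratic. The signs belong to forms that are conjugate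
  linear in the first argument.\<close>

definition polar :: "('a \<Rightarrow> complex) \<Rightarrow> 'a \<Rightarrow> 'a \<Rightarrow> complex" where
  "polar q x y =
     (q (x + y) - q (x - y) - \<i> * q (x + sc \<i> y) + \<i> * q (x - sc \<i> y)) / 4"

lemma polarization:
  assumes "sesquilinear B" "x \<in> V" "y \<in> V"
  shows "B x y = polar (\<lambda>x. B x x) x y"
proof -
  have s: "B u (v + w) = B u v + B u w" "B (u + v) w = B u w + B v w"
      "B u (sc c v) = c * B u v" "B (sc c u) v = cnj c * B u v"
    if "u \<in> V" "v \<in> V" "w \<in> V" for u v w c
    using assms(1) that unfolding sesquilinear_def by blast+
  have d: "x - y = x + sc (- 1) y" "x - sc \<i> y = x + sc (- \<i>) y" by auto
  show ?thesis
    unfolding polar_def d using assms(2,3) by (simp add: s algebra_simps del: vs.scale_minus_left vs.scale_one)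
qed

lemma polar_cong: "(\<And>x. x \<in> V \<Longrightarrow> q x = q' x) \<Longrightarrow> x \<in> V \<Longrightarrow> y \<in> V \<Longrightarrow> polar q x y = polar q' x y"
  by (simp add: polar_def)

lemma polar_tendsto:
  assumes "\<And>x. x \<in> V \<Longrightarrow> (\<lambda>n. q n x) \<longlonglongrightarrow> q' x" "x \<in> V" "y \<in> V"
  shows "(\<lambda>n. polar (q n) x y) \<longlonglongrightarrow> polar q' x y"
  unfolding polar_def using assms(2,3) by (intro tendsto_intros assms(1)) auto

text \<open>By the parallelogram law the four squared norms add up to
  \<open>4 * ((nm x)\<^sup>2 + (nm y)\<^sup>2)\<close>, which cancels the 4 in
  \<open>polar\<close>.\<close>

lemma cmod_polar_le:
  assumes "\<And>x. x \<in> V \<Longrightarrow> cmod (q x) \<le> C * (nm x)\<^sup>2" "x \<in> V" "y \<in> V"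
  shows "cmod (polar q x y) \<le> C * ((nm x)\<^sup>2 + (nm y)\<^sup>2)"
proof -
  have "cmod (polar q x y) * 4 \<le> cmod (q (x + y)) + cmod (q (x - y))
      + cmod (q (x + sc \<i> y)) + cmod (q (x - sc \<i> y))"
    unfolding polar_def
    using norm_triangle_ineq4[of "q (x + y)" "q (x - y)"]
      norm_triangle_ineq4[of "q (x + y) - q (x - y)" "\<i> * q (x + sc \<i> y)"]
      norm_triangle_ineq[of "q (x + y) - q (x - y) - \<i> * q (x + sc \<i> y)" "\<i> * q (x - sc \<i> y)"]
    by (simp add: norm_divide norm_mult)
  also have "\<dots> \<le> C * (nm (x + y))\<^sup>2 + C * (nm (x - y))\<^sup>2 + C * (nm (x + sc \<i> y))\<^sup>2 + C * (nm (x - sc \<i> y))\<^sup>2"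
    using assms(2,3) by (intro add_mono assms(1)) auto
  also have "\<dots> = 4 * (C * ((nm x)\<^sup>2 + (nm y)\<^sup>2))"
    using assms(2,3) by (simp add: hnorm_add_sq hnorm_diff_sq hnorm_scale algebra_simps)
  finally show ?thesis by simp
qed

text \<open>Polarization bounds \<open>B\<close> on unit vectors by \<open>C * (1 + 1)\<close>,
  whence the factor 2; homogeneity does the rest.\<close>

lemma sesquilinear_bound:
  assumes B: "sesquilinear B" and b: "\<And>x. x \<in> V \<Longrightarrow> cmod (B x x) \<le> C * (nm x)\<^sup>2" and x: "x \<in> V" and y: "y \<in> V"
  shows "cmod (B x y) \<le> 2 * C * nm x * nm y"
proof (cases "x = 0 \<or> y = 0")
  case True
  have "B x (sc 0 y) = 0 * B x y" "B (sc 0 x) y = cnj 0 * B x y"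
    using B x y unfolding sesquilinear_def by blast+
  then show ?thesis using True by auto
next
  case False
  define a where "a = complex_of_real (1 / nm x)"
  define c where "c = complex_of_real (1 / nm y)"
  have p: "nm x > 0" "nm y > 0"
    using False x y by (simp_all add: hnorm_eq_zero less_le)
  have n: "nm (sc a x) = 1" "nm (sc c y) = 1"
    using p x y by (simp_all add: hnorm_scale a_def c_def norm_divide)
  have "B (sc a x) (sc c y) = cnj a * c * B x y"
    using B x y unfolding sesquilinear_def by auto
  moreover have "cmod (B (sc a x) (sc c y)) \<le> C * (1\<^sup>2 + 1\<^sup>2)"
    unfolding polarization[OF B scale_in[OF x] scale_in[OF y]]
    using cmod_polar_le[of "\<lambda>x. B x x" C "sc a x" "sc c y"] b x y unfolding n by blast
  ultimately have "cmod (cnj a * c * B x y) \<le> 2 * C" by simp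
  moreover have "cmod (cnj a * c * B x y) = cmod (B x y) / (nm x * nm y)"
    using p unfolding a_def c_def by (simp add: norm_mult norm_divide)
  ultimately show ?thesis
    using p by (simp add: pos_divide_le_eq mult.assoc)
qed

lemma linear_bounded_tendsto:
  assumes add: "\<And>x y. x \<in> V \<Longrightarrow> y \<in> V \<Longrightarrow> \<phi> (x - y) = \<phi> x - \<phi> y"
    and bd: "\<And>x. x \<in> V \<Longrightarrow> cmod (\<phi> x) \<le> M * nm x"
    and X: "\<And>n. X n \<in> V" "x \<in> V" "(\<lambda>n. nm (X n - x)) \<longlonglongrightarrow> 0"
  shows "(\<lambda>n. \<phi> (X n)) \<longlonglongrightarrow> \<phi> x"
proof -
  have "(\<lambda>n. M * nm (X n - x)) \<longlonglongrightarrow> M * 0"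
    by (intro tendsto_intros X)
  then have "(\<lambda>n. \<phi> (X n) - \<phi> x) \<longlonglongrightarrow> 0"
    using X(1,2) bd[of "X n - x" for n] add[of "X n" x for n]
    by (intro Lim_null_comparison[where f = "\<lambda>n. \<phi> (X n) - \<phi> x"]) auto
  then show ?thesis by (simp add: LIM_zero_iff)
qed

text \<open>The representing vector is the minimizer of \<open>Q\<close>: the parallelogram law
  makes minimizing sequences Cauchy, and a first variation at the minimum gives the representation.
  This avoids orthogonal complements.\<close>

theorem Riesz_representation:
  assumes add: "\<And>x y. x \<in> V \<Longrightarrow> y \<in> V \<Longrightarrow> \<phi> (x + y) = \<phi> x + \<phi> y"
    and scale: "\<And>c x. x \<in> V \<Longrightarrow> \<phi> (sc c x) = c * \<phi> x"
    and bd: "\<And>x. x \<in> V \<Longrightarrow> cmod (\<phi> x) \<le> M * nm x"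
  shows "\<exists>!x. x \<in> V \<and> (\<forall>u\<in>V. ip x u = \<phi> u)"
proof -
  define Q where "Q x = (nm x)\<^sup>2 - 2 * Re (\<phi> x)" for x
  define d where "d = Inf (Q ` V)"
  have diff: "\<phi> (x - y) = \<phi> x - \<phi> y" if "x \<in> V" "y \<in> V" for x y
    using add[of x "sc (- 1) y"] scale[of y "- 1"] that by simp
  \<comment> \<open>Completing the square:
    \<open>Q x \<ge> (nm x - M)\<^sup>2 - M\<^sup>2\<close>.\<close>
  have low: "- (M\<^sup>2) \<le> Q x" if "x \<in> V" for x
  proof -
    have "Re (\<phi> x) \<le> M * nm x"
      using bd[OF that] complex_Re_le_cmod[of "\<phi> x"] by linarith
    moreover have "0 \<le> (nm x - M)\<^sup>2" by simp
    ultimately show ?thesis unfolding Q_def by (simp add: power2_diff algebra_simps)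
  qed
  then have bb: "bdd_below (Q ` V)" by (auto intro!: bdd_belowI[of _ "- (M\<^sup>2)"])
  have dle: "d \<le> Q x" if "x \<in> V" for x
    unfolding d_def using bb that by (intro cInf_lower) auto
  have "\<exists>x\<in>V. Q x < d + 1 / (real n + 1)" for n
  proof (rule ccontr)
    assume "\<not> ?thesis"
    then have "d + 1 / (real n + 1) \<le> Inf (Q ` V)"
      by (intro cInf_greatest) (auto simp: not_less)
    then show False unfolding d_def by (simp add: field_simps)
  qed
  then obtain X where X: "X n \<in> V" "Q (X n) < d + 1 / (real n + 1)" for n by metis
  have mid: "(nm (X m - X n))\<^sup>2 \<le> 2 / (real m + 1) + 2 / (real n + 1)" for m n
  proof -
    have *: "nm (sc (1/2) (X m + X n)) = nm (X m + X n) / 2" "\<phi> (sc (1/2) (X m + X n)) = (\<phi> (X m) + \<phi> (X n)) / 2"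
      using X by (simp_all add: hnorm_scale scale add del: vs.scale_right_distrib)
    have "(nm (X m - X n))\<^sup>2 = 2 * Q (X m) + 2 * Q (X n) - 4 * Q (sc (1/2) (X m + X n))"
      using X(1) unfolding Q_def *
      by (simp add: hnorm_add_sq hnorm_diff_sq power_divide field_simps)
    also have "\<dots> \<le> 2 * (d + 1 / (real m + 1)) + 2 * (d + 1 / (real n + 1)) - 4 * d"
      using X[of m] X[of n] dle[of "sc (1/2) (X m + X n)"] by (intro diff_mono add_mono mult_left_mono) auto
    finally show ?thesis by simp
  qed
  have "\<exists>N. \<forall>m\<ge>N. \<forall>n\<ge>N. nm (X m - X n) < e" if "e > 0" for e
  proof -
    obtain N :: nat where N: "4 / e\<^sup>2 < real N" using reals_Archimedean2 by blast
    have "nm (X m - X n) < e" if "m \<ge> N" "n \<ge> N" for m n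
    proof (rule power2_less_imp_less)
      have "2 / (real m + 1) + 2 / (real n + 1) \<le> 2 / (real N + 1) + 2 / (real N + 1)"
        using that by (intro add_mono divide_left_mono) auto
      also have "\<dots> = 4 / (real N + 1)" by simp
      also have "\<dots> < e\<^sup>2"
        using N \<open>e > 0\<close> by (simp add: field_simps) (smt (verit) zero_less_power2)
      finally show "(nm (X m - X n))\<^sup>2 < e\<^sup>2" using mid[of m n] by linarith
    qed (use \<open>e > 0\<close> in auto)
    then show ?thesis by blast
  qed
  then obtain x where x: "x \<in> V" "(\<lambda>n. nm (X n - x)) \<longlonglongrightarrow> 0"
    using complete_carrier[of X] X(1) by blast
  have "(\<lambda>n. Q (X n)) \<longlonglongrightarrow> Q x"
    unfolding Q_def using X(1) x
    by (intro tendsto_intros hnorm_tendsto linear_bounded_tendsto[of \<phi> M]) (auto intro: diff bd)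
  moreover have "(\<lambda>n. d + 1 / (real n + 1)) \<longlonglongrightarrow> d"
    using tendsto_add[OF tendsto_const lim_inverse_n', of d] LIMSEQ_Suc[of "\<lambda>n. d + 1 / real n" "d + 0"]
    by (simp add: add.commute)
  ultimately have Qx: "Q x \<le> d"
    using X(2) by (intro LIMSEQ_le) (auto intro: less_imp_le)
  have rep: "ip x u = \<phi> u" if u: "u \<in> V" for u
  proof -
    define w where "w = ip x u - \<phi> u"
    \<comment> \<open>Adding \<open>sc c u\<close> to the minimizer changes \<open>Q\<close> by
      \<open>r * (cmod w)\<^sup>2 * (r * (nm u)\<^sup>2 - 2)\<close>; this \<open>r\<close> keeps
      the last factor negative, so minimality forces \<open>w = 0\<close>.\<close>
    define r where "r = 1 / (1 + (nm u)\<^sup>2)"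
    define c where "c = - complex_of_real r * cnj w"
    have "0 \<le> Q (x + sc c u) - Q x"
      using dle[of "x + sc c u"] Qx x(1) u by auto
    also have "\<dots> = (cmod c * nm u)\<^sup>2 + 2 * Re (c * w)"
      unfolding Q_def w_def using x(1) u
      by (simp add: hnorm_add_sq hnorm_scale inner_simps add scale algebra_simps)
    also have "Re (c * w) = - r * (cmod w)\<^sup>2"
      unfolding c_def mult.assoc mult.commute[of "cnj w"] complex_norm_square[symmetric] by simp
    also have "(cmod c * nm u)\<^sup>2 = r * (cmod w)\<^sup>2 * (r * (nm u)\<^sup>2)"
    proof -
      have "r \<ge> 0" unfolding r_def by simp
      then have "cmod c = r * cmod w" unfolding c_def by (simp add: norm_mult)
      then show ?thesis by (simp add: power_mult_distrib power2_eq_square)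
    qed
    finally have 1: "0 \<le> r * (cmod w)\<^sup>2 * (r * (nm u)\<^sup>2 - 2)" by (simp add: algebra_simps)
    have r: "r > 0" "r * (nm u)\<^sup>2 < 2"
      unfolding r_def by (auto simp: field_simps add_pos_nonneg)
    then have "(cmod w)\<^sup>2 \<le> 0"
      using 1 by (smt (verit) mult_pos_neg mult_pos_pos)
    then show ?thesis by (simp add: w_def)
  qed
  show ?thesis
  proof (rule ex1I[of _ x])
    show "x \<in> V \<and> (\<forall>u\<in>V. ip x u = \<phi> u)" using x rep by blast
    fix y assume y: "y \<in> V \<and> (\<forall>u\<in>V. ip y u = \<phi> u)"
    show "y = x"
    proof (rule eq_if_inner_eq)
      fix u assume "u \<in> V"
      then show "ip u y = ip u x"
        using y x(1) rep by (subst (1 2) inner_commute) auto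
    qed (use x y in auto)
  qed
qed

end

section \<open>Bounded operators\<close>

lemma bounded_operatorD:
  assumes "bounded_operator H K T"
  shows "x \<in> hcarrier H \<Longrightarrow> T x \<in> hcarrier K"
    and "x \<in> hcarrier H \<Longrightarrow> y \<in> hcarrier H \<Longrightarrow> T (x + y) = T x + T y"
    and "x \<in> hcarrier H \<Longrightarrow> T (hscale H c x) = hscale K c (T x)"
  using assms unfolding bounded_operator_def by auto

section \<open>Adjoints and operator norms between two spaces\<close>

locale hilbert_space_pair = dom: hilbert_space H + cod: hilbert_space K
  for H :: "'a::ab_group_add hilbert" and K :: "'b::ab_group_add hilbert"
begin

lemma bounded_operator_diff:
  assumes "bounded_operator H K T" "x \<in> hcarrier H" "y \<in> hcarrier H"
  shows "T (x - y) = T x - T y"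
proof -
  have "T (x - y) + T y = T x"
    using bounded_operatorD(2)[OF assms(1), of "x - y" y] assms(2,3) by simp
  then show ?thesis by (simp add: algebra_simps)
qed

lemma bounded_operator_bound:
  assumes "bounded_operator H K T"
  obtains M where "M \<ge> 0" "\<And>x. x \<in> hcarrier H \<Longrightarrow> hnorm K (T x) \<le> M * hnorm H x"
proof -
  obtain M where M: "\<forall>x\<in>hcarrier H. hnorm K (T x) \<le> M * hnorm H x"
    using assms unfolding bounded_operator_def by blast
  have "hnorm K (T x) \<le> \<bar>M\<bar> * hnorm H x" if "x \<in> hcarrier H" for x
    using M that mult_right_mono[OF abs_ge_self dom.hnorm_nonneg[OF that], of M] by force
  then show ?thesis using that[of "\<bar>M\<bar>"] by simp
qed

lemma bounded_adjoint:
  assumes T: "bounded_operator H K T" and y: "y \<in> hcarrier K"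
  shows bounded_adjoint_in: "bounded_adjoint H K T y \<in> hcarrier H"
    and inner_bounded_adjoint: "u \<in> hcarrier H \<Longrightarrow> hinner H (bounded_adjoint H K T y) u = hinner K y (T u)"
proof -
  note b = bounded_operatorD[OF T]
  obtain M where M: "M \<ge> 0" "\<And>x. x \<in> hcarrier H \<Longrightarrow> hnorm K (T x) \<le> M * hnorm H x"
    using bounded_operator_bound[OF T] by metis
  have "\<exists>!x. x \<in> hcarrier H \<and> (\<forall>u\<in>hcarrier H. hinner H x u = hinner K y (T u))"
  proof (rule dom.Riesz_representation[where M = "hnorm K y * M"])
    fix u assume u: "u \<in> hcarrier H"
    show "cmod (hinner K y (T u)) \<le> hnorm K y * M * hnorm H u"
      using cod.Cauchy_Schwarz[OF y b(1)[OF u]] mult_left_mono[OF M(2)[OF u] cod.hnorm_nonneg[OF y]]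
      by (simp add: mult.assoc)
  qed (use y b cod.inner_add_right cod.inner_scale_right in auto)
  from theI'[OF this] show "bounded_adjoint H K T y \<in> hcarrier H"
    "u \<in> hcarrier H \<Longrightarrow> hinner H (bounded_adjoint H K T y) u = hinner K y (T u)"
    unfolding bounded_adjoint_def by blast+
qed

lemma bounded_adjoint_diff:
  assumes T: "bounded_operator H K T" and y: "y \<in> hcarrier K" "z \<in> hcarrier K"
  shows "bounded_adjoint H K T (y - z) = bounded_adjoint H K T y - bounded_adjoint H K T z"
proof (rule dom.eq_if_inner_eq)
  fix u assume u: "u \<in> hcarrier H"
  have "hinner H (bounded_adjoint H K T (y - z)) u =
      hinner H (bounded_adjoint H K T y - bounded_adjoint H K T z) u"
    using u y bounded_adjoint[OF T] bounded_operatorD(1)[OF T u]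
    by (simp add: dom.inner_diff_left cod.inner_diff_left)
  then show "hinner H u (bounded_adjoint H K T (y - z)) =
      hinner H u (bounded_adjoint H K T y - bounded_adjoint H K T z)"
    using u y bounded_adjoint_in[OF T] by (subst (1 2) dom.inner_commute) auto
qed (use y bounded_adjoint_in[OF T] in auto)

lemma hnorm_bounded_adjoint_le:
  assumes T: "bounded_operator H K T" and y: "y \<in> hcarrier K" and M: "M \<ge> 0"
    "\<And>x. x \<in> hcarrier H \<Longrightarrow> hnorm K (T x) \<le> M * hnorm H x"
  shows "hnorm H (bounded_adjoint H K T y) \<le> M * hnorm K y"
proof -
  let ?z = "bounded_adjoint H K T y"
  have z: "?z \<in> hcarrier H" using bounded_adjoint_in[OF T y] .
  have "(hnorm H ?z)\<^sup>2 = Re (hinner K y (T ?z))"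
    using inner_bounded_adjoint[OF T y z] by (simp add: dom.hnorm_sq[OF z])
  also have "\<dots> \<le> hnorm K y * hnorm K (T ?z)"
    using cod.Cauchy_Schwarz[OF y bounded_operatorD(1)[OF T z]] complex_Re_le_cmod order_trans by blast
  also have "\<dots> \<le> hnorm K y * (M * hnorm H ?z)"
    using M(2)[OF z] y by (intro mult_left_mono) auto
  finally have "hnorm H ?z * hnorm H ?z \<le> (M * hnorm K y) * hnorm H ?z"
    by (simp add: power2_eq_square mult_ac)
  then show ?thesis
    using dom.hnorm_nonneg[OF z] cod.hnorm_nonneg[OF y] M(1)
    by (cases "hnorm H ?z = 0") (auto simp: mult_le_cancel_right)
qed

lemma bounded_operator_adjoint:
  assumes T: "bounded_operator H K T"
  shows "bounded_operator K H (bounded_adjoint H K T)"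
proof -
  obtain M where M: "M \<ge> 0" "\<And>x. x \<in> hcarrier H \<Longrightarrow> hnorm K (T x) \<le> M * hnorm H x"
    using bounded_operator_bound[OF T] by metis
  have in_H: "bounded_adjoint H K T y \<in> hcarrier H" if "y \<in> hcarrier K" for y
    using bounded_adjoint_in[OF T that] .
  have inner: "hinner H u (bounded_adjoint H K T y) = hinner K (T u) y" if "u \<in> hcarrier H" "y \<in> hcarrier K" for u y
    using that in_H bounded_operatorD(1)[OF T] inner_bounded_adjoint[OF T, of y u]
      dom.inner_commute[of u "bounded_adjoint H K T y"] cod.inner_commute[of "T u" y] by simp
  note TD = bounded_operatorD[OF T]
  have "bounded_adjoint H K T (y + y') = bounded_adjoint H K T y + bounded_adjoint H K T y'"
    if "y \<in> hcarrier K" "y' \<in> hcarrier K" for y y'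
    by (rule dom.eq_if_inner_eq) (use that in_H inner TD in \<open>simp_all add: dom.inner_add_right cod.inner_add_right\<close>)
  moreover have "bounded_adjoint H K T (hscale K c y) = hscale H c (bounded_adjoint H K T y)"
    if "y \<in> hcarrier K" for c y
    by (rule dom.eq_if_inner_eq) (use that in_H inner TD in \<open>simp_all add: dom.inner_scale_right cod.inner_scale_right\<close>)
  ultimately show ?thesis
    unfolding bounded_operator_def using in_H hnorm_bounded_adjoint_le[OF T _ M] by blast
qed

text \<open>A supremum of reals is an upper bound only when the set is bounded above; hence the
  explicit \<open>M\<close>.\<close>

lemma hnorm_le_operator_norm_unit:
  assumes "\<And>x. x \<in> hcarrier H \<Longrightarrow> hnorm H x \<le> 1 \<Longrightarrow> hnorm K (T x) \<le> M"
    and "x \<in> hcarrier H" "hnorm H x \<le> 1"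
  shows "hnorm K (T x) \<le> operator_norm H K T"
  unfolding operator_norm_def using assms by (intro cSUP_upper bdd_aboveI2[of _ _ M]) auto

lemma operator_norm_nonneg:
  assumes "bounded_operator H K T"
  shows "0 \<le> operator_norm H K T"
proof -
  obtain M where M: "M \<ge> 0" "\<And>x. x \<in> hcarrier H \<Longrightarrow> hnorm K (T x) \<le> M * hnorm H x"
    using bounded_operator_bound[OF assms] by metis
  have "hnorm K (T x) \<le> M" if "x \<in> hcarrier H" "hnorm H x \<le> 1" for x
    using M(2)[OF that(1)] mult_left_mono[OF that(2) M(1)] by simp
  from hnorm_le_operator_norm_unit[OF this dom.zero_in] show ?thesis
    using cod.hnorm_nonneg[OF bounded_operatorD(1)[OF assms dom.zero_in]] by force
qed

lemma hnorm_le_operator_norm: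
  assumes T: "bounded_operator H K T" and x: "x \<in> hcarrier H"
  shows "hnorm K (T x) \<le> operator_norm H K T * hnorm H x"
proof (cases "x = 0")
  case True
  then show ?thesis using bounded_operator_diff[OF T x x] by simp
next
  case False
  then have p: "hnorm H x > 0" using x by (simp add: dom.hnorm_eq_zero less_le)
  obtain M where M: "M \<ge> 0" "\<And>x. x \<in> hcarrier H \<Longrightarrow> hnorm K (T x) \<le> M * hnorm H x"
    using bounded_operator_bound[OF T] by metis
  have *: "hnorm K (T x) \<le> M" if "x \<in> hcarrier H" "hnorm H x \<le> 1" for x
    using M(2)[OF that(1)] mult_left_mono[OF that(2) M(1)] by simp
  let ?u = "hscale H (complex_of_real (1 / hnorm H x)) x"
  have "hnorm H ?u = 1"
    using p x by (simp add: dom.hnorm_scale norm_divide)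
  with hnorm_le_operator_norm_unit[OF *, where x = ?u] x
  have "hnorm K (T ?u) \<le> operator_norm H K T" by simp
  then show ?thesis
    using p x bounded_operatorD[OF T] by (simp add: cod.hnorm_scale norm_divide field_simps)
qed

text \<open>Vectors of the unit ball that attain the norm up to \<open>1 / (n + 1)\<close> turn norm
  convergence into convergence along sequences of vectors, the form in which both kinds of
  convergence are treated later.\<close>

lemma operator_norm_tendsto_0:
  assumes T: "\<And>n. bounded_operator H K (T n)"
    and lim: "\<And>xs. (\<And>n. xs n \<in> hcarrier H) \<Longrightarrow> (\<And>n. hnorm H (xs n) \<le> 1) \<Longrightarrow>
      (\<lambda>n. hnorm K (T n (xs n))) \<longlonglongrightarrow> 0"
  shows "(\<lambda>n. operator_norm H K (T n)) \<longlonglongrightarrow> 0"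
proof -
  have "\<exists>x. x \<in> hcarrier H \<and> hnorm H x \<le> 1 \<and> operator_norm H K (T n) - 1 / real (Suc n) < hnorm K (T n x)" for n
  proof -
    have "operator_norm H K (T n) - 1 / real (Suc n) < (SUP x\<in>{x \<in> hcarrier H. hnorm H x \<le> 1}. hnorm K (T n x))"
      by (simp add: operator_norm_def)
    moreover have "{x \<in> hcarrier H. hnorm H x \<le> 1} \<noteq> {}" by (auto intro!: exI[of _ 0])
    ultimately show ?thesis by (auto elim!: less_cSupE)
  qed
  then obtain xs where xs: "\<And>n. xs n \<in> hcarrier H" "\<And>n. hnorm H (xs n) \<le> 1"
    "\<And>n. operator_norm H K (T n) - 1 / real (Suc n) < hnorm K (T n (xs n))" by metis
  have "(\<lambda>n. hnorm K (T n (xs n)) + inverse (real (Suc n))) \<longlonglongrightarrow> 0 + 0"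
    by (intro tendsto_add lim xs LIMSEQ_inverse_real_of_nat)
  then show ?thesis
    using xs(3) operator_norm_nonneg[OF T]
    by (intro Lim_null_comparison[of "\<lambda>n. operator_norm H K (T n)"])
      (auto simp: inverse_eq_divide diff_less_eq intro!: always_eventually less_imp_le)
qed

end

lemma bounded_operator_comp:
  assumes H: "hilbert_space H" and K: "hilbert_space K" and L: "hilbert_space L"
    and S: "bounded_operator H K S" and T: "bounded_operator K L T"
  shows "bounded_operator H L (\<lambda>x. T (S x))"
proof -
  interpret HK: hilbert_space_pair H K using H K by (rule hilbert_space_pair.intro)
  interpret KL: hilbert_space_pair K L using K L by (rule hilbert_space_pair.intro)
  obtain M where M: "M \<ge> 0" "\<And>x. x \<in> hcarrier H \<Longrightarrow> hnorm K (S x) \<le> M * hnorm H x"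
    using HK.bounded_operator_bound[OF S] by metis
  obtain N where N: "N \<ge> 0" "\<And>x. x \<in> hcarrier K \<Longrightarrow> hnorm L (T x) \<le> N * hnorm K x"
    using KL.bounded_operator_bound[OF T] by metis
  have "hnorm L (T (S x)) \<le> N * M * hnorm H x" if "x \<in> hcarrier H" for x
    using N(2)[OF bounded_operatorD(1)[OF S that]] mult_left_mono[OF M(2)[OF that] N(1)] by (simp add: mult.assoc)
  then show ?thesis
    using bounded_operatorD[OF S] bounded_operatorD[OF T] unfolding bounded_operator_def by auto
qed

lemma operator_norm_cong:
  "(\<And>x. x \<in> hcarrier H \<Longrightarrow> T x = S x) \<Longrightarrow> operator_norm H K T = operator_norm H K S"
  unfolding operator_norm_def by (intro SUP_cong) auto

section \<open>Bounded operators on one space and their forms\<close>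

context hilbert_space
begin

abbreviation "bop \<equiv> bounded_operator H H"

sublocale self: hilbert_space_pair H H ..

lemma bop_id: "bop (\<lambda>x. x)"
  unfolding bounded_operator_def by (auto intro!: exI[of _ 1])

lemma bop_scale_const: "bop (sc c)"
  unfolding bounded_operator_def
  by (auto simp: vs.scale_right_distrib hnorm_scale mult.commute intro!: exI[of _ "cmod c"])

lemma bop_add:
  assumes T: "bop T" and S: "bop S"
  shows "bop (\<lambda>x. T x + S x)"
proof -
  obtain M N where M: "\<And>x. x \<in> V \<Longrightarrow> nm (T x) \<le> M * nm x" "\<And>x. x \<in> V \<Longrightarrow> nm (S x) \<le> N * nm x"
    using self.bounded_operator_bound[OF T] self.bounded_operator_bound[OF S] by metis
  have "nm (T x + S x) \<le> (M + N) * nm x" if "x \<in> V" for x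
    using that M[OF that] hnorm_triangle[of "T x" "S x"] bounded_operatorD(1)[OF T] bounded_operatorD(1)[OF S]
    by (simp add: algebra_simps)
  then show ?thesis
    using bounded_operatorD[OF T] bounded_operatorD[OF S]
    unfolding bounded_operator_def by (auto simp: vs.scale_right_distrib)
qed

lemma bop_comp: "bop T \<Longrightarrow> bop S \<Longrightarrow> bop (\<lambda>x. T (S x))"
  by (rule bounded_operator_comp[OF hilbert_space_axioms hilbert_space_axioms hilbert_space_axioms])

lemma bop_scale: "bop T \<Longrightarrow> bop (\<lambda>x. sc c (T x))"
  using bop_comp[OF bop_scale_const] .

lemma bop_diff:
  assumes "bop T" "bop S"
  shows "bop (\<lambda>x. T x - S x)"
  using bop_add[OF assms(1) bop_scale[OF assms(2), of "- 1"]] by simp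

lemma sesquilinear_bop_right: "bop T \<Longrightarrow> sesquilinear (\<lambda>x y. ip x (T y))"
  unfolding sesquilinear_def by (auto simp: bounded_operatorD inner_simps)

lemma sesquilinear_bop_left: "bop T \<Longrightarrow> sesquilinear (\<lambda>x y. ip (T x) y)"
  unfolding sesquilinear_def by (auto simp: bounded_operatorD inner_simps)

lemma bop_eq_if_form_eq:
  assumes T: "bop T" and S: "bop S" and eq: "\<And>x. x \<in> V \<Longrightarrow> ip x (T x) = ip x (S x)" and y: "y \<in> V"
  shows "T y = S y"
proof (rule eq_if_inner_eq)
  fix u assume u: "u \<in> V"
  show "ip u (T y) = ip u (S y)"
    using polarization[OF sesquilinear_bop_right[OF T] u y] polarization[OF sesquilinear_bop_right[OF S] u y]
      polar_cong[OF eq u y] by simp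
qed (use y bounded_operatorD(1)[OF T] bounded_operatorD(1)[OF S] in auto)

lemma bop_tendsto:
  assumes T: "bop T" and X: "\<And>n. X n \<in> V" "x \<in> V" "(\<lambda>n. nm (X n - x)) \<longlonglongrightarrow> 0"
  shows "(\<lambda>n. nm (T (X n) - T x)) \<longlonglongrightarrow> 0"
proof -
  obtain M where M: "M \<ge> 0" "\<And>x. x \<in> V \<Longrightarrow> nm (T x) \<le> M * nm x"
    using self.bounded_operator_bound[OF T] by metis
  have "(\<lambda>n. M * nm (X n - x)) \<longlonglongrightarrow> M * 0" by (intro tendsto_intros X)
  moreover have "norm (nm (T (X n) - T x)) \<le> M * nm (X n - x)" for n
    using M(2)[of "X n - x"] X(1,2) self.bounded_operator_diff[OF T] bounded_operatorD(1)[OF T] by simp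
  ultimately show ?thesis
    using Lim_null_comparison[of "\<lambda>n. nm (T (X n) - T x)" "\<lambda>n. M * nm (X n - x)" sequentially]
    by simp
qed

text \<open>For fixed \<open>y\<close> the map \<open>u \<mapsto> cnj (B u y)\<close> is linear,
  because \<open>B\<close> is conjugate linear on the left; its Riesz vector is
  \<open>T y\<close>.\<close>

lemma operator_of_sesquilinear:
  assumes B: "sesquilinear B" and b: "\<And>x. x \<in> V \<Longrightarrow> cmod (B x x) \<le> C * (nm x)\<^sup>2"
  shows "\<exists>T. bop T \<and> (\<forall>x\<in>V. \<forall>y\<in>V. ip x (T y) = B x y)"
proof -
  have s: "B u (v + w) = B u v + B u w" "B (u + v) w = B u w + B v w"
      "B u (sc c v) = c * B u v" "B (sc c u) v = cnj c * B u v"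
    if "u \<in> V" "v \<in> V" "w \<in> V" for u v w c
    using B that unfolding sesquilinear_def by blast+
  have "\<exists>t. t \<in> V \<and> (\<forall>u\<in>V. ip u t = B u y)" if y: "y \<in> V" for y
  proof -
    have "\<exists>!t. t \<in> V \<and> (\<forall>u\<in>V. ip t u = cnj (B u y))"
    proof (rule Riesz_representation[where M = "2 * C * nm y"])
      fix u assume "u \<in> V"
      then show "cmod (cnj (B u y)) \<le> 2 * C * nm y * nm u"
        using sesquilinear_bound[OF B b _ y, of u] by (simp add: mult_ac)
    qed (use y s in auto)
    then show ?thesis using inner_commute by (metis complex_cnj_cnj)
  qed
  then obtain T where "\<forall>y\<in>V. T y \<in> V \<and> (\<forall>u\<in>V. ip u (T y) = B u y)"
    by metis
  then have T: "T y \<in> V" "\<And>u. u \<in> V \<Longrightarrow> ip u (T y) = B u y" if "y \<in> V" for y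
    using that by auto
  have "nm (T y) \<le> 2 * C * nm y" if y: "y \<in> V" for y
  proof (cases "nm (T y) = 0")
    case True
    \<comment> \<open>The sign of \<open>C\<close> comes from the bound \<open>b\<close> at a
      nonzero \<open>y\<close>.\<close>
    have "0 \<le> 2 * C * nm y"
    proof (cases "y = 0")
      case False
      then have "0 \<le> C * (nm y)\<^sup>2" "(nm y)\<^sup>2 > 0"
        using b[OF y] norm_ge_zero order_trans y by (blast, simp add: hnorm_eq_zero)
      then show ?thesis using y by (simp add: zero_le_mult_iff)
    qed simp
    then show ?thesis using True by simp
  next
    case False
    then have p: "nm (T y) > 0" using hnorm_nonneg[OF T(1)[OF y]] by simp
    have "cmod (ip (T y) (T y)) = (nm (T y))\<^sup>2"
      using inner_self[OF T(1)[OF y]] by (simp add: norm_power)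
    then have "nm (T y) * nm (T y) \<le> 2 * C * nm (T y) * nm y"
      using sesquilinear_bound[OF B b T(1)[OF y] y] T(2)[OF y T(1)[OF y]] by (simp add: power2_eq_square)
    then show ?thesis using p by (simp add: mult_ac)
  qed
  moreover have "T (x + y) = T x + T y" if "x \<in> V" "y \<in> V" for x y
    by (rule eq_if_inner_eq) (use that T s in \<open>auto simp: inner_simps\<close>)
  moreover have "T (sc c x) = sc c (T x)" if "x \<in> V" for x c
    by (rule eq_if_inner_eq) (use that T s[of _ x x] in \<open>auto simp: inner_simps\<close>)
  ultimately have "bop T"
    unfolding bounded_operator_def using T(1) by blast
  then show ?thesis using T(2) by blast
qed

end

section \<open>Operators represented by a family of measures\<close>

definition bounded_borel :: "(real \<Rightarrow> complex) \<Rightarrow> bool" where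
  "bounded_borel f \<longleftrightarrow> f \<in> borel_measurable borel \<and> (\<exists>C. \<forall>s. cmod (f s) \<le> C)"

lemma bounded_borel_measurable [measurable_dest]: "bounded_borel f \<Longrightarrow> f \<in> borel_measurable borel"
  by (simp add: bounded_borel_def)

lemma bounded_borel_bound:
  assumes "bounded_borel f"
  obtains C where "C \<ge> 0" "\<And>s. cmod (f s) \<le> C"
  using assms unfolding bounded_borel_def by (meson norm_ge_zero order_trans)

lemma bounded_borel_const [simp, intro]: "bounded_borel (\<lambda>s. c)"
  unfolding bounded_borel_def by auto

lemma bounded_borel_add [intro]:
  assumes "bounded_borel f" "bounded_borel g"
  shows "bounded_borel (\<lambda>s. f s + g s)"
proof -
  obtain C D where "\<And>s. cmod (f s) \<le> C" "\<And>s. cmod (g s) \<le> D"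
    using bounded_borel_bound[OF assms(1)] bounded_borel_bound[OF assms(2)] by metis
  then have "cmod (f s + g s) \<le> C + D" for s
    using norm_triangle_mono by blast
  then show ?thesis
    using assms unfolding bounded_borel_def by (auto intro: borel_measurable_add)
qed

lemma bounded_borel_mult [intro]:
  assumes "bounded_borel f" "bounded_borel g"
  shows "bounded_borel (\<lambda>s. f s * g s)"
proof -
  obtain C D where "C \<ge> 0" "\<And>s. cmod (f s) \<le> C" "\<And>s. cmod (g s) \<le> D"
    using bounded_borel_bound[OF assms(1)] bounded_borel_bound[OF assms(2)] by metis
  then have "cmod (f s * g s) \<le> C * D" for s
    by (auto simp: norm_mult intro!: mult_mono)
  then show ?thesis
    using assms unfolding bounded_borel_def by (auto intro: borel_measurable_times)
qed

lemma bounded_borel_diff [intro]: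
  assumes "bounded_borel f" "bounded_borel g"
  shows "bounded_borel (\<lambda>s. f s - g s)"
  using bounded_borel_add[OF assms(1) bounded_borel_mult[OF bounded_borel_const assms(2), of "- 1"]] by simp

lemma bounded_borel_cnj [intro]: "bounded_borel f \<Longrightarrow> bounded_borel (\<lambda>s. cnj (f s))"
  unfolding bounded_borel_def
  by (auto intro!: borel_measurable_continuous_on[where f = cnj] continuous_intros)

lemma bounded_borel_indicator [intro]: "B \<in> sets borel \<Longrightarrow> bounded_borel (indicator B)"
  unfolding bounded_borel_def by (auto intro!: exI[of _ 1] simp: indicator_def)

text \<open>Abstract, because two families are of interest: the measures built from the moments of
  the Cayley transform, and the scalar measures of a given projection-valued measure. How
  \<open>\<mu> x\<close> depends on \<open>x\<close> is fixed only through its total mass; quadratic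
  dependence comes with the operators supplied by \<open>represents\<close>.\<close>

locale measure_family = hilbert_space +
  fixes \<mu> :: "'a \<Rightarrow> real measure"
  assumes sets_family: "x \<in> V \<Longrightarrow> sets (\<mu> x) = sets borel"
    and total_mass: "x \<in> V \<Longrightarrow> emeasure (\<mu> x) UNIV = ennreal ((nm x)\<^sup>2)"
begin

lemma space_family: "x \<in> V \<Longrightarrow> space (\<mu> x) = UNIV"
  using sets_eq_imp_space_eq[OF sets_family] by simp

lemma finite_measure_family: "x \<in> V \<Longrightarrow> finite_measure (\<mu> x)"
  by (rule finite_measureI) (simp add: space_family total_mass)

lemma measure_family_UNIV: "x \<in> V \<Longrightarrow> measure (\<mu> x) UNIV = (nm x)\<^sup>2"
  by (simp add: measure_def total_mass)

lemma measurable_family: "x \<in> V \<Longrightarrow> borel_measurable (\<mu> x) = borel_measurable borel"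
  by (rule measurable_cong_sets) (simp_all add: sets_family)

lemma integrable_family:
  assumes "bounded_borel f" "x \<in> V"
  shows "integrable (\<mu> x) f"
proof -
  interpret finite_measure "\<mu> x" using finite_measure_family[OF assms(2)] .
  obtain C where "\<And>s. cmod (f s) \<le> C" using bounded_borel_bound[OF assms(1)] by metis
  then show ?thesis
    using assms by (intro integrable_const_bound[of _ C]) (auto simp: measurable_family dest: bounded_borel_measurable)
qed

lemma integral_family_bound:
  assumes "f \<in> borel_measurable borel" "\<And>s. cmod (f s) \<le> C" "x \<in> V"
  shows "cmod (LINT s|\<mu> x. f s) \<le> C * (nm x)\<^sup>2"
proof -
  interpret finite_measure "\<mu> x" using finite_measure_family[OF assms(3)] .
  have "bounded_borel f" using assms unfolding bounded_borel_def by blast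
  then have i: "integrable (\<mu> x) f" using assms(3) by (rule integrable_family)
  have "cmod (LINT s|\<mu> x. f s) \<le> (LINT s|\<mu> x. cmod (f s))"
    by (rule integral_norm_bound)
  also have "\<dots> \<le> (LINT s|\<mu> x. C)"
    using i assms(2) by (intro integral_mono) auto
  also have "\<dots> = C * (nm x)\<^sup>2"
    using assms(3) by (simp add: space_family measure_family_UNIV mult.commute)
  finally show ?thesis .
qed

lemma integral_family_tendsto:
  assumes "\<And>n. f n \<in> borel_measurable borel" "\<And>n s. cmod (f n s) \<le> C" "\<And>s. (\<lambda>n. f n s) \<longlonglongrightarrow> g s" "x \<in> V"
  shows "(\<lambda>n. LINT s|\<mu> x. f n s) \<longlonglongrightarrow> (LINT s|\<mu> x. g s)"
proof -
  interpret finite_measure "\<mu> x" using finite_measure_family[OF assms(4)] .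
  have "g \<in> borel_measurable borel"
    by (rule borel_measurable_LIMSEQ_metric[OF assms(1,3)])
  then show ?thesis
    using assms by (intro integral_dominated_convergence[where w = "\<lambda>_. C"]) (auto simp: measurable_family)
qed

text \<open>Only the diagonal of the form of \<open>T\<close> is prescribed; polarization determines
  \<open>T\<close> on the carrier from it.\<close>

definition represents :: "(real \<Rightarrow> complex) \<Rightarrow> ('a \<Rightarrow> 'a) \<Rightarrow> bool" where
  "represents f T \<longleftrightarrow> bounded_borel f \<and> bop T \<and> (\<forall>x\<in>V. ip x (T x) = (LINT s|\<mu> x. f s))"

lemma representsD:
  assumes "represents f T"
  shows "bounded_borel f" "bop T" "x \<in> V \<Longrightarrow> ip x (T x) = (LINT s|\<mu> x. f s)"
  using assms unfolding represents_def by auto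

lemma represents_unique: "represents f T \<Longrightarrow> represents f S \<Longrightarrow> x \<in> V \<Longrightarrow> T x = S x"
  unfolding represents_def by (intro bop_eq_if_form_eq[of T S]) auto

lemma represents_cong:
  assumes "represents f T" "\<And>x. x \<in> V \<Longrightarrow> S x = T x"
  shows "represents f S"
proof -
  have "bop S"
    using representsD(2)[OF assms(1)] assms(2) unfolding bounded_operator_def by simp
  then show ?thesis using assms unfolding represents_def by simp
qed

lemma represents_const: "represents (\<lambda>s. c) (sc c)"
  unfolding represents_def
  by (auto simp: bop_scale_const inner_scale_right inner_self measure_family_UNIV space_family finite_measure_family
      finite_measure.emeasure_finite scaleR_conv_of_real mult.commute)

lemma represents_add: "represents f T \<Longrightarrow> represents g S \<Longrightarrow> represents (\<lambda>s. f s + g s) (\<lambda>x. T x + S x)"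
  unfolding represents_def
  by (auto simp: bop_add inner_add_right bounded_operatorD integrable_family)

lemma represents_scale: "represents f T \<Longrightarrow> represents (\<lambda>s. c * f s) (\<lambda>x. sc c (T x))"
  unfolding represents_def
  by (auto simp: bop_scale inner_scale_right bounded_operatorD integrable_family)

lemma represents_inner:
  assumes "represents f T" "x \<in> V" "y \<in> V"
  shows "ip x (T y) = polar (\<lambda>x. LINT s|\<mu> x. f s) x y"
  using polarization[OF sesquilinear_bop_right[OF representsD(2)[OF assms(1)]] assms(2,3)]
    polar_cong[of "\<lambda>x. ip x (T x)" "\<lambda>x. LINT s|\<mu> x. f s", OF representsD(3)[OF assms(1)] assms(2,3)] by simp

lemma represents_weak_limit:
  assumes "\<And>n. represents (f n) (T n)" "represents g S"
    "\<And>n s. cmod (f n s) \<le> C" "\<And>s. (\<lambda>n. f n s) \<longlonglongrightarrow> g s" "x \<in> V" "y \<in> V"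
  shows "(\<lambda>n. ip x (T n y)) \<longlonglongrightarrow> ip x (S y)"
  unfolding represents_inner[OF assms(1) assms(5,6)] represents_inner[OF assms(2) assms(5,6)]
  by (intro polar_tendsto integral_family_tendsto[of f C])
    (use assms bounded_borel_measurable representsD(1) in auto)

text \<open>The polarized limit functional is a pointwise limit of the forms of the
  \<open>T n\<close>, hence sesquilinear, and the bound \<open>C\<close> on the integrands bounds it
  on the diagonal; a bounded form comes from an operator.\<close>

lemma represents_limit_exists:
  assumes f: "\<And>n. \<exists>T. represents (f n) T"
    and C: "\<And>n s. cmod (f n s) \<le> C" and lim: "\<And>s. (\<lambda>n. f n s) \<longlonglongrightarrow> g s"
  shows "\<exists>T. represents g T"
proof -
  obtain T where T: "\<And>n. represents (f n) (T n)" using f by metis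
  define q where "q x = (LINT s|\<mu> x. g s)" for x
  have meas: "f n \<in> borel_measurable borel" for n
    using representsD(1)[OF T] bounded_borel_measurable by blast
  have g: "g \<in> borel_measurable borel"
    by (rule borel_measurable_LIMSEQ_metric[OF meas lim])
  have gC: "cmod (g s) \<le> C" for s
    by (rule LIMSEQ_le_const2[OF tendsto_norm[OF lim]]) (use C in auto)
  have l: "(\<lambda>n. ip x (T n y)) \<longlonglongrightarrow> polar q x y" if "x \<in> V" "y \<in> V" for x y
    unfolding represents_inner[OF T that] q_def
    by (intro polar_tendsto integral_family_tendsto[of f C] that meas C lim)
  have Tn: "T n x \<in> V" if "x \<in> V" for n x
    using bounded_operatorD(1)[OF representsD(2)[OF T] that] .
  note TD = bounded_operatorD[OF representsD(2)[OF T]]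
  have "sesquilinear (polar q)"
    unfolding sesquilinear_def
  proof (intro conjI ballI allI)
    fix x y z assume v: "x \<in> V" "y \<in> V" "z \<in> V"
    show "polar q x (y + z) = polar q x y + polar q x z"
      using tendsto_add[OF l[OF v(1,2)] l[OF v(1,3)]] l[OF v(1) add_in[OF v(2,3)]] v
      by (auto simp: TD inner_simps intro: LIMSEQ_unique)
    show "polar q (x + y) z = polar q x z + polar q y z"
      using tendsto_add[OF l[OF v(1,3)] l[OF v(2,3)]] l[OF add_in[OF v(1,2)] v(3)] v
      by (auto simp: TD inner_simps intro: LIMSEQ_unique)
  next
    fix c x y assume v: "x \<in> V" "y \<in> V"
    show "polar q x (sc c y) = c * polar q x y"
      using tendsto_mult_left[OF l[OF v], of c] l[OF v(1) scale_in[OF v(2)], of c] v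
      by (auto simp: TD inner_simps intro: LIMSEQ_unique)
    show "polar q (sc c x) y = cnj c * polar q x y"
      using tendsto_mult_left[OF l[OF v], of "cnj c"] l[OF scale_in[OF v(1)] v(2), of c] v
      by (auto simp: TD inner_simps intro: LIMSEQ_unique)
  qed
  moreover have pq: "polar q x x = q x" if "x \<in> V" for x
  proof (rule LIMSEQ_unique[OF l[OF that that]])
    show "(\<lambda>n. ip x (T n x)) \<longlonglongrightarrow> q x"
      unfolding representsD(3)[OF T that] q_def by (rule integral_family_tendsto[OF meas C lim that])
  qed
  ultimately obtain S where S: "bop S" "\<And>x y. x \<in> V \<Longrightarrow> y \<in> V \<Longrightarrow> ip x (S y) = polar q x y"
    using operator_of_sesquilinear[of "polar q" C] integral_family_bound[OF g gC] unfolding q_def by auto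
  have "represents g S"
    unfolding represents_def using S g gC pq unfolding q_def bounded_borel_def by auto
  then show ?thesis by blast
qed

text \<open>On the diagonal both sides are the integral of \<open>f\<close>; polarization extends
  this to all pairs.\<close>

lemma represents_cnj_adjoint:
  assumes T: "represents f T" and S: "represents (\<lambda>s. cnj (f s)) S" and v: "x \<in> V" "y \<in> V"
  shows "ip (S x) y = ip x (T y)"
proof -
  have "ip (S x) x = ip x (T x)" if "x \<in> V" for x
    using inner_commute[OF bounded_operatorD(1)[OF representsD(2)[OF S] that] that]
    by (simp add: representsD(3)[OF S that] representsD(3)[OF T that])
  then show ?thesis
    using polarization[OF sesquilinear_bop_left[OF representsD(2)[OF S]] v]
      polarization[OF sesquilinear_bop_right[OF representsD(2)[OF T]] v]
      polar_cong[of "\<lambda>x. ip (S x) x" "\<lambda>x. ip x (T x)", OF _ v] by simp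
qed

end

text \<open>The bounded Borel functions arise from \<open>G\<close> by linear operations and bounded
  pointwise limits, as in the monotone class theorem, encoded as an induction principle. Products
  are left out of the closure: that the calculus respects them is what this induction has to
  prove.\<close>

definition generating :: "(real \<Rightarrow> complex) set \<Rightarrow> bool" where
  "generating G \<longleftrightarrow>
     (\<forall>P. (\<forall>f\<in>G. P f) \<longrightarrow>
        (\<forall>f g. P f \<longrightarrow> P g \<longrightarrow> P (\<lambda>s. f s + g s)) \<longrightarrow>
        (\<forall>c f. P f \<longrightarrow> P (\<lambda>s. c * f s)) \<longrightarrow>
        (\<forall>F f C. (\<forall>n::nat. P (F n)) \<longrightarrow> (\<forall>n s. cmod (F n s) \<le> C) \<longrightarrow> (\<forall>s. (\<lambda>n. F n s) \<longlonglongrightarrow> f s) \<longrightarrow> P f) \<longrightarrow>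
        (\<forall>f. bounded_borel f \<longrightarrow> P f))"

lemma generating_induct [consumes 2, case_names generator add scale limit]:
  assumes "generating G" "bounded_borel f"
    and "\<And>f. f \<in> G \<Longrightarrow> P f"
    and "\<And>f g. P f \<Longrightarrow> P g \<Longrightarrow> P (\<lambda>s. f s + g s)"
    and "\<And>c f. P f \<Longrightarrow> P (\<lambda>s. c * f s)"
    and "\<And>F f C. (\<And>n::nat. P (F n)) \<Longrightarrow> (\<And>n s. cmod (F n s) \<le> C) \<Longrightarrow> (\<And>s. (\<lambda>n. F n s) \<longlonglongrightarrow> f s) \<Longrightarrow> P f"
  shows "P f"
proof -
  note gen = assms(1)[unfolded generating_def, THEN spec[of _ P]]
  have 1: "\<forall>f\<in>G. P f" using assms(3) by blast
  have 2: "\<forall>f g. P f \<longrightarrow> P g \<longrightarrow> P (\<lambda>s. f s + g s)" using assms(4) by blast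
  have 3: "\<forall>c f. P f \<longrightarrow> P (\<lambda>s. c * f s)" using assms(5) by blast
  have 4: "\<forall>F f C. (\<forall>n::nat. P (F n)) \<longrightarrow> (\<forall>n s. cmod (F n s) \<le> C) \<longrightarrow> (\<forall>s. (\<lambda>n. F n s) \<longlonglongrightarrow> f s) \<longrightarrow> P f"
    using assms(6) by blast
  from gen[THEN mp, OF 1, THEN mp, OF 2, THEN mp, OF 3, THEN mp, OF 4] assms(2) show ?thesis
    by blast
qed

lemma bounded_borel_limit:
  assumes "\<And>n. bounded_borel (F n)" "\<And>n s. cmod (F n s) \<le> C" "\<And>s. (\<lambda>n. F n s) \<longlonglongrightarrow> f s"
  shows "bounded_borel f"
  unfolding bounded_borel_def
proof (intro conjI exI allI)
  show "f \<in> borel_measurable borel"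
    by (rule borel_measurable_LIMSEQ_metric[OF bounded_borel_measurable[OF assms(1)] assms(3)])
  show "cmod (f s) \<le> C" for s
    by (rule LIMSEQ_le_const2[OF tendsto_norm[OF assms(3)]]) (use assms(2) in auto)
qed

lemma cnj_mult_self: "cnj z * z = complex_of_real ((cmod z)\<^sup>2)"
  by (simp only: complex_norm_square mult.commute)

text \<open>Bounded functions are limits of simple ones. The approximants are bounded by
  \<open>2 * C\<close>, since they stay within twice the distance of \<open>f\<close> from
  0.\<close>

lemma generating_indicators: "generating {indicator B | B. B \<in> sets borel}"
  unfolding generating_def
proof (intro allI impI)
  fix P :: "(real \<Rightarrow> complex) \<Rightarrow> bool" and f :: "real \<Rightarrow> complex"
  assume gen: "\<forall>f\<in>{indicator B |B. B \<in> sets borel}. P f"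
    and add: "\<forall>f g. P f \<longrightarrow> P g \<longrightarrow> P (\<lambda>s. f s + g s)"
    and scale: "\<forall>c f. P f \<longrightarrow> P (\<lambda>s. c * f s)"
    and lim: "\<forall>F f C. (\<forall>n::nat. P (F n)) \<longrightarrow> (\<forall>n s. cmod (F n s) \<le> C) \<longrightarrow> (\<forall>s. (\<lambda>n. F n s) \<longlonglongrightarrow> f s) \<longrightarrow> P f"
    and f: "bounded_borel f"
  have ind: "P (indicator B)" if "B \<in> sets borel" for B
    using gen that by blast
  have zero: "P (\<lambda>s. 0)" 
  proof -
    have "(indicator {} :: real \<Rightarrow> complex) = (\<lambda>s. 0)" by (rule ext) simp
    from subst[of _ _ P, OF this ind] show ?thesis by simp
  qed
  have simple: "P g" if g: "simple_function borel g" for g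
  proof -
    have fin: "finite (range g)"
      using simple_functionD(1)[OF g] by simp
    have "P (\<lambda>s. \<Sum>c\<in>S. c * indicator (g -` {c}) s)" if "finite S" for S
      using that
    proof (induction S)
      case (insert c S)
      have "g -` {c} \<in> sets borel"
        using simple_functionD(2)[OF g, of "{c}"] by simp
      from add[rule_format, OF scale[rule_format, OF ind[OF this], of c] insert.IH]
      show ?case by (simp only: sum.insert[OF insert.hyps])
    qed (simp add: zero)
    from this[OF fin]
    moreover have "(\<Sum>c\<in>range g. c * indicator (g -` {c}) s) = g s" for s
    proof -
      have "(\<Sum>c\<in>range g. c * indicator (g -` {c}) s) = (\<Sum>c\<in>range g. if c = g s then c else 0)"
        by (intro sum.cong) (auto simp: indicator_def)
      then show ?thesis using fin by simp
    qed
    ultimately show ?thesis by simp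
  qed
  obtain C where C: "\<And>s. cmod (f s) \<le> C" using bounded_borel_bound[OF f] by metis
  obtain F where F: "\<And>i. simple_function borel (F i)" "\<And>s. (\<lambda>i. F i s) \<longlonglongrightarrow> f s"
      "\<And>i s. dist (F i s) 0 \<le> 2 * dist (f s) 0"
    using borel_measurable_implies_sequence_metric[OF bounded_borel_measurable[OF f], of 0] by auto
  have "cmod (F i s) \<le> 2 * C" for i s
    using F(3)[of i s] C[of s] by simp
  then show "P f"
    using lim simple[OF F(1)] F(2) by blast
qed

section \<open>Extension of a calculus from generators to bounded Borel functions\<close>

context measure_family
begin

lemma integral_indicator_family:
  assumes "B \<in> sets borel" "x \<in> V"
  shows "(LINT s|\<mu> x. indicator B s) = complex_of_real (measure (\<mu> x) B)"
proof -
  interpret finite_measure "\<mu> x" using finite_measure_family[OF assms(2)] .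
  have "(LINT s|\<mu> x. indicator B s) = (LINT s|\<mu> x. complex_of_real (indicator B s))"
    by (intro Bochner_Integration.integral_cong) (auto simp: indicator_def)
  also have "\<dots> = complex_of_real (LINT s|\<mu> x. indicator B s)"
    by (rule integral_complex_of_real)
  finally show ?thesis using assms by (simp add: sets_family space_family)
qed

text \<open>Multiplicativity is extended one factor at a time, first the right factor for
  \<open>f\<close> in \<open>G\<close>, then the left one: the limits are weak, and composition is
  weakly continuous in each factor separately but not jointly.\<close>

lemma calculus_extension:
  assumes gen: "generating G"
    and ex: "\<And>f. f \<in> G \<Longrightarrow> \<exists>T. represents f T"
    and mult: "\<And>f g T S. f \<in> G \<Longrightarrow> g \<in> G \<Longrightarrow> represents f T \<Longrightarrow> represents g S \<Longrightarrow>
      represents (\<lambda>s. f s * g s) (\<lambda>x. T (S x))"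
  shows calculus_extension_exists: "bounded_borel f \<Longrightarrow> \<exists>T. represents f T"
    and calculus_extension_mult: "represents f T \<Longrightarrow> represents g S \<Longrightarrow>
      represents (\<lambda>s. f s * g s) (\<lambda>x. T (S x))"
proof -
  have exists: "\<exists>T. represents f T" if "bounded_borel f" for f
    using gen that
  proof (induction rule: generating_induct)
    case (generator f)
    then show ?case by (rule ex)
  next
    case (add f g)
    then obtain T S where TS: "represents f T" "represents g S" by auto
    show ?case by (rule exI[of _ "\<lambda>x. T x + S x"]) (rule represents_add[OF TS])
  next
    case (scale c f)
    then obtain T where T: "represents f T" by auto
    show ?case by (rule exI[of _ "\<lambda>x. sc c (T x)"]) (rule represents_scale[OF T])
  next
    case (limit F f C)
    show ?case by (rule represents_limit_exists[OF limit])
  qed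
  \<comment> \<open>An operator for \<open>k\<close> already exists; a weak limit of operators for
    the approximants must coincide with it on the carrier.\<close>
  have limit_eq: "represents k W" if "represents k U" "bop W"
      "\<And>n. represents (K n) (Z n)" "\<And>n s. cmod (K n s) \<le> C" "\<And>s. (\<lambda>n. K n s) \<longlonglongrightarrow> k s"
      "\<And>x y. x \<in> V \<Longrightarrow> y \<in> V \<Longrightarrow> (\<lambda>n. ip x (Z n y)) \<longlonglongrightarrow> ip x (W y)" for k U W K Z C
  proof (rule represents_cong[OF that(1)])
    fix y assume y: "y \<in> V"
    show "W y = U y"
    proof (rule eq_if_inner_eq)
      fix x assume x: "x \<in> V"
      show "ip x (W y) = ip x (U y)"
        by (rule LIMSEQ_unique[OF that(6)[OF x y] represents_weak_limit[OF that(3,1,4,5) x y]])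
    qed (use y bounded_operatorD(1)[OF that(2)] bounded_operatorD(1)[OF representsD(2)[OF that(1)]] in auto)
  qed
  have left: "\<forall>T S. represents f T \<longrightarrow> represents g S \<longrightarrow> represents (\<lambda>s. f s * g s) (\<lambda>x. T (S x))"
    if f: "f \<in> G" and g: "bounded_borel g" for f g
  proof -
    obtain T0 where T0: "represents f T0" using ex[OF f] by blast
    have bf: "bounded_borel f" using representsD(1)[OF T0] .
    \<comment> \<open>Boundedness is carried along because the induction rule gives no information
      on the functions that it passes through.\<close>
    have "bounded_borel g \<and> (\<forall>T S. represents f T \<longrightarrow> represents g S \<longrightarrow> represents (\<lambda>s. f s * g s) (\<lambda>x. T (S x)))"
      using gen g
    proof (induction rule: generating_induct)
      case (generator g)
      then show ?case using mult[OF f generator] representsD(1) ex by blast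
    next
      case (add g h)
      show ?case
      proof (intro conjI allI impI)
        fix T S assume T: "represents f T" and S: "represents (\<lambda>s. g s + h s) S"
        obtain S1 S2 where S12: "represents g S1" "represents h S2"
          using exists add by metis
        have "represents (\<lambda>s. f s * g s + f s * h s) (\<lambda>x. T (S1 x) + T (S2 x))"
          using add S12 T by (intro represents_add) auto
        moreover have "T (S x) = T (S1 x) + T (S2 x)" if "x \<in> V" for x
          using represents_unique[OF S represents_add[OF S12] that] that
            bounded_operatorD[OF representsD(2)[OF T]] bounded_operatorD(1)[OF representsD(2)[OF S12(1)]]
            bounded_operatorD(1)[OF representsD(2)[OF S12(2)]] by simp
        ultimately show "represents (\<lambda>s. f s * (g s + h s)) (\<lambda>x. T (S x))"
          using represents_cong by (simp add: distrib_left)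
      qed (use add in auto)
    next
      case (scale c g)
      show ?case
      proof (intro conjI allI impI)
        fix T S assume T: "represents f T" and S: "represents (\<lambda>s. c * g s) S"
        obtain S1 where S1: "represents g S1" using exists scale by metis
        have "represents (\<lambda>s. c * (f s * g s)) (\<lambda>x. sc c (T (S1 x)))"
          using scale S1 T by (intro represents_scale) auto
        moreover have "T (S x) = sc c (T (S1 x))" if "x \<in> V" for x
          using represents_unique[OF S represents_scale[OF S1] that] that
            bounded_operatorD[OF representsD(2)[OF T]] bounded_operatorD(1)[OF representsD(2)[OF S1]] by simp
        ultimately show "represents (\<lambda>s. f s * (c * g s)) (\<lambda>x. T (S x))"
          using represents_cong by (simp add: mult.left_commute)
      qed (use scale in auto)
    next
      case (limit F g C)
      have bg: "bounded_borel g"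
        by (rule bounded_borel_limit[OF _ limit(2,3)]) (use limit(1) in blast)
      show ?case
      proof (intro conjI allI impI)
        fix T S assume T: "represents f T" and S: "represents g S"
        obtain D where D: "D \<ge> 0" "\<And>s. cmod (f s) \<le> D" using bounded_borel_bound[OF bf] by metis
        obtain U where U: "represents (\<lambda>s. f s * g s) U" using exists[OF bounded_borel_mult[OF bf bg]] by blast
        obtain R where R: "\<And>n. represents (F n) (R n)" using exists[OF conjunct1[OF limit(1)]] by metis
        \<comment> \<open>The operator of \<open>cnj f\<close> is the adjoint of \<open>T\<close>;
          moving it to the left makes the limit in the right factor a weak limit.\<close>
        obtain T' where T': "represents (\<lambda>s. cnj (f s)) T'" using exists bf by blast
        show "represents (\<lambda>s. f s * g s) (\<lambda>x. T (S x))"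
        proof (rule limit_eq[OF U, of _ "\<lambda>n s. f s * F n s" "\<lambda>n x. T (R n x)" "D * C"])
          fix x y assume x: "x \<in> V" and y: "y \<in> V"
          have "ip x (T z) = ip (T' x) z" if "z \<in> V" for z
            using represents_cnj_adjoint[OF T T' x that] by simp
          then have *: "ip x (T (R n y)) = ip (T' x) (R n y)" "ip x (T (S y)) = ip (T' x) (S y)" for n
            using bounded_operatorD(1)[OF representsD(2)[OF R] y] bounded_operatorD(1)[OF representsD(2)[OF S] y] by auto
          show "(\<lambda>n. ip x (T (R n y))) \<longlonglongrightarrow> ip x (T (S y))"
            unfolding *
            by (rule represents_weak_limit[OF R S limit(2,3) bounded_operatorD(1)[OF representsD(2)[OF T'] x] y])
        next
          show "represents (\<lambda>s. f s * F n s) (\<lambda>x. T (R n x))" for n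
            using limit(1) T R by blast
          show "cmod (f s * F n s) \<le> D * C" for n s
            using D limit(2)[of n s] by (auto simp: norm_mult intro!: mult_mono)
        qed (rule bop_comp[OF representsD(2)[OF T] representsD(2)[OF S]], intro tendsto_intros limit(3))
      qed (rule bg)
    qed
    then show ?thesis by blast
  qed
  have right: "bounded_borel f \<and> (\<forall>g T S. represents f T \<longrightarrow> represents g S \<longrightarrow> represents (\<lambda>s. f s * g s) (\<lambda>x. T (S x)))"
    if f: "bounded_borel f" for f
    using gen f
  proof (induction rule: generating_induct)
    case (generator f)
    then show ?case using left ex representsD(1) by blast
  next
    case (add f h)
    show ?case
    proof (intro conjI allI impI)
      fix g T S assume S: "represents g S" and T: "represents (\<lambda>s. f s + h s) T"
      obtain T1 T2 where T12: "represents f T1" "represents h T2"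
        using exists add by metis
      have "represents (\<lambda>s. f s * g s + h s * g s) (\<lambda>x. T1 (S x) + T2 (S x))"
        using add T12 S by (intro represents_add) auto
      moreover have "T (S x) = T1 (S x) + T2 (S x)" if "x \<in> V" for x
        using represents_unique[OF T represents_add[OF T12], of "S x"] that
          bounded_operatorD(1)[OF representsD(2)[OF S]] by simp
      ultimately show "represents (\<lambda>s. (f s + h s) * g s) (\<lambda>x. T (S x))"
        using represents_cong by (simp add: distrib_right)
    qed (use add in auto)
  next
    case (scale c f)
    show ?case
    proof (intro conjI allI impI)
      fix g T S assume S: "represents g S" and T: "represents (\<lambda>s. c * f s) T"
      obtain T1 where T1: "represents f T1" using exists scale by metis
      have "represents (\<lambda>s. c * (f s * g s)) (\<lambda>x. sc c (T1 (S x)))"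
        using scale T1 S by (intro represents_scale) auto
      moreover have "T (S x) = sc c (T1 (S x))" if "x \<in> V" for x
        using represents_unique[OF T represents_scale[OF T1], of "S x"] that
          bounded_operatorD(1)[OF representsD(2)[OF S]] by simp
      ultimately show "represents (\<lambda>s. (c * f s) * g s) (\<lambda>x. T (S x))"
        using represents_cong by (simp add: mult.assoc)
    qed (use scale in auto)
  next
    case (limit F f C)
    have bf: "bounded_borel f"
      by (rule bounded_borel_limit[OF _ limit(2,3)]) (use limit(1) in blast)
    show ?case
    proof (intro conjI allI impI)
      fix g T S assume T: "represents f T" and S: "represents g S"
      have bg: "bounded_borel g" using representsD(1)[OF S] .
      obtain D where D: "D \<ge> 0" "\<And>s. cmod (g s) \<le> D" using bounded_borel_bound[OF bg] by metis
      have C: "C \<ge> 0" using limit(2)[of 0 0] norm_ge_zero order_trans by blast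
      obtain U where U: "represents (\<lambda>s. f s * g s) U" using exists[OF bounded_borel_mult[OF bf bg]] by blast
      obtain R where R: "\<And>n. represents (F n) (R n)" using exists[OF conjunct1[OF limit(1)]] by metis
      show "represents (\<lambda>s. f s * g s) (\<lambda>x. T (S x))"
      proof (rule limit_eq[OF U, of _ "\<lambda>n s. F n s * g s" "\<lambda>n x. R n (S x)" "C * D"])
        fix x y assume x: "x \<in> V" and y: "y \<in> V"
        show "(\<lambda>n. ip x (R n (S y))) \<longlonglongrightarrow> ip x (T (S y))"
          by (rule represents_weak_limit[OF R T limit(2,3) x bounded_operatorD(1)[OF representsD(2)[OF S] y]])
      next
        show "represents (\<lambda>s. F n s * g s) (\<lambda>x. R n (S x))" for n
          using limit(1) S R by blast
        show "cmod (F n s * g s) \<le> C * D" for n s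
          using D C limit(2)[of n s] by (auto simp: norm_mult intro!: mult_mono)
      qed (rule bop_comp[OF representsD(2)[OF T] representsD(2)[OF S]], intro tendsto_intros limit(3))
    qed (rule bf)
  qed
  show "bounded_borel f \<Longrightarrow> \<exists>T. represents f T" by (rule exists)
  show "represents f T \<Longrightarrow> represents g S \<Longrightarrow> represents (\<lambda>s. f s * g s) (\<lambda>x. T (S x))"
    using right[OF representsD(1)] by blast
qed

end

section \<open>The bounded Borel functional calculus\<close>

locale spectral_calculus = measure_family +
  assumes represents_exists: "bounded_borel f \<Longrightarrow> \<exists>T. represents f T"
    and represents_mult: "represents f T \<Longrightarrow> represents g S \<Longrightarrow> represents (\<lambda>s. f s * g s) (\<lambda>x. T (S x))"
begin

definition fc :: "(real \<Rightarrow> complex) \<Rightarrow> 'a \<Rightarrow> 'a" where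
  "fc f = (SOME T. represents f T)"

lemma represents_fc: "bounded_borel f \<Longrightarrow> represents f (fc f)"
  unfolding fc_def using represents_exists by (rule someI_ex)

lemma fc_bop: "bounded_borel f \<Longrightarrow> bop (fc f)"
  using representsD(2)[OF represents_fc] .

lemma fc_in [simp]: "bounded_borel f \<Longrightarrow> x \<in> V \<Longrightarrow> fc f x \<in> V"
  using bounded_operatorD(1)[OF fc_bop] .

lemma fc_eq: "represents f T \<Longrightarrow> x \<in> V \<Longrightarrow> fc f x = T x"
  using represents_unique[OF represents_fc[OF representsD(1)]] by blast

lemma fc_form: "bounded_borel f \<Longrightarrow> x \<in> V \<Longrightarrow> ip x (fc f x) = (LINT s|\<mu> x. f s)"
  using representsD(3)[OF represents_fc] .

lemma fc_const: "x \<in> V \<Longrightarrow> fc (\<lambda>s. c) x = sc c x"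
  by (rule fc_eq[OF represents_const])

lemma fc_one: "x \<in> V \<Longrightarrow> fc (\<lambda>s. 1) x = x"
  by (simp add: fc_const)

lemma fc_add: "bounded_borel f \<Longrightarrow> bounded_borel g \<Longrightarrow> x \<in> V \<Longrightarrow> fc (\<lambda>s. f s + g s) x = fc f x + fc g x"
  by (rule fc_eq[OF represents_add[OF represents_fc represents_fc]])

lemma fc_scale: "bounded_borel f \<Longrightarrow> x \<in> V \<Longrightarrow> fc (\<lambda>s. c * f s) x = sc c (fc f x)"
  by (rule fc_eq[OF represents_scale[OF represents_fc]])

lemma fc_mult: "bounded_borel f \<Longrightarrow> bounded_borel g \<Longrightarrow> x \<in> V \<Longrightarrow> fc (\<lambda>s. f s * g s) x = fc f (fc g x)"
  by (rule fc_eq[OF represents_mult[OF represents_fc represents_fc]])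

lemma fc_diff:
  assumes "bounded_borel f" "bounded_borel g" "x \<in> V"
  shows "fc (\<lambda>s. f s - g s) x = fc f x - fc g x"
  using fc_add[OF assms(1) bounded_borel_mult[OF bounded_borel_const assms(2), of "- 1"] assms(3)]
    fc_scale[OF assms(2,3), of "- 1"] by simp

lemma fc_adjoint:
  assumes "bounded_borel f" "x \<in> V" "y \<in> V"
  shows "ip (fc f x) y = ip x (fc (\<lambda>s. cnj (f s)) y)"
  by (rule represents_cnj_adjoint)
    (use represents_fc[OF assms(1)] represents_fc[OF bounded_borel_cnj[OF assms(1)]] assms in auto)

lemma fc_inner_fc:
  assumes "bounded_borel f" "bounded_borel g" "x \<in> V"
  shows "ip (fc f x) (fc g x) = (LINT s|\<mu> x. cnj (f s) * g s)"
  using assms fc_adjoint[of f x "fc g x"] fc_mult[of "\<lambda>s. cnj (f s)" g x] fc_form[of "\<lambda>s. cnj (f s) * g s" x]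
  by (simp add: bounded_borel_cnj bounded_borel_mult)

lemma integrable_norm_sq: "bounded_borel f \<Longrightarrow> x \<in> V \<Longrightarrow> integrable (\<mu> x) (\<lambda>s. (cmod (f s))\<^sup>2)"
  using integrable_norm[OF integrable_family[OF bounded_borel_mult[of f f]]]
  by (simp add: norm_mult power2_eq_square)

lemma fc_norm:
  assumes "bounded_borel f" "x \<in> V"
  shows "(nm (fc f x))\<^sup>2 = (LINT s|\<mu> x. (cmod (f s))\<^sup>2)"
proof -
  have "complex_of_real ((nm (fc f x))\<^sup>2) = ip (fc f x) (fc f x)"
    using assms by (intro inner_self[symmetric]) auto
  also have "\<dots> = (LINT s|\<mu> x. complex_of_real ((cmod (f s))\<^sup>2))"
    unfolding fc_inner_fc[OF assms(1,1,2)] cnj_mult_self ..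
  also have "\<dots> = complex_of_real (LINT s|\<mu> x. (cmod (f s))\<^sup>2)"
    by (rule integral_complex_of_real)
  finally show ?thesis by (simp only: of_real_eq_iff)
qed

lemma fc_eq_if_AE:
  assumes "bounded_borel f" "bounded_borel g" "x \<in> V" "AE s in \<mu> x. f s = g s"
  shows "fc f x = fc g x"
proof -
  have b: "bounded_borel (\<lambda>s. f s - g s)"
    by (intro bounded_borel_diff assms(1) assms(2))
  have "(nm (fc (\<lambda>s. f s - g s) x))\<^sup>2 = (LINT s|\<mu> x. 0)"
    unfolding fc_norm[OF b assms(3)]
    by (rule integral_cong_AE) (use assms b bounded_borel_measurable[OF b] in \<open>auto simp: measurable_family\<close>)
  then show ?thesis
    using hnorm_eq_zero[of "fc f x - fc g x"] assms by (simp add: fc_diff)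
qed

text \<open>The squared norm is the integral of \<open>(cmod (f s))\<^sup>2\<close>, so only values
  on a set carrying \<open>\<mu> x\<close> count; later this restricts all estimates to
  \<open>L\<close>.\<close>

lemma fc_norm_le:
  assumes "bounded_borel f" "x \<in> V" "AE s in \<mu> x. cmod (f s) \<le> C" "C \<ge> 0"
  shows "nm (fc f x) \<le> C * nm x"
proof (rule power2_le_imp_le)
  interpret finite_measure "\<mu> x" using finite_measure_family[OF assms(2)] .
  have "(nm (fc f x))\<^sup>2 \<le> (LINT s|\<mu> x. C\<^sup>2)"
    unfolding fc_norm[OF assms(1,2)]
    using assms(3)
    by (intro integral_mono_AE integrable_norm_sq[OF assms(1,2)]) (auto simp: power_mono elim!: eventually_mono)
  also have "\<dots> = (C * nm x)\<^sup>2"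
    using assms(2) by (simp add: space_family measure_family_UNIV power_mult_distrib mult.commute)
  finally show "(nm (fc f x))\<^sup>2 \<le> (C * nm x)\<^sup>2" .
qed (use assms in auto)

lemma fc_tendsto:
  assumes F: "\<And>n. bounded_borel (F n)" and C: "\<And>n s. cmod (F n s) \<le> C"
    and lim: "\<And>s. (\<lambda>n. F n s) \<longlonglongrightarrow> f s" and f: "bounded_borel f" and x: "x \<in> V"
  shows "(\<lambda>n. nm (fc (F n) x - fc f x)) \<longlonglongrightarrow> 0"
proof -
  have b: "bounded_borel (\<lambda>s. F n s - f s)" for n
    by (intro bounded_borel_diff F f)
  obtain D where D: "\<And>s. cmod (f s) \<le> D" using bounded_borel_bound[OF f] by metis
  interpret finite_measure "\<mu> x" using finite_measure_family[OF x] .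
  have "(\<lambda>n. LINT s|\<mu> x. (cmod (F n s - f s))\<^sup>2) \<longlonglongrightarrow> (LINT s|\<mu> x. 0)"
  proof (rule integral_dominated_convergence[where w = "\<lambda>_. (C + D)\<^sup>2"])
    show "AE s in \<mu> x. (\<lambda>n. (cmod (F n s - f s))\<^sup>2) \<longlonglongrightarrow> 0"
    proof (rule AE_I2)
      fix s
      have "(\<lambda>n. (cmod (F n s - f s))\<^sup>2) \<longlonglongrightarrow> (cmod (f s - f s))\<^sup>2"
        by (intro tendsto_intros lim)
      then show "(\<lambda>n. (cmod (F n s - f s))\<^sup>2) \<longlonglongrightarrow> 0" by simp
    qed
    have "cmod (F n s - f s) \<le> C + D" for n s
      using norm_triangle_ineq4[of "F n s" "f s"] C[of n s] D[of s] by linarith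
    then show "AE s in \<mu> x. norm ((cmod (F n s - f s))\<^sup>2) \<le> (C + D)\<^sup>2" for n
      by (auto intro!: power_mono)
  qed (use b x bounded_borel_measurable[OF b] in \<open>auto simp: measurable_family\<close>)
  then have "(\<lambda>n. (nm (fc (F n) x - fc f x))\<^sup>2) \<longlonglongrightarrow> 0"
    using fc_norm[OF b x] by (simp add: fc_diff F f x)
  then have "(\<lambda>n. sqrt ((nm (fc (F n) x - fc f x))\<^sup>2)) \<longlonglongrightarrow> sqrt 0"
    by (rule tendsto_real_sqrt)
  then show ?thesis using F f x by simp
qed

lemma integral_fc:
  assumes "bounded_borel f" "bounded_borel g" "x \<in> V"
  shows "(LINT s|\<mu> (fc g x). f s) = (LINT s|\<mu> x. f s * complex_of_real ((cmod (g s))\<^sup>2))"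
proof -
  have "(LINT s|\<mu> (fc g x). f s) = ip (fc g x) (fc f (fc g x))"
    using assms by (simp add: fc_form)
  also have "\<dots> = ip (fc g x) (fc (\<lambda>s. f s * g s) x)"
    using assms by (simp add: fc_mult)
  also have "\<dots> = (LINT s|\<mu> x. cnj (g s) * (f s * g s))"
    using assms by (intro fc_inner_fc) auto
  also have "\<dots> = (LINT s|\<mu> x. f s * complex_of_real ((cmod (g s))\<^sup>2))"
    unfolding mult.left_commute[of "cnj (g _)"] cnj_mult_self ..
  finally show ?thesis .
qed

text \<open>Multiplicativity at work: the form of \<open>f\<close> at \<open>fc g x\<close> is the
  form of \<open>cnj g * f * g\<close> at \<open>x\<close>. Indicators then identify the measure,
  which gives access to unbounded integrands at the vectors \<open>fc g x\<close>.\<close>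

lemma measure_fc:
  assumes g: "bounded_borel g" and x: "x \<in> V"
  shows "\<mu> (fc g x) = density (\<mu> x) (\<lambda>s. ennreal ((cmod (g s))\<^sup>2))"
proof (rule measure_eqI)
  have gx: "fc g x \<in> V" using g x by simp
  have m: "(\<lambda>s. ennreal ((cmod (g s))\<^sup>2)) \<in> borel_measurable borel"
    using bounded_borel_measurable[OF g] by measurable
  show "sets (\<mu> (fc g x)) = sets (density (\<mu> x) (\<lambda>s. ennreal ((cmod (g s))\<^sup>2)))"
    using gx x by (simp add: sets_family)
  fix B assume "B \<in> sets (\<mu> (fc g x))"
  then have B: "B \<in> sets borel" using gx by (simp add: sets_family)
  interpret gx: finite_measure "\<mu> (fc g x)" using finite_measure_family[OF gx] .
  have "complex_of_real (measure (\<mu> (fc g x)) B) = (LINT s|\<mu> (fc g x). indicator B s)"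
    using B gx by (simp add: integral_indicator_family)
  also have "\<dots> = (LINT s|\<mu> x. complex_of_real (indicator B s * (cmod (g s))\<^sup>2))"
    unfolding integral_fc[OF bounded_borel_indicator[OF B] g x]
    by (intro Bochner_Integration.integral_cong) (auto simp: indicator_def)
  also have "\<dots> = complex_of_real (LINT s|\<mu> x. indicator B s * (cmod (g s))\<^sup>2)"
    by (rule integral_complex_of_real)
  finally have 1: "measure (\<mu> (fc g x)) B = (LINT s|\<mu> x. indicator B s * (cmod (g s))\<^sup>2)"
    by (simp only: of_real_eq_iff)
  have "integrable (\<mu> x) (\<lambda>s. indicator B s * (cmod (g s))\<^sup>2)"
    using integrable_real_mult_indicator[OF _ integrable_norm_sq[OF g x], of B] B x
    by (simp add: sets_family mult.commute)
  from nn_integral_eq_integral[OF this, symmetric]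
  have "ennreal (LINT s|\<mu> x. indicator B s * (cmod (g s))\<^sup>2) = (\<integral>\<^sup>+s. ennreal (indicator B s * (cmod (g s))\<^sup>2) \<partial>\<mu> x)"
    by simp
  also have "\<dots> = emeasure (density (\<mu> x) (\<lambda>s. ennreal ((cmod (g s))\<^sup>2))) B"
    using B x m by (subst emeasure_density)
      (auto simp: sets_family measurable_family indicator_def intro!: nn_integral_cong)
  finally show "emeasure (\<mu> (fc g x)) B = emeasure (density (\<mu> x) (\<lambda>s. ennreal ((cmod (g s))\<^sup>2))) B"
    using 1 by (simp add: gx.emeasure_eq_measure)
qed

end

section \<open>Projection-valued measures\<close>

locale pvm = hilbert_space +
  fixes E :: "real set \<Rightarrow> 'a \<Rightarrow> 'a"
  assumes pvm: "projection_valued_measure H E"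
begin

abbreviation "\<nu> \<equiv> scalar_spectral_measure H E"

lemma E_bop: "B \<in> sets borel \<Longrightarrow> bop (E B)"
  and E_idem: "B \<in> sets borel \<Longrightarrow> x \<in> V \<Longrightarrow> E B (E B x) = E B x"
  and E_sym: "B \<in> sets borel \<Longrightarrow> x \<in> V \<Longrightarrow> y \<in> V \<Longrightarrow> ip (E B x) y = ip x (E B y)"
  and E_UNIV: "x \<in> V \<Longrightarrow> E UNIV x = x"
  and E_sigma: "range C \<subseteq> sets borel \<Longrightarrow> disjoint_family C \<Longrightarrow> x \<in> V \<Longrightarrow>
    (\<lambda>N. nm ((\<Sum>n<N. E (C n) x) - E (\<Union>n. C n) x)) \<longlonglongrightarrow> 0"
  using pvm unfolding projection_valued_measure_def by blast+

lemma E_in [simp]: "B \<in> sets borel \<Longrightarrow> x \<in> V \<Longrightarrow> E B x \<in> V"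
  using bounded_operatorD(1)[OF E_bop] .

lemma E_form: "B \<in> sets borel \<Longrightarrow> x \<in> V \<Longrightarrow> ip x (E B x) = complex_of_real ((nm (E B x))\<^sup>2)"
  using E_sym[of B x "E B x"] by (simp add: E_idem inner_self)

text \<open>Countable additivity for the constant empty family lets the multiples
  \<open>N * E {} x\<close> converge, which is possible only for 0.\<close>

lemma E_empty: "x \<in> V \<Longrightarrow> E {} x = 0"
proof -
  assume x: "x \<in> V"
  have "(\<lambda>N. nm ((\<Sum>n<N. E {} x) - E {} x)) \<longlonglongrightarrow> 0"
    using E_sigma[of "\<lambda>_. {}" x] x by (simp add: disjoint_family_on_def)
  moreover have "nm ((\<Sum>n<Suc N. E {} x) - E {} x) = real N * nm (E {} x)" for N
  proof -
    have "(\<Sum>n<N. E {} x) = sc (of_nat N) (E {} x)"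
      by (induction N) (auto simp: vs.scale_left_distrib add.commute)
    then show ?thesis using x by (simp add: hnorm_scale)
  qed
  ultimately have "(\<lambda>N. real N * nm (E {} x)) \<longlonglongrightarrow> 0"
    using LIMSEQ_Suc by fastforce
  then have l: "(\<lambda>N. real (Suc N) * nm (E {} x) - real N * nm (E {} x)) \<longlonglongrightarrow> 0 - 0"
    by (intro tendsto_diff LIMSEQ_Suc)
  then have "(\<lambda>N. nm (E {} x)) \<longlonglongrightarrow> 0" by (simp add: algebra_simps)
  then have "nm (E {} x) = 0" by (simp add: LIMSEQ_const_iff)
  then show "E {} x = 0" using x by (simp add: hnorm_eq_zero)
qed

lemma sets_scalar_spectral_measure [simp]: "sets (\<nu> x) = sets borel"
  unfolding scalar_spectral_measure_def using sets.sigma_sets_eq[of "borel :: real measure"] by simp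

text \<open>\<open>measure_of\<close> takes the prescribed values once the set function is known to
  be positive and countably additive; the latter is additivity of \<open>E\<close> in norm together
  with continuity of the inner product.\<close>

lemma emeasure_scalar_spectral_measure:
  assumes x: "x \<in> V" and B: "B \<in> sets borel"
  shows "emeasure (\<nu> x) B = ennreal ((nm (E B x))\<^sup>2)"
proof -
  have "emeasure (\<nu> x) B = ennreal (Re (ip x (E B x)))"
  proof (rule emeasure_measure_of[OF scalar_spectral_measure_def])
    show "positive (sets (\<nu> x)) (\<lambda>B. ennreal (Re (ip x (E B x))))"
      using x by (simp add: positive_def E_empty)
    show "countably_additive (sets (\<nu> x)) (\<lambda>B. ennreal (Re (ip x (E B x))))"
    proof (rule countably_additiveI)
      fix C :: "nat \<Rightarrow> real set"
      assume C: "range C \<subseteq> sets (\<nu> x)" "disjoint_family C" "\<Union> (range C) \<in> sets (\<nu> x)"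
      then have Cs: "C n \<in> sets borel" "range C \<subseteq> sets borel" for n by auto
      have "(\<lambda>N. ip x (\<Sum>n<N. E (C n) x)) \<longlonglongrightarrow> ip x (E (\<Union> (range C)) x)"
        by (rule inner_tendsto) (use x Cs C E_sigma in auto)
      from tendsto_Re[OF this]
      have "(\<lambda>n. Re (ip x (E (C n) x))) sums Re (ip x (E (\<Union> (range C)) x))"
        unfolding sums_def using x Cs by (simp add: inner_sum_right)
      then show "(\<Sum>n. ennreal (Re (ip x (E (C n) x)))) = ennreal (Re (ip x (E (\<Union> (range C)) x)))"
        using x Cs by (intro suminf_ennreal_eq) (auto simp: E_form)
    qed
  qed (use B in auto)
  then show ?thesis using x B by (simp add: E_form)
qed

sublocale fam: measure_family H \<nu>
  by unfold_locales (simp_all add: emeasure_scalar_spectral_measure E_UNIV)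

lemma measure_scalar_spectral_measure:
  "x \<in> V \<Longrightarrow> B \<in> sets borel \<Longrightarrow> measure (\<nu> x) B = (nm (E B x))\<^sup>2"
  by (simp add: measure_def emeasure_scalar_spectral_measure)

lemma represents_E: "B \<in> sets borel \<Longrightarrow> fam.represents (indicator B) (E B)"
  unfolding fam.represents_def
  by (simp add: bounded_borel_indicator E_bop E_form fam.integral_indicator_family measure_scalar_spectral_measure)

lemma E_Un:
  assumes "B \<in> sets borel" "C \<in> sets borel" "B \<inter> C = {}" "x \<in> V"
  shows "E (B \<union> C) x = E B x + E C x"
proof -
  have "(\<lambda>s. indicator B s + indicator C s) = (indicator (B \<union> C) :: real \<Rightarrow> complex)"
    using assms(3) by (intro ext) (auto simp: indicator_def)
  then show ?thesis
    using fam.represents_unique[OF represents_E, of "B \<union> C" "\<lambda>x. E B x + E C x" x]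
      fam.represents_add[OF represents_E represents_E, of B C] assms by simp
qed

text \<open>For \<open>y\<close> in the range of \<open>E C\<close> the set \<open>C\<close> already
  carries the whole mass of \<open>\<nu> y\<close>, so nothing is left for \<open>B\<close>.
  Multiplicativity of \<open>E\<close> follows from this.\<close>

lemma E_disjoint:
  assumes B: "B \<in> sets borel" and C: "C \<in> sets borel" and d: "B \<inter> C = {}" and x: "x \<in> V"
  shows "E B (E C x) = 0"
proof -
  define y where "y = E C x"
  have y: "y \<in> V" "E C y = y" using C x by (simp_all add: y_def E_idem)
  interpret finite_measure "\<nu> y" using fam.finite_measure_family[OF y(1)] .
  have "measure (\<nu> y) B + measure (\<nu> y) C = measure (\<nu> y) (B \<union> C)"
    using B C d by (subst finite_measure_Union) auto
  also have "\<dots> \<le> measure (\<nu> y) UNIV"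
    using B C by (intro finite_measure_mono) auto
  finally have "(nm (E B y))\<^sup>2 \<le> 0"
    using y B C by (simp add: measure_scalar_spectral_measure E_UNIV)
  then show ?thesis using y B hnorm_eq_zero[of "E B y"] by (simp add: y_def)
qed

lemma E_Int:
  assumes B: "B \<in> sets borel" and C: "C \<in> sets borel" and x: "x \<in> V"
  shows "E B (E C x) = E (B \<inter> C) x"
proof -
  have s: "B \<inter> C \<in> sets borel" "B - C \<in> sets borel" "C - B \<in> sets borel" using B C by auto
  have "E C x = E (B \<inter> C) x + E (C - B) x"
    using E_Un[OF s(1,3) _ x] by (simp add: Int_commute Int_Diff_Un) (metis Int_Diff_Un Int_Diff_disjoint Int_commute)
  then have "E B (E C x) = E B (E (B \<inter> C) x) + E B (E (C - B) x)"
    using bounded_operatorD(2)[OF E_bop[OF B]] s x by simp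
  also have "E B (E (C - B) x) = 0" using B s x by (intro E_disjoint) auto
  also have "E B (E (B \<inter> C) x) = E (B \<inter> C) (E (B \<inter> C) x) + E (B - C) (E (B \<inter> C) x)"
    using E_Un[OF s(1,2), of "E (B \<inter> C) x"] s x by (simp add: Int_Diff_Un Int_Diff_disjoint)
  also have "E (B - C) (E (B \<inter> C) x) = 0" using B s x by (intro E_disjoint) auto
  finally show ?thesis using s x by (simp add: E_idem)
qed

text \<open>The generators are the indicators, represented by \<open>E\<close> itself;
  \<open>E_Int\<close> is multiplicativity on them.\<close>

sublocale spectral_calculus H \<nu>
proof
  have ex: "\<exists>T. fam.represents f T" if "f \<in> {indicator B | B. B \<in> sets borel}" for f
    using that represents_E by blast
  have mult: "fam.represents (\<lambda>s. f s * g s) (\<lambda>x. T (S x))"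
    if f: "f \<in> {indicator B | B. B \<in> sets borel}" and g: "g \<in> {indicator B | B. B \<in> sets borel}"
      and T: "fam.represents f T" and S: "fam.represents g S" for f g T S
  proof -
    obtain B C where B: "B \<in> sets borel" "f = indicator B" and C: "C \<in> sets borel" "g = indicator C"
      using f g by blast
    have "(\<lambda>s. f s * g s) = indicator (B \<inter> C)"
      unfolding B C by (auto simp: indicator_def)
    moreover have "T (S x) = E (B \<inter> C) x" if x: "x \<in> V" for x
      using fam.represents_unique[OF T[unfolded B(2)] represents_E[OF B(1)], of "S x"]
        fam.represents_unique[OF S[unfolded C(2)] represents_E[OF C(1)] x] x B(1) C(1) by (simp add: E_Int)
    ultimately show ?thesis
      using fam.represents_cong[OF represents_E[of "B \<inter> C"], of "\<lambda>x. T (S x)"] B(1) C(1) by simp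
  qed
  show "\<exists>T. fam.represents f T" if "bounded_borel f" for f
    by (rule fam.calculus_extension_exists[OF generating_indicators]) (erule ex, erule (3) mult, rule that)
  show "fam.represents (\<lambda>s. f s * g s) (\<lambda>x. T (S x))" if "fam.represents f T" "fam.represents g S" for f g T S
    by (rule fam.calculus_extension_mult[OF generating_indicators _ _ that]) (erule ex, erule (3) mult)
qed

end

section \<open>The projection-valued measure of a calculus\<close>

context spectral_calculus
begin

lemma fc_indicator_norm: "B \<in> sets borel \<Longrightarrow> x \<in> V \<Longrightarrow> ip x (fc (indicator B) x) = complex_of_real (measure (\<mu> x) B)"
  by (simp add: fc_form bounded_borel_indicator integral_indicator_family)

lemma projection_valued_measure_fc: "projection_valued_measure H (\<lambda>B. fc (indicator B))"
  unfolding projection_valued_measure_def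
proof (intro conjI ballI allI impI)
  fix B :: "real set" assume B: "B \<in> sets borel"
  then have b: "bounded_borel (indicator B)" by (rule bounded_borel_indicator)
  show "bop (fc (indicator B))" using b by (rule fc_bop)
  have "(\<lambda>s. indicator B s * indicator B s) = (indicator B :: real \<Rightarrow> complex)"
    by (auto simp: indicator_def)
  then show "fc (indicator B) (fc (indicator B) x) = fc (indicator B) x" if "x \<in> V" for x
    using fc_mult[OF b b that] by simp
  have "(\<lambda>s. cnj (indicator B s)) = (indicator B :: real \<Rightarrow> complex)"
    by (auto simp: indicator_def)
  then show "ip (fc (indicator B) x) y = ip x (fc (indicator B) y)" if "x \<in> V" "y \<in> V" for x y
    using fc_adjoint[OF b that] by simp
next
  fix x assume "x \<in> V"
  then show "fc (indicator UNIV) x = x"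
    using fc_one by (simp add: indicator_def)
next
  fix C :: "nat \<Rightarrow> real set" and x
  assume C: "range C \<subseteq> sets borel" "disjoint_family C" and x: "x \<in> V"
  then have Cs: "C n \<in> sets borel" for n by auto
  define F :: "nat \<Rightarrow> real \<Rightarrow> complex" where "F N = indicator (\<Union>n<N. C n)" for N
  have bF: "bounded_borel (F N)" for N
    unfolding F_def using Cs by (intro bounded_borel_indicator) auto
  have "fc (F N) x = (\<Sum>n<N. fc (indicator (C n)) x)" for N
  proof (induction N)
    case 0
    then show ?case using x fc_const[of x 0] unfolding F_def by (simp add: indicator_def)
  next
    case (Suc N)
    have "C N \<inter> (\<Union>n<N. C n) = {}"
    proof -
      have "C N \<inter> C n = {}" if "n < N" for n
        using C(2) that by (intro disjoint_family_onD[OF C(2)]) auto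
      then show ?thesis by blast
    qed
    then have "F (Suc N) = (\<lambda>s. F N s + indicator (C N) s)"
      unfolding F_def by (auto simp: indicator_def lessThan_Suc fun_eq_iff)
    then show ?case
      using Suc fc_add[OF bF[of N] bounded_borel_indicator[OF Cs] x] by simp
  qed
  moreover have "(\<lambda>N. nm (fc (F N) x - fc (indicator (\<Union>n. C n)) x)) \<longlonglongrightarrow> 0"
  proof (rule fc_tendsto[OF bF _ _ _ x])
    show "cmod (F N s) \<le> 1" for N s
      unfolding F_def by (simp add: indicator_def)
    show "(\<lambda>N. F N s) \<longlonglongrightarrow> indicator (\<Union>n. C n) s" for s
      unfolding F_def by (rule LIMSEQ_indicator_UN)
    show "bounded_borel (indicator (\<Union>n. C n))"
      using Cs by (intro bounded_borel_indicator) auto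
  qed
  ultimately show "(\<lambda>N. nm ((\<Sum>n<N. fc (indicator (C n)) x) - fc (indicator (\<Union>n. C n)) x)) \<longlonglongrightarrow> 0"
    by simp
qed

lemma scalar_spectral_measure_fc:
  assumes "x \<in> V"
  shows "scalar_spectral_measure H (\<lambda>B. fc (indicator B)) x = \<mu> x"
proof -
  interpret P: pvm H "\<lambda>B. fc (indicator B)"
    by unfold_locales (rule projection_valued_measure_fc)
  interpret finite_measure "\<mu> x" using finite_measure_family[OF assms] .
  show ?thesis
  proof (rule measure_eqI)
    fix B assume "B \<in> sets (P.\<nu> x)"
    then have B: "B \<in> sets borel" by simp
    have "(nm (fc (indicator B) x))\<^sup>2 = measure (\<mu> x) B"
      using P.E_form[OF B assms] unfolding fc_indicator_norm[OF B assms] of_real_eq_iff ..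
    then show "emeasure (P.\<nu> x) B = emeasure (\<mu> x) B"
      by (simp add: emeasure_eq_measure P.emeasure_scalar_spectral_measure[OF assms B])
  qed (use assms in \<open>simp add: sets_family\<close>)
qed

end

section \<open>The integral of the identity\<close>

text \<open>The scalar function of the resolvent at \<open>z\<close>. For real \<open>z\<close> its
  value at \<open>s = z\<close> is 0 by the convention for division, so it is still a total Borel
  function, but unbounded near \<open>z\<close>.\<close>

definition rsv :: "complex \<Rightarrow> real \<Rightarrow> complex" where
  "rsv z s = 1 / (complex_of_real s - z)"

lemma rsv_measurable [measurable]: "rsv z \<in> borel_measurable borel"
  unfolding rsv_def by measurable

lemma of_real_minus_nonreal: "Im z \<noteq> 0 \<Longrightarrow> complex_of_real s - z \<noteq> 0"
  by (metis Im_complex_of_real eq_iff_diff_eq_0)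

lemma cmod_of_real_minus_ge: "\<bar>Im z\<bar> \<le> cmod (complex_of_real s - z)"
  using abs_Im_le_cmod[of "complex_of_real s - z"] by simp

lemma bounded_borel_rsv: "Im z \<noteq> 0 \<Longrightarrow> bounded_borel (rsv z)"
  unfolding bounded_borel_def
proof (intro conjI exI allI)
  fix s assume z: "Im z \<noteq> 0"
  show "cmod (rsv z s) \<le> 1 / \<bar>Im z\<bar>"
    unfolding rsv_def using z cmod_of_real_minus_ge[of z s] of_real_minus_nonreal[OF z, of s]
    by (simp add: norm_divide frac_le)
qed simp

lemma of_real_times_rsv: "Im z \<noteq> 0 \<Longrightarrow> complex_of_real s * rsv z s = 1 + z * rsv z s"
  unfolding rsv_def using of_real_minus_nonreal[of z s] by (simp add: field_simps)

lemma bounded_borel_of_real_times_rsv: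
  assumes "Im z \<noteq> 0"
  shows "bounded_borel (\<lambda>s. complex_of_real s * rsv z s)"
  unfolding of_real_times_rsv[OF assms]
  by (intro bounded_borel_add bounded_borel_mult bounded_borel_const bounded_borel_rsv assms)

lemma bounded_borel_of_real_indicator:
  assumes "B \<in> sets borel" "\<And>s. s \<in> B \<Longrightarrow> \<bar>s\<bar> \<le> C"
  shows "bounded_borel (\<lambda>s. complex_of_real s * indicator B s)"
  unfolding bounded_borel_def
proof (intro conjI exI allI)
  show "(\<lambda>s. complex_of_real s * indicator B s) \<in> borel_measurable borel"
    using assms(1) by measurable
  show "cmod (complex_of_real s * indicator B s) \<le> \<bar>C\<bar>" for s
    using assms(2)[of s] by (cases "s \<in> B") auto
qed

lemma rsv_times: "Im z \<noteq> 0 \<Longrightarrow> rsv z s * (complex_of_real s - z) = 1"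
  unfolding rsv_def using of_real_minus_nonreal[of z s] by simp

lemma rsv_nonzero: "Im z \<noteq> 0 \<Longrightarrow> rsv z s \<noteq> 0"
  using rsv_times[of z s] by auto

lemma linear_operatorD:
  assumes "linear_operator H A"
  shows "x \<in> op_dom A \<Longrightarrow> x \<in> hcarrier H"
    and "x \<in> op_dom A \<Longrightarrow> op_app A x \<in> hcarrier H"
    and "x \<in> op_dom A \<Longrightarrow> y \<in> op_dom A \<Longrightarrow> op_app A (x + y) = op_app A x + op_app A y"
    and "x \<in> op_dom A \<Longrightarrow> op_app A (hscale H c x) = hscale H c (op_app A x)"
    and "module.subspace (hscale H) (op_dom A)"
  using assms unfolding linear_operator_def by auto

context spectral_calculus
begin

text \<open>At the vector \<open>fc g y\<close> the measure has density
  \<open>(cmod (g s))\<^sup>2\<close> relative to \<open>\<mu> y\<close>, so square integrability of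
  \<open>s\<close> there becomes that of the bounded function \<open>s * g s\<close>.\<close>

lemma identity_integral_fc:
  assumes g: "bounded_borel g" and sg: "bounded_borel (\<lambda>s. complex_of_real s * g s)" and y: "y \<in> V"
  shows integrable_identity_fc: "integrable (\<mu> (fc g y)) (\<lambda>s. (cmod (complex_of_real s))\<^sup>2)"
    and integral_identity_fc: "(LINT s|\<mu> (fc g y). complex_of_real s) =
      ip (fc g y) (fc (\<lambda>s. complex_of_real s * g s) y)"
proof -
  have [measurable]: "g \<in> borel_measurable (\<mu> y)"
    using bounded_borel_measurable[OF g] y by (simp add: measurable_family)
  have [measurable_cong]: "sets (\<mu> y) = sets borel" using y by (rule sets_family)
  have "integrable (\<mu> y) (\<lambda>s. (cmod (complex_of_real s * g s))\<^sup>2)"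
    using sg y by (rule integrable_norm_sq)
  then have "integrable (density (\<mu> y) (\<lambda>s. ennreal ((cmod (g s))\<^sup>2))) (\<lambda>s. (cmod (complex_of_real s))\<^sup>2)"
    by (subst integrable_density) (auto simp: norm_mult power_mult_distrib mult.commute)
  then show "integrable (\<mu> (fc g y)) (\<lambda>s. (cmod (complex_of_real s))\<^sup>2)"
    by (simp add: measure_fc[OF g y])
  have "(LINT s|\<mu> (fc g y). complex_of_real s) = (LINT s|\<mu> y. (cmod (g s))\<^sup>2 *\<^sub>R complex_of_real s)"
    unfolding measure_fc[OF g y] by (rule integral_density) auto
  also have "\<dots> = (LINT s|\<mu> y. cnj (g s) * (complex_of_real s * g s))"
    by (intro Bochner_Integration.integral_cong)
      (simp_all add: scaleR_conv_of_real mult.left_commute cnj_mult_self del: of_real_power)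
  also have "\<dots> = ip (fc g y) (fc (\<lambda>s. complex_of_real s * g s) y)"
    using fc_inner_fc[OF g sg y] by simp
  finally show "(LINT s|\<mu> (fc g y). complex_of_real s) =
      ip (fc g y) (fc (\<lambda>s. complex_of_real s * g s) y)" .
qed

text \<open>The preimage is formally \<open>s - z\<close> applied to \<open>x\<close>. That function
  is unbounded, so it is truncated to \<open>{- n..n}\<close>; square integrability makes the
  truncations a Cauchy sequence of vectors, and multiplication by \<open>rsv z\<close> turns them
  into indicators that increase to 1.\<close>

lemma fc_rsv_range_if_integrable:
  assumes z: "Im z \<noteq> 0" and x: "x \<in> V" and int: "integrable (\<mu> x) (\<lambda>s. (cmod (complex_of_real s))\<^sup>2)"
  shows "\<exists>y\<in>V. x = fc (rsv z) y"
proof -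
  define I where "I n = {- real n..real n}" for n
  define g where "g n s = (complex_of_real s - z) * indicator (I n) s" for n s
  \<comment> \<open>An integrable majorant of \<open>(cmod (s - z))\<^sup>2\<close>, from
    \<open>(a + b)\<^sup>2 \<le> 2 * a\<^sup>2 + 2 * b\<^sup>2\<close>.\<close>
  define h where "h s = 2 * (cmod (complex_of_real s))\<^sup>2 + 2 * (cmod z)\<^sup>2" for s
  have I: "I n \<in> sets borel" for n by (simp add: I_def)
  have "bounded_borel (\<lambda>s. complex_of_real s * indicator (I n) s + (- z) * indicator (I n) s)" for n
    by (intro bounded_borel_add bounded_borel_mult bounded_borel_indicator I bounded_borel_const
        bounded_borel_of_real_indicator[of _ "real n"]) (auto simp: I_def)
  then have g: "bounded_borel (g n)" for n
    unfolding g_def by (simp add: algebra_simps)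
  interpret finite_measure "\<mu> x" using finite_measure_family[OF x] .
  have [measurable_cong]: "sets (\<mu> x) = sets borel" using x by (rule sets_family)
  have h: "integrable (\<mu> x) h" unfolding h_def using int by (intro Bochner_Integration.integrable_add integrable_mult_right) auto
  have hge: "(cmod (complex_of_real s - z))\<^sup>2 \<le> h s" for s
  proof -
    have "(cmod (complex_of_real s - z))\<^sup>2 \<le> (cmod (complex_of_real s) + cmod z)\<^sup>2"
      by (intro power_mono norm_triangle_ineq4) simp
    also have "\<dots> \<le> h s"
      unfolding h_def using sum_squares_bound[of "cmod (complex_of_real s)" "cmod z"] by (simp add: power2_sum)
    finally show ?thesis .
  qed
  define \<tau> where "\<tau> N = (LINT s|\<mu> x. h s * indicator (- I N) s)" for N
  have hint: "integrable (\<mu> x) (\<lambda>s. h s * indicator (- I N) s)" for N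
    using I x by (intro integrable_real_mult_indicator h) (auto simp: sets_family)
  have "\<tau> \<longlonglongrightarrow> (LINT s|\<mu> x. 0)"
    unfolding \<tau>_def
  proof (rule integral_dominated_convergence[where w = h])
    show "AE s in \<mu> x. (\<lambda>N. h s * indicator (- I N) s) \<longlonglongrightarrow> 0"
    proof (rule AE_I2)
      fix s
      obtain N0 :: nat where N0: "\<bar>s\<bar> \<le> real N0" using real_arch_simple by blast
      then have "\<forall>N\<ge>N0. h s * indicator (- I N) s = 0"
        by (auto simp: I_def indicator_def)
      then show "(\<lambda>N. h s * indicator (- I N) s) \<longlonglongrightarrow> 0"
        by (intro tendsto_eventually) (auto simp: eventually_sequentially)
    qed
    show "AE s in \<mu> x. norm (h s * indicator (- I N) s) \<le> h s" for N
      by (auto simp: h_def indicator_def)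
  qed (use h hint in auto)
  then have \<tau>: "\<tau> \<longlonglongrightarrow> 0" by simp
  have diff: "(nm (fc (g m) x - fc (g n) x))\<^sup>2 \<le> \<tau> N" if "N \<le> m" "N \<le> n" for m n N
  proof -
    have b: "bounded_borel (\<lambda>s. g m s - g n s)"
      by (intro bounded_borel_diff g)
    have "(nm (fc (g m) x - fc (g n) x))\<^sup>2 = (LINT s|\<mu> x. (cmod (g m s - g n s))\<^sup>2)"
      using fc_norm[OF b x] by (simp add: fc_diff g x)
    also have "\<dots> \<le> \<tau> N"
      unfolding \<tau>_def
    proof (rule integral_mono[OF integrable_norm_sq[OF b x] hint])
      fix s
      show "(cmod (g m s - g n s))\<^sup>2 \<le> h s * indicator (- I N) s"
        using that hge[of s] order_trans[OF zero_le_power2 hge[of s]]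
        by (auto simp: g_def I_def indicator_def norm_minus_commute[of z])
    qed
    finally show ?thesis .
  qed
  have "\<exists>N. \<forall>m\<ge>N. \<forall>n\<ge>N. nm (fc (g m) x - fc (g n) x) < e" if "e > 0" for e
  proof -
    have "\<forall>\<^sub>F N in sequentially. \<tau> N < e\<^sup>2"
      using order_tendstoD(2)[OF \<tau>, of "e\<^sup>2"] that by simp
    then obtain N where N: "\<tau> N < e\<^sup>2" by (auto simp: eventually_sequentially)
    have "nm (fc (g m) x - fc (g n) x) < e" if "N \<le> m" "N \<le> n" for m n
      using diff[OF that] N \<open>e > 0\<close> by (intro power2_less_imp_less[of _ e]) auto
    then show ?thesis by blast
  qed
  then obtain y where y: "y \<in> V" "(\<lambda>n. nm (fc (g n) x - y)) \<longlonglongrightarrow> 0"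
    using complete_carrier[of "\<lambda>n. fc (g n) x"] g x by auto
  have r: "bounded_borel (rsv z)" using z by (rule bounded_borel_rsv)
  have "(\<lambda>n. nm (fc (rsv z) (fc (g n) x) - fc (rsv z) y)) \<longlonglongrightarrow> 0"
    by (rule bop_tendsto[OF fc_bop[OF r]]) (use g x y in auto)
  moreover have "(\<lambda>n. nm (fc (rsv z) (fc (g n) x) - x)) \<longlonglongrightarrow> 0"
  proof -
    have "(\<lambda>s. rsv z s * g n s) = indicator (I n)" for n
      unfolding g_def using rsv_times[OF z] by (simp add: mult.assoc[symmetric])
    then have *: "fc (rsv z) (fc (g n) x) = fc (indicator (I n)) x" for n
      using fc_mult[OF r g[of n] x] by simp
    have "(\<lambda>n. nm (fc (indicator (I n)) x - fc (\<lambda>s. 1) x)) \<longlonglongrightarrow> 0"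
    proof (rule fc_tendsto[where C = 1])
      show "(\<lambda>n. indicator (I n) s) \<longlonglongrightarrow> (1 :: complex)" for s
      proof -
        obtain N0 :: nat where N0: "\<bar>s\<bar> \<le> real N0" using real_arch_simple by blast
        then have "\<forall>N\<ge>N0. indicator (I N) s = (1 :: complex)"
          by (auto simp: I_def indicator_def)
        then show ?thesis
          by (intro tendsto_eventually) (auto simp: eventually_sequentially)
      qed
    qed (use I x in \<open>auto simp: indicator_def intro: bounded_borel_indicator[unfolded indicator_def]\<close>)
    then show ?thesis using x by (simp add: * fc_one)
  qed
  ultimately have "fc (rsv z) y = x"
    by (intro limit_unique[of "\<lambda>n. fc (rsv z) (fc (g n) x)"]) (use r g x y in auto)
  then show ?thesis using y by blast
qed

text \<open>Both domains are the range of \<open>fc (rsv \<i>)\<close>: for \<open>A\<close> by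
  assumption, for the integral by \<open>fc_rsv_range_if_integrable\<close>. On that range
  \<open>s * rsv \<i> s = 1 + \<i> * rsv \<i> s\<close> matches the two actions.\<close>

lemma is_spectral_integral_identity:
  assumes A: "linear_operator H A"
    and ran: "\<And>y. y \<in> V \<Longrightarrow> fc (rsv \<i>) y \<in> op_dom A \<and> op_app A (fc (rsv \<i>) y) = y + sc \<i> (fc (rsv \<i>) y)"
    and dom: "\<And>x. x \<in> op_dom A \<Longrightarrow> \<exists>y\<in>V. x = fc (rsv \<i>) y"
  shows "is_spectral_integral H (\<lambda>B. fc (indicator B)) complex_of_real A"
proof -
  let ?\<nu> = "scalar_spectral_measure H (\<lambda>B. fc (indicator B))"
  have b: "bounded_borel (rsv \<i>)" "bounded_borel (\<lambda>s. complex_of_real s * rsv \<i> s)"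
    by (simp_all add: bounded_borel_rsv bounded_borel_of_real_times_rsv)
  have r: "integrable (\<mu> x) (\<lambda>s. (cmod (complex_of_real s))\<^sup>2) \<and> ip x (op_app A x) = (LINT s|\<mu> x. complex_of_real s)"
    if xd: "x \<in> op_dom A" for x
  proof -
    obtain y where y: "y \<in> V" "x = fc (rsv \<i>) y" using dom[OF xd] by blast
    have "fc (\<lambda>s. complex_of_real s * rsv \<i> s) y = y + sc \<i> (fc (rsv \<i>) y)"
      using fc_add[of "\<lambda>s. 1" "\<lambda>s. \<i> * rsv \<i> s" y] fc_scale[OF b(1) y(1), of \<i>] b(1) y(1)
      by (simp add: of_real_times_rsv fc_one bounded_borel_mult)
    then show ?thesis
      using identity_integral_fc[OF b y(1)] ran[OF y(1)] y(2) by simp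
  qed
  have "op_dom A = {x \<in> V. integrable (?\<nu> x) (\<lambda>s. (cmod (complex_of_real s))\<^sup>2)}"
  proof (intro set_eqI iffI)
    fix x assume x: "x \<in> op_dom A"
    then have "x \<in> V" using linear_operatorD(1)[OF A] by blast
    then show "x \<in> {x \<in> V. integrable (?\<nu> x) (\<lambda>s. (cmod (complex_of_real s))\<^sup>2)}"
      using r[OF x] by (simp add: scalar_spectral_measure_fc)
  next
    fix x assume x: "x \<in> {x \<in> V. integrable (?\<nu> x) (\<lambda>s. (cmod (complex_of_real s))\<^sup>2)}"
    then have "x \<in> V" "integrable (?\<nu> x) (\<lambda>s. (cmod (complex_of_real s))\<^sup>2)"
      by auto
    then have "x \<in> V" "integrable (\<mu> x) (\<lambda>s. (cmod (complex_of_real s))\<^sup>2)"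
      using scalar_spectral_measure_fc[of x] by auto
    then show "x \<in> op_dom A"
      using fc_rsv_range_if_integrable[of \<i> x] ran by auto
  qed
  moreover have "ip x (op_app A x) = (LINT s|?\<nu> x. complex_of_real s)" if "x \<in> op_dom A" for x
    using r[OF that] scalar_spectral_measure_fc[OF linear_operatorD(1)[OF A that]] by simp
  ultimately show ?thesis
    unfolding is_spectral_integral_def using A by blast
qed

end

locale spectral_resolution = pvm +
  fixes A :: "'a operator"
  assumes spectral_integral: "is_spectral_integral H E complex_of_real A"
begin

lemma A_linear: "linear_operator H A"
  and A_dom: "op_dom A = {x \<in> V. integrable (\<nu> x) (\<lambda>s. (cmod (complex_of_real s))\<^sup>2)}"
  and A_form: "x \<in> op_dom A \<Longrightarrow> ip x (op_app A x) = (LINT s|\<nu> x. complex_of_real s)"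
  using spectral_integral unfolding is_spectral_integral_def by auto

lemma fc_in_dom:
  assumes "bounded_borel g" "bounded_borel (\<lambda>s. complex_of_real s * g s)" "y \<in> V"
  shows "fc g y \<in> op_dom A"
  unfolding A_dom using assms integrable_identity_fc[OF assms] by simp

text \<open>The definition of a spectral integral fixes only \<open>ip x (op_app A x)\<close>.
  Polarizing along vectors \<open>fc g x\<close> identifies \<open>A (fc g y)\<close> against the
  range of \<open>fc g\<close>, not yet as a vector.\<close>

lemma A_fc_orthogonal:
  assumes g: "bounded_borel g" and sg: "bounded_borel (\<lambda>s. complex_of_real s * g s)" and x: "x \<in> V" and y: "y \<in> V"
  shows "ip (fc g x) (op_app A (fc g y)) = ip (fc g x) (fc (\<lambda>s. complex_of_real s * g s) y)"
proof -
  note lin = linear_operatorD[OF A_linear] and gD = bounded_operatorD[OF fc_bop[OF g]]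
    and sgD = bounded_operatorD[OF fc_bop[OF sg]]
  have d: "fc g u \<in> op_dom A" "op_app A (fc g u) \<in> V" if "u \<in> V" for u
    using fc_in_dom[OF g sg that] lin by auto
  have 1: "sesquilinear (\<lambda>x y. ip (fc g x) (op_app A (fc g y)))"
    unfolding sesquilinear_def using g by (auto simp: gD d lin inner_simps)
  have 2: "sesquilinear (\<lambda>x y. ip (fc g x) (fc (\<lambda>s. complex_of_real s * g s) y))"
    unfolding sesquilinear_def using g sg by (auto simp: gD sgD inner_simps)
  have 3: "ip (fc g u) (op_app A (fc g u)) = ip (fc g u) (fc (\<lambda>s. complex_of_real s * g s) u)"
    if "u \<in> V" for u
    using A_form[OF d(1)[OF that]] integral_identity_fc[OF g sg that] by simp
  show ?thesis
    unfolding polarization[OF 1 x y] polarization[OF 2 x y] by (rule polar_cong[OF 3 x y])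
qed

text \<open>The difference \<open>v\<close> of both sides is orthogonal to the range of
  \<open>fc (rsv \<i>)\<close>, so the adjoint of that operator kills it; since
  \<open>rsv \<i>\<close> has no zeros, the measure of \<open>v\<close> is zero.\<close>

lemma A_fc_rsv:
  assumes y: "y \<in> V"
  shows "op_app A (fc (rsv \<i>) y) = fc (\<lambda>s. complex_of_real s * rsv \<i> s) y"
proof -
  have b: "bounded_borel (rsv \<i>)" "bounded_borel (\<lambda>s. complex_of_real s * rsv \<i> s)"
    by (simp_all add: bounded_borel_rsv bounded_borel_of_real_times_rsv)
  define v where "v = op_app A (fc (rsv \<i>) y) - fc (\<lambda>s. complex_of_real s * rsv \<i> s) y"
  have in_V: "op_app A (fc (rsv \<i>) y) \<in> V" "fc (\<lambda>s. complex_of_real s * rsv \<i> s) y \<in> V"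
    using linear_operatorD(2)[OF A_linear fc_in_dom[OF b y]] b y by auto
  then have v: "v \<in> V" by (simp add: v_def)
  have "fc (\<lambda>s. cnj (rsv \<i> s)) v = 0"
  proof (rule eq_zero_if_orthogonal)
    fix u assume u: "u \<in> V"
    have "ip u (fc (\<lambda>s. cnj (rsv \<i> s)) v) = ip (fc (rsv \<i>) u) v"
      using fc_adjoint[OF b(1) u v] by simp
    also have "\<dots> = 0"
      unfolding v_def using A_fc_orthogonal[OF b u y] in_V u b by (simp add: inner_simps)
    finally show "ip u (fc (\<lambda>s. cnj (rsv \<i> s)) v) = 0" .
  qed (use b v bounded_borel_cnj in auto)
  then have "(LINT s|\<nu> v. (cmod (cnj (rsv \<i> s)))\<^sup>2) = 0"
    using fc_norm[OF bounded_borel_cnj[OF b(1)] v] by simp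
  then have "AE s in \<nu> v. (cmod (cnj (rsv \<i> s)))\<^sup>2 = 0"
    using integral_nonneg_eq_0_iff_AE[OF integrable_norm_sq[OF bounded_borel_cnj[OF b(1)] v]] by simp
  then have "AE s in \<nu> v. False"
    by (rule eventually_mono) (simp add: rsv_nonzero)
  then have "emeasure (\<nu> v) (space (\<nu> v)) = 0"
    using AE_iff_null[of "\<nu> v" "\<lambda>_. False"] by (simp add: null_sets_def fam.space_family[OF v])
  then have "(nm v)\<^sup>2 = 0"
    using fam.total_mass[OF v] fam.space_family[OF v] by (simp add: ennreal_eq_0_iff)
  then have "v = 0" using hnorm_eq_zero[OF v] by simp
  then show ?thesis by (simp add: v_def)
qed

text \<open>Reduction to \<open>rsv \<i>\<close> by the factorization
  \<open>g = rsv \<i> * k\<close>, where \<open>k\<close> is bounded by the two assumptions on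
  \<open>g\<close>.\<close>

lemma A_fc:
  assumes g: "bounded_borel g" and sg: "bounded_borel (\<lambda>s. complex_of_real s * g s)" and y: "y \<in> V"
  shows "op_app A (fc g y) = fc (\<lambda>s. complex_of_real s * g s) y"
proof -
  define k where "k s = (complex_of_real s - \<i>) * g s" for s
  have k: "bounded_borel k"
    unfolding k_def left_diff_distrib by (intro bounded_borel_diff bounded_borel_mult bounded_borel_const g sg)
  have b: "bounded_borel (rsv \<i>)" "bounded_borel (\<lambda>s. complex_of_real s * rsv \<i> s)"
    by (simp_all add: bounded_borel_rsv bounded_borel_of_real_times_rsv)
  have e: "(\<lambda>s. rsv \<i> s * k s) = g" "(\<lambda>s. complex_of_real s * rsv \<i> s * k s) = (\<lambda>s. complex_of_real s * g s)"
    unfolding k_def using rsv_times[of \<i>] by (simp_all add: mult.assoc) (simp_all add: mult.assoc[symmetric])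
  have "fc g y = fc (rsv \<i>) (fc k y)"
    using fc_mult[OF b(1) k y] by (simp add: e)
  moreover have "fc (\<lambda>s. complex_of_real s * g s) y = fc (\<lambda>s. complex_of_real s * rsv \<i> s) (fc k y)"
    using fc_mult[OF b(2) k y] by (simp add: e)
  ultimately show ?thesis using A_fc_rsv[of "fc k y"] k y by simp
qed

text \<open>\<open>fc g y\<close> solves the resolvent equation, and injectivity on the domain lets
  \<open>inv_into\<close> find it. The inverse relation is asked for almost everywhere only, so that
  real points of the resolvent set are covered.\<close>

lemma resolvent_eq_fc:
  assumes z: "z \<in> resolvent_set H A" and g: "bounded_borel g" and sg: "bounded_borel (\<lambda>s. complex_of_real s * g s)"
    and inv: "\<And>x. x \<in> V \<Longrightarrow> AE s in \<nu> x. (complex_of_real s - z) * g s = 1" and y: "y \<in> V"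
  shows "resolvent H A z y = fc g y"
proof -
  have b: "bounded_borel (\<lambda>s. (complex_of_real s - z) * g s)"
    using bounded_borel_add[OF sg bounded_borel_mult[OF bounded_borel_const g, of "- z"]] by (simp add: algebra_simps)
  have "shifted H A z (fc g y) = fc (\<lambda>s. complex_of_real s * g s) y - fc (\<lambda>s. z * g s) y"
    unfolding shifted_def using A_fc[OF g sg y] fc_scale[OF g y] by simp
  also have "\<dots> = fc (\<lambda>s. (complex_of_real s - z) * g s) y"
    using fc_diff[OF sg bounded_borel_mult[OF bounded_borel_const g] y] by (simp add: algebra_simps)
  also have "\<dots> = fc (\<lambda>s. 1) y"
    by (rule fc_eq_if_AE[OF b bounded_borel_const y inv[OF y]])
  finally have "shifted H A z (fc g y) = y" using y by (simp add: fc_one)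
  moreover have "inj_on (shifted H A z) (op_dom A)"
    using z unfolding resolvent_set_def bij_betw_def by blast
  ultimately show ?thesis
    unfolding resolvent_def using inv_into_f_f[of "shifted H A z" "op_dom A" "fc g y"] fc_in_dom[OF g sg y] by simp
qed

lemma fc_indicator_eq: "B \<in> sets borel \<Longrightarrow> x \<in> V \<Longrightarrow> fc (indicator B) x = E B x"
  by (rule fc_eq[OF represents_E])

text \<open>On the spectral subspace of \<open>ball a r\<close> the operator \<open>A - a\<close>
  has norm at most \<open>r\<close>, while \<open>M\<close> bounds its inverse; for
  \<open>\<bar>M\<bar> * r < 1\<close> the subspace is trivial.\<close>

lemma null_near_resolvent_point:
  assumes a: "complex_of_real a \<in> resolvent_set H A"
  shows "\<exists>r>0. \<forall>x\<in>V. emeasure (\<nu> x) (ball a r) = 0"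
proof -
  obtain M where M: "\<And>x. x \<in> op_dom A \<Longrightarrow> nm x \<le> M * nm (shifted H A (complex_of_real a) x)"
    using a unfolding resolvent_set_def by blast
  define r where "r = 1 / (2 * (\<bar>M\<bar> + 1))"
  have r: "r > 0" "\<bar>M\<bar> * r < 1" unfolding r_def by (auto simp: field_simps)
  define B where "B = ball a r"
  have B: "B \<in> sets borel" unfolding B_def by simp
  have b: "bounded_borel (indicator B)" using B by (rule bounded_borel_indicator)
  have sb: "bounded_borel (\<lambda>s. complex_of_real s * indicator B s)"
    using B by (rule bounded_borel_of_real_indicator[of _ "\<bar>a\<bar> + r"]) (auto simp: B_def dist_real_def)
  have "emeasure (\<nu> x) B = 0" if x: "x \<in> V" for x
  proof -
    define y where "y = fc (indicator B) x"
    have y: "y \<in> V" using b x by (simp add: y_def)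
    have yy: "fc (indicator B) y = y"
      unfolding y_def using x B by (simp add: fc_indicator_eq E_idem)
    define k where "k s = complex_of_real s * indicator B s - complex_of_real a * indicator B s" for s
    have k: "bounded_borel k"
      unfolding k_def using bounded_borel_add[OF sb bounded_borel_mult[OF bounded_borel_const b, of "- complex_of_real a"]]
      by simp
    have "shifted H A (complex_of_real a) y = fc k y"
      unfolding shifted_def k_def
      using A_fc[OF b sb y] fc_diff[OF sb bounded_borel_mult[OF bounded_borel_const b] y, of "complex_of_real a"]
        fc_scale[OF b y, of "complex_of_real a"] by (simp add: yy)
    moreover have "nm (fc k y) \<le> r * nm y"
    proof (rule fc_norm_le[OF k y])
      have "cmod (k s) \<le> r" for s
        using r(1) unfolding k_def B_def
        by (auto simp: indicator_def dist_real_def norm_minus_commute simp flip: of_real_diff)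
      then show "AE s in \<nu> y. cmod (k s) \<le> r" by simp
    qed (use r in simp)
    ultimately have "nm y \<le> \<bar>M\<bar> * (r * nm y)"
      using M[OF fc_in_dom[OF b sb y, unfolded yy]] y
      by (smt (verit) abs_ge_self hnorm_nonneg mult_mono mult_right_mono fc_in k zero_le_mult_iff abs_ge_zero mult_left_mono)
    then have "nm y * (1 - \<bar>M\<bar> * r) \<le> 0" by (simp add: algebra_simps)
    then have "nm y \<le> 0" using r by (simp add: mult_le_0_iff)
    then have "nm y = 0" using hnorm_nonneg[OF y] by simp
    then show ?thesis
      using emeasure_scalar_spectral_measure[OF x B] unfolding y_def fc_indicator_eq[OF B x] by simp
  qed
  then show ?thesis using r(1) unfolding B_def by blast
qed

text \<open>The null balls may form an uncountable cover; Lindelof's theorem extracts a countable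
  one.\<close>

lemma AE_open_in_resolvent_set:
  assumes S: "open S" "\<And>s. s \<in> S \<Longrightarrow> complex_of_real s \<in> resolvent_set H A" and x: "x \<in> V"
  shows "AE s in \<nu> x. s \<notin> S"
proof -
  have "\<forall>a\<in>S. \<exists>r>0. emeasure (\<nu> x) (ball a r) = 0"
    using null_near_resolvent_point[OF S(2)] x by blast
  then obtain r where r: "\<And>a. a \<in> S \<Longrightarrow> r a > 0 \<and> emeasure (\<nu> x) (ball a (r a)) = 0" by metis
  obtain F where F: "F \<subseteq> (\<lambda>a. ball a (r a)) ` S" "countable F" "\<Union>F = (\<Union>a\<in>S. ball a (r a))"
    using Lindelof[of "(\<lambda>a. ball a (r a)) ` S"] by auto
  have "\<Union>F \<in> null_sets (\<nu> x)"
    using F(1,2) r by (intro null_sets_UN'[of F "\<lambda>B. B", simplified]) (auto simp: null_sets_def)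
  moreover have "S \<subseteq> \<Union>F" unfolding F(3) using r by auto
  ultimately show ?thesis
    by (intro AE_I'[of "\<Union>F"]) auto
qed

text \<open>On the spectral subspace of \<open>{- n..c}\<close> with \<open>c < \<gamma>\<close> the
  form of \<open>A\<close> is at most \<open>c * (nm y)\<^sup>2\<close>, against the lower bound.
  The intervals are bounded so that \<open>s\<close> is bounded on them, and stop short of
  \<open>\<gamma>\<close> so that the inequality is strict.\<close>

lemma AE_ge_if_bounded_below:
  assumes bb: "bounded_below H A \<gamma>" and x: "x \<in> V"
  shows "AE s in \<nu> x. \<gamma> \<le> s"
proof -
  have "emeasure (\<nu> x) {- real n..\<gamma> - 1 / real (Suc n)} = 0" for n
  proof -
    define c where "c = \<gamma> - 1 / real (Suc n)"
    define B where "B = {- real n..c}"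
    have B: "B \<in> sets borel" by (simp add: B_def)
    have b: "bounded_borel (indicator B)" using B by (rule bounded_borel_indicator)
    have sb: "bounded_borel (\<lambda>s. complex_of_real s * indicator B s)"
      using B by (rule bounded_borel_of_real_indicator[of _ "max (real n) \<bar>c\<bar>"]) (auto simp: B_def)
    interpret finite_measure "\<nu> x" using fam.finite_measure_family[OF x] .
    have "ip (fc (indicator B) x) (op_app A (fc (indicator B) x)) =
        (LINT s|\<nu> x. complex_of_real (s * indicator B s))"
      unfolding A_fc[OF b sb x] fc_inner_fc[OF b sb x]
      by (intro Bochner_Integration.integral_cong) (auto simp: indicator_def)
    also have "\<dots> = complex_of_real (LINT s|\<nu> x. s * indicator B s)"
      by (rule integral_complex_of_real)
    finally have 1: "Re (ip (fc (indicator B) x) (op_app A (fc (indicator B) x))) = (LINT s|\<nu> x. s * indicator B s)"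
      by simp
    have "(LINT s|\<nu> x. s * indicator B s) \<le> (LINT s|\<nu> x. c * indicator B s)"
    proof (rule integral_mono)
      have "integrable (\<nu> x) (\<lambda>s. Re (complex_of_real s * indicator B s))"
        using fam.integrable_family[OF sb x] by (rule integrable_Re)
      moreover have "(\<lambda>s. Re (complex_of_real s * indicator B s)) = (\<lambda>s. s * indicator B s)"
        by (rule ext) (simp add: indicator_def)
      ultimately show "integrable (\<nu> x) (\<lambda>s. s * indicator B s)"
        by simp
      show "integrable (\<nu> x) (\<lambda>s. c * indicator B s)"
        using B by (intro integrable_mult_right integrable_real_indicator) (auto simp: emeasure_finite less_top[symmetric])
    qed (auto simp: indicator_def B_def)
    also have "\<dots> = c * measure (\<nu> x) B"
      using fam.space_family[OF x] by simp
    also have "measure (\<nu> x) B = (nm (fc (indicator B) x))\<^sup>2"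
      by (simp add: measure_scalar_spectral_measure x B fc_indicator_eq)
    finally have "\<gamma> * (nm (fc (indicator B) x))\<^sup>2 \<le> c * (nm (fc (indicator B) x))\<^sup>2"
      using bb fc_in_dom[OF b sb x] 1 unfolding bounded_below_def by fastforce
    moreover have "c < \<gamma>" by (simp add: c_def)
    ultimately have "(nm (fc (indicator B) x))\<^sup>2 = 0"
      by (smt (verit) mult_less_cancel_right_disj zero_le_power2)
    then show ?thesis
      using emeasure_scalar_spectral_measure[OF x B] fc_indicator_eq[OF B x] by (simp add: B_def c_def)
  qed
  then have "(\<Union>n. {- real n..\<gamma> - 1 / real (Suc n)}) \<in> null_sets (\<nu> x)"
    by (intro null_sets_UN) (auto simp: null_sets_def)
  moreover have "{s. s < \<gamma>} \<subseteq> (\<Union>n. {- real n..\<gamma> - 1 / real (Suc n)})"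
  proof
    fix s assume "s \<in> {s. s < \<gamma>}"
    then have s: "s < \<gamma>" by simp
    obtain n1 :: nat where n1: "\<bar>s\<bar> \<le> real n1" using real_arch_simple by blast
    obtain n2 :: nat where n2: "1 / (\<gamma> - s) \<le> real n2" using real_arch_simple by blast
    define n where "n = max n1 n2"
    have "1 / (\<gamma> - s) \<le> real (Suc n)" using n2 unfolding n_def by linarith
    then have "1 / real (Suc n) \<le> \<gamma> - s" using s by (simp add: field_simps)
    moreover have "- real n \<le> s" using n1 unfolding n_def by linarith
    ultimately show "s \<in> (\<Union>n. {- real n..\<gamma> - 1 / real (Suc n)})"
      by (intro UN_I[of n]) auto
  qed
  ultimately show ?thesis
    by (intro AE_I'[of "\<Union>n. {- real n..\<gamma> - 1 / real (Suc n)}"]) (auto simp: not_le)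
qed

end

context pvm
begin

text \<open>Covers functions such as \<open>exp (- t * s)\<close> that are unbounded on the line but
  agree with a bounded \<open>g\<close> where the measures live. The second part shows that every
  operator admissible for the choice in \<open>functional_calculus\<close> acts as
  \<open>fc g\<close>.\<close>

lemma is_spectral_integral_fc:
  assumes f: "f \<in> borel_measurable borel" and g: "bounded_borel g"
    and fg: "\<And>x. x \<in> V \<Longrightarrow> AE s in \<nu> x. f s = g s"
  shows "is_spectral_integral H E f \<lparr>op_dom = V, op_app = fc g\<rparr>"
    and "is_spectral_integral H E f T \<Longrightarrow> x \<in> V \<Longrightarrow> op_app T x = fc g x"
proof -
  note [measurable] = f bounded_borel_measurable[OF g]
  have int: "integrable (\<nu> x) (\<lambda>s. (cmod (f s))\<^sup>2)" if "x \<in> V" for x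
  proof -
    have "AE s in \<nu> x. (cmod (g s))\<^sup>2 = (cmod (f s))\<^sup>2"
      using fg[OF that] by (rule eventually_mono) simp
    then show ?thesis
      using integrable_norm_sq[OF g that] integrable_cong_AE[of "\<lambda>s. (cmod (g s))\<^sup>2" "\<nu> x" "\<lambda>s. (cmod (f s))\<^sup>2"]
      by (simp add: fam.measurable_family[OF that])
  qed
  have form: "(LINT s|\<nu> x. f s) = ip x (fc g x)" if "x \<in> V" for x
    unfolding fc_form[OF g that]
    by (rule integral_cong_AE) (use fg[OF that] f bounded_borel_measurable[OF g] in \<open>auto simp: fam.measurable_family[OF that]\<close>)
  show "is_spectral_integral H E f \<lparr>op_dom = V, op_app = fc g\<rparr>"
    unfolding is_spectral_integral_def linear_operator_def
    using bounded_operatorD[OF fc_bop[OF g]] int form subspace_carrier by auto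
  assume T: "is_spectral_integral H E f T" and x: "x \<in> V"
  have dom: "op_dom T = V" and lin: "linear_operator H T"
    and Tf: "\<And>x. x \<in> V \<Longrightarrow> ip x (op_app T x) = (LINT s|\<nu> x. f s)"
    using T int unfolding is_spectral_integral_def by auto
  note TD = linear_operatorD[OF lin, unfolded dom]
  have "sesquilinear (\<lambda>x y. ip x (op_app T y))"
    unfolding sesquilinear_def by (auto simp: TD inner_simps)
  then have "ip u (op_app T x) = ip u (fc g x)" if "u \<in> V" for u
    using polarization[OF _ that x, of "\<lambda>x y. ip x (op_app T y)"]
      polarization[OF sesquilinear_bop_right[OF fc_bop[OF g]] that x] Tf form that x
      polar_cong[of "\<lambda>x. ip x (op_app T x)" "\<lambda>x. ip x (fc g x)" u x] by simp
  then show "op_app T x = fc g x"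
    using x g TD by (intro eq_if_inner_eq) auto
qed

end

section \<open>Self-adjoint operators\<close>

locale self_adjoint_operator = hilbert_space +
  fixes A :: "'a operator"
  assumes self_adjoint: "self_adjoint H A"
begin

abbreviation "D \<equiv> op_dom A"
abbreviation "Aop \<equiv> op_app A"

lemma A_linear: "linear_operator H A"
  using self_adjoint unfolding self_adjoint_def by blast

lemmas A_simps = linear_operatorD(1,2)[OF A_linear]

lemma D_add: "x \<in> D \<Longrightarrow> y \<in> D \<Longrightarrow> x + y \<in> D \<and> Aop (x + y) = Aop x + Aop y"
  using vs.subspace_add[OF linear_operatorD(5)[OF A_linear]] linear_operatorD(3)[OF A_linear] by blast

lemma D_scale: "x \<in> D \<Longrightarrow> sc c x \<in> D \<and> Aop (sc c x) = sc c (Aop x)"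
  using vs.subspace_scale[OF linear_operatorD(5)[OF A_linear]] linear_operatorD(4)[OF A_linear] by blast

lemma D_diff: "x \<in> D \<Longrightarrow> y \<in> D \<Longrightarrow> x - y \<in> D \<and> Aop (x - y) = Aop x - Aop y"
  using D_add[of x "sc (- 1) y"] D_scale[of y "- 1"] by simp

lemma orthogonal_to_D:
  assumes w: "w \<in> V" and orth: "\<And>x. x \<in> D \<Longrightarrow> ip w x = 0"
  shows "w = 0"
proof -
  have "nm w \<le> e" if e: "e > 0" for e
  proof -
    obtain d where d: "d \<in> D" "nm (w - d) < e"
      using self_adjoint w e unfolding self_adjoint_def hdense_def by blast
    have "(nm w)\<^sup>2 = Re (ip w (w - d))"
      using orth[OF d(1)] w A_simps(1)[OF d(1)] by (simp add: inner_simps hnorm_sq)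
    also have "\<dots> \<le> nm w * nm (w - d)"
      using Cauchy_Schwarz[of w "w - d"] complex_Re_le_cmod order_trans w A_simps(1)[OF d(1)] by blast
    also have "\<dots> \<le> nm w * e" using d(2) w by (intro mult_left_mono) auto
    finally show ?thesis
      using hnorm_nonneg[OF w] e by (cases "nm w = 0") (auto simp: power2_eq_square)
  qed
  then have "nm w \<le> 0" by (rule field_le_epsilon[of "nm w" 0, simplified])
  then have "nm w = 0" using hnorm_nonneg[OF w] by linarith
  then show ?thesis using w by (simp add: hnorm_eq_zero)
qed

lemma adjoint_unique:
  assumes "z \<in> V" "z' \<in> V" "\<And>x. x \<in> D \<Longrightarrow> ip z x = ip z' x"
  shows "z = z'"
  using orthogonal_to_D[of "z - z'"] assms A_simps(1) by (simp add: inner_simps)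

text \<open>Density makes the value of the adjoint unique, so the definite description in
  \<open>adjoint_operator\<close> can be evaluated.\<close>

lemma symmetric:
  assumes y: "y \<in> D" and x: "x \<in> D"
  shows "ip (Aop y) x = ip y (Aop x)"
proof -
  define adj where "adj z \<longleftrightarrow> z \<in> V \<and> (\<forall>x\<in>D. ip z x = ip y (Aop x))" for z
  have "y \<in> op_dom (adjoint_operator H A)" "op_app (adjoint_operator H A) y = Aop y"
    using self_adjoint y unfolding self_adjoint_def by auto
  then have "\<exists>z. adj z" "Aop y = (THE z. adj z)"
    unfolding adjoint_operator_def adj_def by auto
  moreover have "z = z'" if "adj z" "adj z'" for z z'
    using that adjoint_unique unfolding adj_def by simp
  ultimately have "adj (Aop y)" by (metis the_equality)
  then show ?thesis using x unfolding adj_def by blast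
qed

lemma maximal:
  assumes y: "y \<in> V" and z: "z \<in> V" and eq: "\<And>x. x \<in> D \<Longrightarrow> ip z x = ip y (Aop x)"
  shows "y \<in> D \<and> Aop y = z"
proof -
  have "y \<in> op_dom (adjoint_operator H A)"
    unfolding adjoint_operator_def using assms by auto
  then have "y \<in> D" using self_adjoint unfolding self_adjoint_def by simp
  moreover from this have "Aop y = z"
    using symmetric eq A_simps z by (intro adjoint_unique) auto
  ultimately show ?thesis by blast
qed

text \<open>An adjoint is closed, since the relation that defines it survives limits.\<close>

lemma closed_graph:
  assumes X: "\<And>n. X n \<in> D" and x: "x \<in> V" "(\<lambda>n. nm (X n - x)) \<longlonglongrightarrow> 0"
    and w: "w \<in> V" "(\<lambda>n. nm (Aop (X n) - w)) \<longlonglongrightarrow> 0"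
  shows "x \<in> D \<and> Aop x = w"
proof (rule maximal[OF x(1) w(1)])
  fix u assume u: "u \<in> D"
  have "(\<lambda>n. ip (Aop (X n)) u) \<longlonglongrightarrow> ip w u" "(\<lambda>n. ip (X n) (Aop u)) \<longlonglongrightarrow> ip x (Aop u)"
    using X x w u A_simps by (auto intro!: inner_tendsto)
  then show "ip w u = ip x (Aop u)"
    using symmetric[OF X u] LIMSEQ_unique by simp
qed

text \<open>Representing \<open>\<langle>y, \<cdot>\<rangle>\<close> in the domain with the graph inner product solves \<open>(A\<^sup>2 + 1) w = y\<close>,
  and \<open>(A \<plusminus> \<i>) w\<close> are then the preimages of \<open>y\<close> under \<open>A \<minusplus> \<i>\<close>.\<close>

definition graph_space :: "'a hilbert" where
  "graph_space = \<lparr>hcarrier = D, hscale = sc, hinner = \<lambda>x y. ip (Aop x) (Aop y) + ip x y\<rparr>"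

lemma graph_space_simps [simp]:
  "hcarrier graph_space = D" "hscale graph_space = sc"
  "hinner graph_space x y = ip (Aop x) (Aop y) + ip x y"
  by (simp_all add: graph_space_def)

lemma hnorm_graph_space: "x \<in> D \<Longrightarrow> hnorm graph_space x = sqrt ((nm (Aop x))\<^sup>2 + (nm x)\<^sup>2)"
  by (simp add: hnorm_def[of graph_space] hnorm_sq A_simps)

text \<open>Completeness in the graph norm is closedness of \<open>A\<close>: a Cauchy sequence in
  that norm makes both \<open>X n\<close> and \<open>Aop (X n)\<close> Cauchy.\<close>

lemma hilbert_space_graph_space: "hilbert_space graph_space"
proof (rule hilbert_space.intro)
  show "\<exists>x\<in>hcarrier graph_space. (\<lambda>n. hnorm graph_space (X n - x)) \<longlonglongrightarrow> 0"
    if X: "\<And>n. X n \<in> hcarrier graph_space"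
      and C: "\<And>e. e > 0 \<Longrightarrow> \<exists>N. \<forall>m\<ge>N. \<forall>n\<ge>N. hnorm graph_space (X m - X n) < e" for X :: "nat \<Rightarrow> 'a"
  proof -
    have XD: "X n \<in> D" for n using X by simp
    have le: "nm (X m - X n) \<le> hnorm graph_space (X m - X n)"
      "nm (Aop (X m) - Aop (X n)) \<le> hnorm graph_space (X m - X n)" for m n
      using D_diff[OF XD XD] by (auto simp: hnorm_graph_space real_le_rsqrt)
    have "\<exists>x\<in>V. (\<lambda>n. nm (X n - x)) \<longlonglongrightarrow> 0"
    proof (rule complete_carrier)
      show "\<exists>N. \<forall>m\<ge>N. \<forall>n\<ge>N. nm (X m - X n) < e" if "e > 0" for e
        using C[OF that] le(1) by (meson order_le_less_trans)
    qed (use XD A_simps in auto)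
    then obtain x where x: "x \<in> V" "(\<lambda>n. nm (X n - x)) \<longlonglongrightarrow> 0" by blast
    have "\<exists>w\<in>V. (\<lambda>n. nm (Aop (X n) - w)) \<longlonglongrightarrow> 0"
    proof (rule complete_carrier)
      show "\<exists>N. \<forall>m\<ge>N. \<forall>n\<ge>N. nm (Aop (X m) - Aop (X n)) < e" if "e > 0" for e
        using C[OF that] le(2) by (meson order_le_less_trans)
    qed (use XD A_simps in auto)
    then obtain w where w: "w \<in> V" "(\<lambda>n. nm (Aop (X n) - w)) \<longlonglongrightarrow> 0" by blast
    have xD: "x \<in> D" "Aop x = w" using closed_graph[OF XD x w] by auto
    have "hnorm graph_space (X n - x) = sqrt ((nm (Aop (X n) - w))\<^sup>2 + (nm (X n - x))\<^sup>2)" for n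
      using D_diff[OF XD xD(1)] xD(2) by (simp add: hnorm_graph_space)
    moreover have "(\<lambda>n. sqrt ((nm (Aop (X n) - w))\<^sup>2 + (nm (X n - x))\<^sup>2)) \<longlonglongrightarrow> sqrt (0\<^sup>2 + 0\<^sup>2)"
      by (intro tendsto_intros x w)
    ultimately have "(\<lambda>n. hnorm graph_space (X n - x)) \<longlonglongrightarrow> 0" by simp
    then show ?thesis using xD(1) by (intro bexI[of _ x]) auto
  qed
  show "vector_space (hscale graph_space)" by (simp add: vector_space_scale)
  show "module.subspace (hscale graph_space) (hcarrier graph_space)"
    using linear_operatorD(5)[OF A_linear] by simp
  show "hinner graph_space x y = cnj (hinner graph_space y x)"
    if "x \<in> hcarrier graph_space" "y \<in> hcarrier graph_space" for x y
    using that inner_commute[of "Aop x" "Aop y"] inner_commute[of x y] by (simp add: A_simps)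
  show "Re (hinner graph_space x x) > 0" if "x \<in> hcarrier graph_space" "x \<noteq> 0" for x
    using that inner_pos[of x] inner_self_nonneg[of "Aop x"] by (simp add: A_simps add_nonneg_pos)
qed (auto simp: D_add D_scale A_simps inner_simps algebra_simps)

lemma square_plus_one_surj:
  assumes y: "y \<in> V"
  obtains w where "w \<in> D" "Aop w \<in> D" "Aop (Aop w) + w = y"
proof -
  interpret G: hilbert_space graph_space by (rule hilbert_space_graph_space)
  have "\<exists>!w. w \<in> G.V \<and> (\<forall>u\<in>G.V. G.ip w u = ip y u)"
  proof (rule G.Riesz_representation[where M = "nm y"])
    fix u assume "u \<in> G.V"
    then have u: "u \<in> D" by simp
    have "cmod (ip y u) \<le> nm y * nm u"
      using Cauchy_Schwarz y A_simps(1)[OF u] by blast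
    also have "nm u \<le> G.nm u" using u by (simp add: hnorm_graph_space real_le_rsqrt)
    finally show "cmod (ip y u) \<le> nm y * G.nm u" using y by (simp add: mult_left_mono)
  qed (use y A_simps in \<open>auto simp: inner_simps\<close>)
  then obtain w where w: "w \<in> D" "\<And>u. u \<in> D \<Longrightarrow> ip (Aop w) (Aop u) + ip w u = ip y u" by auto
  have "Aop w \<in> D \<and> Aop (Aop w) = y - w"
  proof (rule maximal)
    fix u assume u: "u \<in> D"
    show "ip (y - w) u = ip (Aop w) (Aop u)"
      using w(2)[OF u] y A_simps(1)[OF u] A_simps(1)[OF w(1)] by (simp add: inner_simps algebra_simps)
  qed (use y w A_simps in auto)
  then show ?thesis using that w(1) by simp
qed

text \<open>\<open>ip (Aop x) x\<close> is real by symmetry, so the cross term is purely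
  imaginary.\<close>

lemma norm_shift:
  assumes "x \<in> D" "c = \<i> \<or> c = - \<i>"
  shows "(nm (Aop x + sc c x))\<^sup>2 = (nm (Aop x))\<^sup>2 + (nm x)\<^sup>2"
proof -
  have "Im (ip (Aop x) x) = 0"
    using symmetric[OF assms(1,1)] arg_cong[OF inner_commute[of x "Aop x"], of Im] A_simps assms(1) by simp
  then show ?thesis
    using assms A_simps[OF assms(1)] by (auto simp: hnorm_add_sq hnorm_scale inner_simps)
qed

lemma ex1_resolvent:
  assumes y: "y \<in> V" and c: "c = \<i> \<or> c = - \<i>"
  shows "\<exists>!x. x \<in> D \<and> Aop x + sc c x = y"
proof -
  obtain w where w: "w \<in> D" "Aop w \<in> D" "Aop (Aop w) + w = y"
    using square_plus_one_surj[OF y] .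
  define x where "x = Aop w - sc c w"
  have "x \<in> D" "Aop x = Aop (Aop w) - sc c (Aop w)"
    using D_diff[OF w(2)] D_scale[OF w(1), of c] unfolding x_def by auto
  moreover have "c * c = - 1" using c by auto
  ultimately have x: "x \<in> D \<and> Aop x + sc c x = y"
    using w(3) unfolding x_def by (simp add: vs.scale_right_diff_distrib)
  show ?thesis
  proof (rule ex1I[of _ x])
    show "x \<in> D \<and> Aop x + sc c x = y" by (rule x)
    fix x' assume x': "x' \<in> D \<and> Aop x' + sc c x' = y"
    have "Aop (x' - x) = Aop x' - Aop x" using D_diff[of x' x] x x' by blast
    then have "Aop (x' - x) + sc c (x' - x) = (Aop x' + sc c x') - (Aop x + sc c x)"
      by (simp only: vs.scale_right_diff_distrib add_diff_add)
    then have d: "x' - x \<in> D" "Aop (x' - x) + sc c (x' - x) = 0"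
      using D_diff[of x' x] x x' by auto
    have "(nm (x' - x))\<^sup>2 \<le> 0"
      using norm_shift[OF d(1) c] unfolding d(2) by (simp add: sum_power2_le_zero_iff)
    then show "x' = x" using hnorm_eq_zero[of "x' - x"] A_simps(1)[OF d(1)] by simp
  qed
qed

section \<open>The resolvent at \<open>\<i>\<close> and the Cayley transform\<close>

definition R :: "'a \<Rightarrow> 'a" where
  "R y = (THE x. x \<in> D \<and> Aop x + sc (- \<i>) x = y)"

lemma R_in_D: "y \<in> V \<Longrightarrow> R y \<in> D"
  and A_R: "y \<in> V \<Longrightarrow> Aop (R y) = y + sc \<i> (R y)"
  using theI'[OF ex1_resolvent[of y "- \<i>"]] unfolding R_def[symmetric] by (auto simp: algebra_simps)

lemma R_eqI: "x \<in> D \<Longrightarrow> R (Aop x - sc \<i> x) = x"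
  using ex1_resolvent[of "Aop x - sc \<i> x" "- \<i>"] A_simps unfolding R_def
  by (intro the1_equality) auto

lemma R_in [simp]: "y \<in> V \<Longrightarrow> R y \<in> V"
  using R_in_D A_simps(1) by blast

lemma R_linear: "y \<in> V \<Longrightarrow> z \<in> V \<Longrightarrow> R (y + z) = R y + R z" "y \<in> V \<Longrightarrow> R (sc c y) = sc c (R y)"
proof -
  assume y: "y \<in> V"
  show "R (sc c y) = sc c (R y)"
    using R_eqI[of "sc c (R y)"] D_scale[OF R_in_D[OF y], of c] A_R[OF y]
    by (simp add: vs.scale_right_distrib mult.commute)
  assume z: "z \<in> V"
  show "R (y + z) = R y + R z"
    using R_eqI[of "R y + R z"] D_add[OF R_in_D[OF y] R_in_D[OF z]] A_R[OF y] A_R[OF z]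
    by (simp add: vs.scale_right_distrib algebra_simps)
qed

lemma bop_R: "bop R"
  unfolding bounded_operator_def
proof (intro conjI ballI allI exI)
  fix y assume y: "y \<in> V"
  have "Aop (R y) + sc (- \<i>) (R y) = y" using A_R[OF y] by simp
  then have "(nm (R y))\<^sup>2 \<le> (nm y)\<^sup>2"
    using norm_shift[OF R_in_D[OF y], of "- \<i>"] by simp
  then show "nm (R y) \<le> 1 * nm y" using y power2_le_imp_le[of "nm (R y)" "nm y"] by simp
  show "R y \<in> V" using y by simp
  show "R (sc c y) = sc c (R y)" for c using R_linear(2)[OF y] .
  show "R (y + z) = R y + R z" if "z \<in> V" for z using R_linear(1)[OF y that] .
qed

text \<open>The Cayley transform \<open>(A + \<i>) R\<close>, where \<open>R\<close> inverts
  \<open>A - \<i>\<close>, in a form that is visibly bounded and everywhere defined.\<close>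

definition U :: "'a \<Rightarrow> 'a" where
  "U y = y + sc (2 * \<i>) (R y)"

lemma bop_U: "bop U"
  unfolding U_def by (intro bop_add bop_id bop_scale bop_R)

lemma U_in [simp]: "y \<in> V \<Longrightarrow> U y \<in> V"
  by (simp add: U_def)

lemma U_R: "y \<in> V \<Longrightarrow> U y = Aop (R y) + sc \<i> (R y)"
  using vs.scale_left_distrib[of \<i> \<i> "R y"] by (simp add: U_def A_R add.assoc)

lemma norm_U: "y \<in> V \<Longrightarrow> nm (U y) = nm y"
proof (rule power2_eq_imp_eq)
  assume y: "y \<in> V"
  have "Aop (R y) + sc (- \<i>) (R y) = y" using A_R[OF y] by simp
  then show "(nm (U y))\<^sup>2 = (nm y)\<^sup>2"
    using norm_shift[OF R_in_D[OF y], of "\<i>"] norm_shift[OF R_in_D[OF y], of "- \<i>"] U_R[OF y] by simp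
qed auto

lemma inner_U:
  assumes "x \<in> V" "y \<in> V"
  shows "ip (U x) (U y) = ip x y"
proof -
  note UD = bounded_operatorD[OF bop_U]
  have 1: "sesquilinear (\<lambda>x y. ip (U x) (U y))"
    unfolding sesquilinear_def by (auto simp: UD inner_simps)
  have 2: "sesquilinear ip"
    unfolding sesquilinear_def by (auto simp: inner_simps)
  have 3: "ip (U u) (U u) = ip u u" if "u \<in> V" for u
    using that by (simp add: inner_self norm_U)
  show ?thesis
    unfolding polarization[OF 1 assms] polarization[OF 2 assms] by (rule polar_cong[OF 3 assms])
qed

lemma U_surj: "y \<in> V \<Longrightarrow> \<exists>x\<in>V. U x = y"
proof -
  assume y: "y \<in> V"
  obtain x where x: "x \<in> D" "Aop x + sc \<i> x = y"
    using ex1_resolvent[OF y, of \<i>] by blast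
  have u: "Aop x - sc \<i> x \<in> V" using x A_simps by auto
  have "U (Aop x - sc \<i> x) = y"
    using U_R[OF u] R_eqI[OF x(1)] x(2) by simp
  then show ?thesis using u by blast
qed

lemma U_inj: "x \<in> V \<Longrightarrow> y \<in> V \<Longrightarrow> U x = U y \<Longrightarrow> x = y"
  using norm_U[of "x - y"] self.bounded_operator_diff[OF bop_U, of x y] hnorm_eq_zero[of "x - y"] by simp

definition Ui :: "'a \<Rightarrow> 'a" where
  "Ui = inv_into V U"

lemma Ui: "y \<in> V \<Longrightarrow> Ui y \<in> V" "y \<in> V \<Longrightarrow> U (Ui y) = y" "y \<in> V \<Longrightarrow> Ui (U y) = y"
proof -
  assume y: "y \<in> V"
  have im: "y \<in> U ` V" using U_surj[OF y] by blast
  show "Ui y \<in> V" unfolding Ui_def using im by (rule inv_into_into)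
  show "U (Ui y) = y" unfolding Ui_def using im by (rule f_inv_into_f)
  have "inj_on U V" using U_inj by (intro inj_onI)
  then show "Ui (U y) = y" unfolding Ui_def using y by (rule inv_into_f_f)
qed

lemma bop_Ui: "bop Ui"
  unfolding bounded_operator_def
proof (intro conjI ballI allI exI)
  note UD = bounded_operatorD[OF bop_U]
  fix x assume x: "x \<in> V"
  show "Ui x \<in> V" using Ui(1)[OF x] .
  show "nm (Ui x) \<le> 1 * nm x" using norm_U[OF Ui(1)[OF x]] Ui(2)[OF x] by simp
  show "Ui (sc c x) = sc c (Ui x)" for c
    by (rule U_inj) (use x in \<open>simp_all add: Ui UD\<close>)
  fix y assume y: "y \<in> V"
  show "Ui (x + y) = Ui x + Ui y"
    by (rule U_inj) (use x y in \<open>simp_all add: Ui UD\<close>)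
qed

lemma inner_U_left: "x \<in> V \<Longrightarrow> y \<in> V \<Longrightarrow> ip (U x) y = ip x (Ui y)"
  using inner_U[of x "Ui y"] by (simp add: Ui)

lemma R_eq_U: "y \<in> V \<Longrightarrow> R y = sc (1 / (2 * \<i>)) (U y - y)"
  by (simp add: U_def)

lemma U_pow_in [simp]: "x \<in> V \<Longrightarrow> (U ^^ k) x \<in> V"
  by (induction k) auto

lemma norm_U_pow [simp]: "x \<in> V \<Longrightarrow> nm ((U ^^ k) x) = nm x"
  by (induction k) (auto simp: norm_U)

lemma inner_U_pow: "x \<in> V \<Longrightarrow> y \<in> V \<Longrightarrow> ip ((U ^^ k) x) ((U ^^ k) y) = ip x y"
  by (induction k) (auto simp: inner_U)

lemma U_pow_bop: "bop (U ^^ k)"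
proof (induction k)
  case 0
  then show ?case using bop_id by (simp add: id_def)
next
  case (Suc k)
  then show ?case using bop_comp[OF bop_U Suc] by (simp add: comp_def)
qed

text \<open>The mean ergodic theorem; there is no fixed vector because the range of \<open>U - 1\<close> is \<open>D\<close>.\<close>

lemma U_average_tendsto:
  assumes x: "x \<in> V"
  shows "(\<lambda>N. nm (\<Sum>k<N. (U ^^ k) x) / real N) \<longlonglongrightarrow> 0"
proof (rule LIMSEQ_I)
  fix e :: real assume e: "e > 0"
  obtain d where d: "d \<in> D" "nm (x - d) < e / 2"
    using self_adjoint x e unfolding self_adjoint_def hdense_def by (meson half_gt_zero)
  have dV: "d \<in> V" using d A_simps by blast
  \<comment> \<open>Chosen so that \<open>d = U w - w\<close>: \<open>U - 1\<close> is
    \<open>2 * \<i>\<close> times \<open>R\<close>, and \<open>R\<close> inverts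
    \<open>A - \<i>\<close>. The sums over the powers of \<open>U\<close> then telescope on
    \<open>d\<close>.\<close>
  define w where "w = sc (1 / (2 * \<i>)) (Aop d - sc \<i> d)"
  have w: "w \<in> V" using d A_simps unfolding w_def by auto
  have "R w = sc (1 / (2 * \<i>)) d"
    using R_linear(2)[of "Aop d - sc \<i> d" "1 / (2 * \<i>)"] R_eqI[OF d(1)] A_simps[OF d(1)]
    unfolding w_def by (simp only: diff_in scale_in)
  then have dw: "d = U w - w" by (simp add: U_def)
  have tele: "(\<Sum>k<N. (U ^^ k) d) = (U ^^ N) w - w" for N
  proof (induction N)
    case (Suc N)
    have "(U ^^ N) d = (U ^^ N) (U w) - (U ^^ N) w"
      unfolding dw using self.bounded_operator_diff[OF U_pow_bop] w by simp
    then show ?case using Suc by (simp add: funpow_swap1)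
  qed simp
  obtain N0 :: nat where N0: "4 * nm w / e < real N0" using reals_Archimedean2 by blast
  have "norm (nm (\<Sum>k<N. (U ^^ k) x) / real N - 0) < e" if N: "N \<ge> Suc N0" for N
  proof -
    have "(\<Sum>k<N. (U ^^ k) x) = (\<Sum>k<N. (U ^^ k) (x - d)) + (\<Sum>k<N. (U ^^ k) d)"
      using self.bounded_operator_diff[OF U_pow_bop x dV] by (simp flip: sum.distrib)
    then have "nm (\<Sum>k<N. (U ^^ k) x) \<le> nm (\<Sum>k<N. (U ^^ k) (x - d)) + nm (\<Sum>k<N. (U ^^ k) d)"
      using x dV hnorm_triangle[of "\<Sum>k<N. (U ^^ k) (x - d)" "\<Sum>k<N. (U ^^ k) d"] by simp
    also have "nm (\<Sum>k<N. (U ^^ k) (x - d)) \<le> real N * nm (x - d)" for N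
    proof (induction N)
      case (Suc N)
      then show ?case
        using hnorm_triangle[of "\<Sum>k<N. (U ^^ k) (x - d)" "(U ^^ N) (x - d)"] x dV by (simp add: algebra_simps)
    qed simp
    also have "nm (\<Sum>k<N. (U ^^ k) d) \<le> 2 * nm w"
      unfolding tele using hnorm_diff_le[of "(U ^^ N) w" w] w by simp
    finally have "nm (\<Sum>k<N. (U ^^ k) x) \<le> real N * nm (x - d) + 2 * nm w" by simp
    moreover have "2 * nm w < real N * (e / 2)"
    proof -
      have "4 * nm w < real N0 * e" using N0 e by (simp add: field_simps)
      also have "\<dots> \<le> real N * e" using N e by (intro mult_right_mono) auto
      finally show ?thesis by simp
    qed
    moreover have "real N * nm (x - d) \<le> real N * (e / 2)"
      using d(2) by (intro mult_left_mono) auto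
    ultimately have "nm (\<Sum>k<N. (U ^^ k) x) < real N * e" by simp
    moreover have "real N > 0" using N by simp
    ultimately show ?thesis using x by (simp add: field_simps)
  qed
  then show "\<exists>no. \<forall>n\<ge>no. norm (nm (\<Sum>k<n. (U ^^ k) x) / real n - 0) < e" by blast
qed

end

section \<open>Uniform approximation by polynomials in resolvents\<close>

lemma cnj_rsv: "cnj (rsv z s) = rsv (cnj z) s"
  by (simp add: rsv_def)

text \<open>Polynomials in the resolvent function and its conjugate, generated by one factor at a
  time, so that an induction only has to treat a single resolvent factor. Closure under products is
  derived.\<close>

inductive_set resolvent_algebra :: "complex \<Rightarrow> (real \<Rightarrow> complex) set" for z where
  const: "(\<lambda>s. c) \<in> resolvent_algebra z"
| add: "f \<in> resolvent_algebra z \<Longrightarrow> g \<in> resolvent_algebra z \<Longrightarrow> (\<lambda>s. f s + g s) \<in> resolvent_algebra z"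
| rsv: "f \<in> resolvent_algebra z \<Longrightarrow> (\<lambda>s. rsv z s * f s) \<in> resolvent_algebra z"
| rsv_cnj: "f \<in> resolvent_algebra z \<Longrightarrow> (\<lambda>s. rsv (cnj z) s * f s) \<in> resolvent_algebra z"

lemma resolvent_algebra_scale: "f \<in> resolvent_algebra z \<Longrightarrow> (\<lambda>s. c * f s) \<in> resolvent_algebra z"
  by (induction rule: resolvent_algebra.induct)
    (auto simp: distrib_left mult.left_commute[of c] intro: resolvent_algebra.intros)

lemma resolvent_algebra_mult:
  assumes "f \<in> resolvent_algebra z" "g \<in> resolvent_algebra z"
  shows "(\<lambda>s. f s * g s) \<in> resolvent_algebra z"
  using assms(1)
  by (induction rule: resolvent_algebra.induct)
    (auto simp: distrib_right mult.assoc intro: resolvent_algebra.intros resolvent_algebra_scale[OF assms(2)])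

lemma resolvent_algebra_rsv: "rsv z \<in> resolvent_algebra z" "rsv (cnj z) \<in> resolvent_algebra z"
  using resolvent_algebra.rsv[OF resolvent_algebra.const[of 1]] resolvent_algebra.rsv_cnj[OF resolvent_algebra.const[of 1]]
  by simp_all

lemma real_polynomial_in_resolvent_algebra:
  fixes q :: "complex \<Rightarrow> real"
  assumes "real_polynomial_function q"
  shows "(\<lambda>s. complex_of_real (q (rsv z s))) \<in> resolvent_algebra z"
  using assms
proof (induction rule: real_polynomial_function.induct)
  case (linear q)
  \<comment> \<open>A real linear functional on the complex plane is
    \<open>w \<mapsto> a * w + b * cnj w\<close> with these coefficients.\<close>
  define a where "a = (complex_of_real (q 1) - \<i> * complex_of_real (q \<i>)) / 2"
  define b where "b = (complex_of_real (q 1) + \<i> * complex_of_real (q \<i>)) / 2"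
  have "complex_of_real (q (rsv z s)) = a * rsv z s + b * rsv (cnj z) s" for s
  proof -
    interpret bounded_linear q by (rule linear)
    have "rsv z s = Re (rsv z s) *\<^sub>R 1 + Im (rsv z s) *\<^sub>R \<i>"
      by (simp add: complex_eq_iff)
    then have "q (rsv z s) = Re (rsv z s) * q 1 + Im (rsv z s) * q \<i>"
      by (metis add scaleR real_scaleR_def)
    then show ?thesis
      unfolding cnj_rsv[symmetric] a_def b_def by (simp add: complex_eq_iff field_simps)
  qed
  then show ?case
    by (simp only:) (intro resolvent_algebra.add resolvent_algebra_scale resolvent_algebra_rsv)
qed (auto intro: resolvent_algebra.const resolvent_algebra.add resolvent_algebra_mult)

text \<open>The substitution \<open>w = 1 / (s - z)\<close> maps \<open>L\<close> and the point at infinity onto a compact set.\<close>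

theorem resolvent_algebra_dense:
  fixes f :: "real \<Rightarrow> complex"
  assumes L: "closed L" and z: "\<And>s. s \<in> L \<Longrightarrow> complex_of_real s \<noteq> z"
    and f: "continuous_on L f" and f0: "\<And>e. e > 0 \<Longrightarrow> \<exists>B. \<forall>s\<in>L. \<bar>s\<bar> > B \<longrightarrow> cmod (f s) < e" and e: "e > 0"
  shows "\<exists>p\<in>resolvent_algebra z. \<forall>s\<in>L. cmod (f s - p s) < e"
proof -
  define C where "C = {u. Im u = 0 \<and> Re u \<in> L}"
  have C: "complex_of_real ` L = C"
    unfolding C_def by (auto simp: image_iff complex_eq_iff)
  have "C = Im -` {0} \<inter> Re -` L" unfolding C_def by auto
  then have closedC: "closed C"
    using L by (auto intro!: closed_Int closed_vimage continuous_intros)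
  have "z \<notin> C" using z unfolding C[symmetric] by blast
  then obtain d where d: "d > 0" "\<And>u. u \<in> C \<Longrightarrow> d \<le> dist z u"
    using separate_point_closed[OF closedC] by blast
  \<comment> \<open>The point 0 stands for infinity, where \<open>F\<close> gets the value 0;
    elsewhere \<open>k \<mapsto> z + 1 / k\<close> inverts the substitution.\<close>
  define K where "K = insert 0 (rsv z ` L)"
  define F where "F k = (if k = 0 then 0 else f (Re (z + 1 / k)))" for k
  have nz: "rsv z s \<noteq> 0" "z + 1 / rsv z s = complex_of_real s" if "s \<in> L" for s
    using z[OF that] unfolding rsv_def by simp_all
  have K_mem: "k \<in> K \<longleftrightarrow> k = 0 \<or> z + 1 / k \<in> C" for k
  proof (cases "k = 0")
    case False
    have "z + 1 / k \<in> C \<Longrightarrow> k \<in> rsv z ` L"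
    proof -
      assume "z + 1 / k \<in> C"
      then obtain s where s: "s \<in> L" "z + 1 / k = complex_of_real s" unfolding C[symmetric] by blast
      then have "k = rsv z s" using False z[OF s(1)] unfolding rsv_def by (simp add: field_simps flip: s(2))
      then show ?thesis using s by blast
    qed
    then show ?thesis using False nz C unfolding K_def by auto
  qed (simp add: K_def)
  have "closed K"
  proof -
    have "open ({k. k \<noteq> 0} \<inter> (\<lambda>k. z + 1 / k) -` (- C))"
      using closedC by (intro continuous_open_preimage continuous_intros open_Collect_neq) auto
    moreover have "- K = {k. k \<noteq> 0} \<inter> (\<lambda>k. z + 1 / k) -` (- C)" using K_mem by auto
    ultimately show ?thesis by (simp add: closed_def)
  qed
  moreover have "bounded K"
    unfolding bounded_iff
  proof (intro exI ballI)
    fix k assume "k \<in> K"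
    then consider "k = 0" | s where "s \<in> L" "k = rsv z s" unfolding K_def by auto
    then show "norm k \<le> 1 / d"
    proof cases
      case (2 s)
      have "d \<le> cmod (complex_of_real s - z)"
        using d(2)[of "complex_of_real s"] 2 C by (auto simp: dist_norm norm_minus_commute)
      then show ?thesis using d(1) 2 by (simp add: rsv_def norm_divide frac_le)
    qed (use d in simp)
  qed
  ultimately have "compact K" by (simp add: compact_eq_bounded_closed)
  moreover have "continuous_on K F"
    unfolding continuous_on_eq_continuous_within
  proof
    fix k assume k: "k \<in> K"
    show "continuous (at k within K) F"
    proof (cases "k = 0")
      case True
      show ?thesis
        unfolding continuous_within_eps_delta
      proof (intro allI impI)
        fix e' :: real assume e': "e' > 0"
        obtain B where B: "\<And>s. s \<in> L \<Longrightarrow> \<bar>s\<bar> > B \<Longrightarrow> cmod (f s) < e'" using f0[OF e'] by blast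
        \<comment> \<open>\<open>cmod (rsv z s) < t\<close> means
          \<open>cmod (s - z) > \<bar>B\<bar> + cmod z + 1\<close>, which forces
          \<open>\<bar>s\<bar> > \<bar>B\<bar>\<close>.\<close>
        define t where "t = 1 / (\<bar>B\<bar> + cmod z + 1)"
        have t: "t > 0" unfolding t_def by (simp add: add_nonneg_pos)
        have "cmod (F k') < e'" if "k' \<in> K" "cmod k' < t" for k'
        proof (cases "k' = 0")
          case False
          then obtain s where s: "s \<in> L" "k' = rsv z s" using \<open>k' \<in> K\<close> unfolding K_def by auto
          have "cmod (complex_of_real s - z) > \<bar>B\<bar> + cmod z + 1"
          proof -
            have p: "cmod (complex_of_real s - z) > 0" using z[OF s(1)] by simp
            have q: "\<bar>B\<bar> + cmod z + 1 > 0" by (simp add: add_nonneg_pos)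
            have "1 / cmod (complex_of_real s - z) < 1 / (\<bar>B\<bar> + cmod z + 1)"
              using that(2) unfolding s(2) rsv_def t_def by (simp add: norm_divide)
            then show ?thesis using p q by (simp add: field_simps)
          qed
          moreover have "cmod (complex_of_real s - z) \<le> \<bar>s\<bar> + cmod z"
            using norm_triangle_ineq4[of "complex_of_real s" z] by simp
          ultimately have "\<bar>s\<bar> > B" by linarith
          moreover have "F k' = f s" unfolding F_def s(2) using nz[OF s(1)] by simp
          ultimately show ?thesis using B s by simp
        qed (simp add: F_def e')
        then show "\<exists>d>0. \<forall>x'\<in>K. dist x' k < d \<longrightarrow> dist (F x') (F k) < e'"
          using t True by (intro exI[of _ t]) (auto simp: F_def[of 0])
      qed
    next
      case False
      have img: "Re (z + 1 / k') \<in> L" if "k' \<in> K - {0}" for k'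
        using that K_mem[of k'] unfolding C_def by blast
      have "continuous_on (K - {0}) (\<lambda>k. f (Re (z + 1 / k)))"
        by (rule continuous_on_compose2[OF f]) (use img in \<open>auto intro!: continuous_intros\<close>)
      then have "continuous_on (K - {0}) F"
        by (rule continuous_on_cong[THEN iffD1, rotated 2]) (auto simp: F_def)
      then have "continuous (at k within K - {0}) F"
        using k False by (simp add: continuous_on_eq_continuous_within)
      moreover have "at k within K = at k within K - {0}"
        by (rule at_within_nhd[of k "- {0}"]) (use False in auto)
      ultimately show ?thesis by simp
    qed
  qed
  ultimately obtain g where g: "polynomial_function g" "\<And>k. k \<in> K \<Longrightarrow> norm (F k - g k) < e"
    using Stone_Weierstrass_polynomial_function[of K F e] e by blast
  have "real_polynomial_function (\<lambda>k. Re (g k))" "real_polynomial_function (\<lambda>k. Im (g k))"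
    using g(1) bounded_linear_Re bounded_linear_Im unfolding polynomial_function_def comp_def by blast+
  then have "(\<lambda>s. complex_of_real (Re (g (rsv z s))) + \<i> * complex_of_real (Im (g (rsv z s)))) \<in> resolvent_algebra z"
    by (intro resolvent_algebra.add resolvent_algebra_scale real_polynomial_in_resolvent_algebra)
  then have "(\<lambda>s. g (rsv z s)) \<in> resolvent_algebra z"
    by (simp only: complex_eq[symmetric])
  moreover have "cmod (f s - g (rsv z s)) < e" if "s \<in> L" for s
  proof -
    have "F (rsv z s) = f s" unfolding F_def using nz[OF that] by simp
    moreover have "rsv z s \<in> K" using that by (simp add: K_def)
    ultimately show ?thesis using g(2)[of "rsv z s"] by simp
  qed
  ultimately show ?thesis by (intro bexI[of _ "\<lambda>s. g (rsv z s)"] ballI)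
qed

text \<open>Four enlargements of the class: uniform approximation gives continuous functions
  vanishing outside an interval, trapezoids give indicators of open intervals, Dynkin's theorem
  gives indicators of Borel sets, and simple functions give the rest.\<close>

lemma generating_resolvent_algebra:
  assumes z: "Im z \<noteq> 0"
  shows "generating (resolvent_algebra z)"
  unfolding generating_def
proof (intro allI impI)
  fix P :: "(real \<Rightarrow> complex) \<Rightarrow> bool" and f :: "real \<Rightarrow> complex"
  assume gen: "\<forall>f\<in>resolvent_algebra z. P f"
    and add: "\<forall>f g. P f \<longrightarrow> P g \<longrightarrow> P (\<lambda>s. f s + g s)"
    and scale: "\<forall>c f. P f \<longrightarrow> P (\<lambda>s. c * f s)"
    and lim: "\<forall>F f C. (\<forall>n::nat. P (F n)) \<longrightarrow> (\<forall>n s. cmod (F n s) \<le> C) \<longrightarrow> (\<forall>s. (\<lambda>n. F n s) \<longlonglongrightarrow> f s) \<longrightarrow> P f"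
    and f: "bounded_borel f"
  have const: "P (\<lambda>s. c)" for c using gen resolvent_algebra.const by blast
  have vanishing: "P g" if g: "continuous_on UNIV g" "\<And>s. cmod (g s) \<le> 1" "\<And>s. s \<notin> {a<..<b} \<Longrightarrow> g s = 0" for g a b
  proof -
    have "\<exists>p\<in>resolvent_algebra z. \<forall>s\<in>UNIV. cmod (g s - p s) < 1 / real (Suc n)" for n
    proof (rule resolvent_algebra_dense)
      show "complex_of_real s \<noteq> z" for s using of_real_minus_nonreal[OF z, of s] by auto
      show "\<exists>B. \<forall>s\<in>UNIV. \<bar>s\<bar> > B \<longrightarrow> cmod (g s) < e" if "e > 0" for e
      proof (intro exI[of _ "max \<bar>a\<bar> \<bar>b\<bar>"] ballI impI)
        fix s assume "max \<bar>a\<bar> \<bar>b\<bar> < \<bar>s\<bar>"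
        then have "s \<notin> {a<..<b}" by auto
        then show "cmod (g s) < e" using g(3) that by simp
      qed
    qed (use g in auto)
    then obtain p where p: "\<And>n. p n \<in> resolvent_algebra z" "\<And>n s. cmod (g s - p n s) < 1 / real (Suc n)"
      by (metis UNIV_I)
    have "cmod (p n s) \<le> 2" for n s
    proof -
      have "cmod (p n s) \<le> cmod (g s) + cmod (g s - p n s)"
        using norm_triangle_sub[of "p n s" "g s"] by (simp add: norm_minus_commute)
      moreover have "1 / real (Suc n) \<le> 1" by simp
      ultimately show ?thesis using g(2)[of s] p(2)[of s n] by linarith
    qed
    moreover have "(\<lambda>n. p n s) \<longlonglongrightarrow> g s" for s
    proof -
      have "(\<lambda>n. g s - p n s) \<longlonglongrightarrow> 0"
      proof (rule Lim_null_comparison)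
        show "\<forall>\<^sub>F n in sequentially. norm (g s - p n s) \<le> 1 / real (Suc n)"
          using p(2) by (simp add: less_imp_le)
        show "(\<lambda>n. 1 / real (Suc n)) \<longlonglongrightarrow> 0"
          using lim_inverse_n' LIMSEQ_Suc by blast
      qed
      from tendsto_diff[OF tendsto_const[of "g s"] this] show ?thesis by simp
    qed
    ultimately show ?thesis using lim[rule_format, of p 2 g] gen p(1) by blast
  qed
  have interval: "P (indicator {a<..<b})" for a b :: real
  proof -
    \<comment> \<open>Trapezoids of slope \<open>n\<close> that vanish outside
      \<open>{a<..<b}\<close> and increase to its indicator.\<close>
    define h where "h n s = min 1 (real n * max 0 (min (s - a) (b - s)))" for n :: nat and s
    have h: "0 \<le> h n s" "h n s \<le> 1" for n s unfolding h_def by auto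
    have "P (\<lambda>s. complex_of_real (h n s))" for n
    proof (rule vanishing[of _ a b])
      show "continuous_on UNIV (\<lambda>s. complex_of_real (h n s))"
        unfolding h_def by (intro continuous_intros)
      show "cmod (complex_of_real (h n s)) \<le> 1" for s using h[of n s] by simp
      show "complex_of_real (h n s) = 0" if "s \<notin> {a<..<b}" for s
      proof -
        have "max 0 (min (s - a) (b - s)) = 0" using that by auto
        then show ?thesis by (simp add: h_def)
      qed
    qed
    moreover have "(\<lambda>n. complex_of_real (h n s)) \<longlonglongrightarrow> indicator {a<..<b} s" for s
    proof (cases "s \<in> {a<..<b}")
      case True
      define m where "m = min (s - a) (b - s)"
      have m: "m > 0" using True unfolding m_def by auto
      obtain N :: nat where N: "1 / m < real N" using reals_Archimedean2 by blast
      have "h n s = 1" if "n \<ge> N" for n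
      proof -
        have "1 < real N * m" using N m by (simp add: field_simps)
        also have "\<dots> \<le> real n * m" using that m by (intro mult_right_mono) auto
        finally show ?thesis using m unfolding h_def m_def[symmetric] by simp
      qed
      then have "\<forall>\<^sub>F n in sequentially. complex_of_real (h n s) = 1"
        unfolding eventually_sequentially by (metis of_real_1)
      then show ?thesis using True by (simp add: tendsto_eventually)
    next
      case False
      then have "max 0 (min (s - a) (b - s)) = 0" by auto
      then show ?thesis using False by (simp add: h_def)
    qed
    moreover have "cmod (complex_of_real (h n s)) \<le> 1" for n s using h[of n s] by simp
    ultimately show ?thesis
      using lim[rule_format, of "\<lambda>n s. complex_of_real (h n s)" 1 "indicator {a<..<b}"] by blast
  qed
  have indicators: "P (indicator B)" if "B \<in> sets borel" for B :: "real set"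
  proof -
    let ?G = "range (\<lambda>(a, b). {a<..<b::real})"
    have "Int_stable ?G"
    proof (rule Int_stableI)
      fix S T assume "S \<in> ?G" "T \<in> ?G"
      then obtain a b c d where "S = {a<..<b}" "T = {c<..<d}" by auto
      then have "S \<inter> T = (\<lambda>(a, b). {a<..<b}) (max a c, min b d)" by auto
      then show "S \<inter> T \<in> ?G" by blast
    qed
    moreover have "?G \<subseteq> Pow UNIV" by simp
    moreover have "B \<in> sigma_sets UNIV ?G"
    proof -
      have "sets (borel :: real measure) = sigma_sets UNIV (range (\<lambda>(a, b). box a b))"
        unfolding borel_eq_box by (rule sets_measure_of) simp
      then show ?thesis using that by (simp add: box_real)
    qed
    ultimately show ?thesis
    proof (induction rule: sigma_sets_induct_disjoint)
      case (basic S)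
      then show ?case using interval by auto
    next
      case empty
      have "(indicator {} :: real \<Rightarrow> complex) = (\<lambda>s. 0)" by (rule ext) simp
      from subst[of _ _ P, OF this[symmetric] const] show ?case .
    next
      case (compl S)
      have "(\<lambda>s. 1 + (- 1) * indicator S s) = (indicator (UNIV - S) :: real \<Rightarrow> complex)"
        by (rule ext) (simp add: indicator_def)
      from subst[of _ _ P, OF this add[rule_format, OF const scale[rule_format, OF compl(2)]]] show ?case .
    next
      case (union S)
      have S: "P (indicator (\<Union>n<N. S n))" for N :: nat
      proof (induction N)
        case 0
        have "(indicator (\<Union>n<0. S n) :: real \<Rightarrow> complex) = (\<lambda>s. 0)" by (rule ext) simp
        from subst[of _ _ P, OF this[symmetric] const] show ?case .
      next
        case (Suc N)
        have "S N \<inter> S n = {}" if "n < N" for n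
          using that by (intro disjoint_family_onD[OF union(1)]) auto
        then have "(\<lambda>s. indicator (\<Union>n<N. S n) s + indicator (S N) s) = (indicator (\<Union>n<Suc N. S n) :: real \<Rightarrow> complex)"
          by (intro ext) (auto simp: indicator_def lessThan_Suc)
        from subst[of _ _ P, OF this add[rule_format, OF Suc union(3)]] show ?case .
      qed
      have "cmod (indicator (\<Union>n<N. S n) s) \<le> 1" for N s by (simp add: indicator_def)
      then show ?case
        using lim[rule_format, of "\<lambda>N. indicator (\<Union>n<N. S n)" 1 "indicator (\<Union>n. S n)"] S LIMSEQ_indicator_UN[of S]
        by blast
    qed
  qed
  show "P f"
    using generating_indicators f
  proof (induction rule: generating_induct)
    case (limit F f C)
    then show ?case using lim by blast
  qed (use indicators add scale in auto)
qed

section \<open>The spectral theorem\<close>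

lemma cis_has_bochner_integral:
  "has_bochner_integral lborel (\<lambda>\<theta>. indicator {- pi..pi} \<theta> *\<^sub>R cis (of_int n * \<theta>))
     (if n = 0 then complex_of_real (2 * pi) else 0)"
proof (cases "n = 0")
  case True
  have "has_bochner_integral lborel (\<lambda>\<theta>. indicator {- pi..pi} \<theta> *\<^sub>R (1 :: complex))
      (complex_of_real pi - complex_of_real (- pi))"
    by (rule has_bochner_integral_FTC_Icc)
      (auto intro!: derivative_eq_intros has_vector_derivative_of_real)
  then show ?thesis using True by simp
next
  case False
  define F where "F \<theta> = exp (\<i> * of_int n * complex_of_real \<theta>) / (\<i> * of_int n)" for \<theta> :: real
  have e: "cis (of_int n * \<theta>) = exp (\<i> * of_int n * complex_of_real \<theta>)" for \<theta> :: real
    by (simp add: cis_conv_exp mult.assoc)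
  have "has_bochner_integral lborel (\<lambda>\<theta>. indicator {- pi..pi} \<theta> *\<^sub>R cis (of_int n * \<theta>)) (F pi - F (- pi))"
  proof (rule has_bochner_integral_FTC_Icc)
    fix \<theta> :: real
    have "((\<lambda>w. exp (\<i> * of_int n * w) / (\<i> * of_int n)) has_field_derivative exp (\<i> * of_int n * complex_of_real \<theta>))
        (at (complex_of_real \<theta>))"
      using False by (auto intro!: derivative_eq_intros)
    then show "(F has_vector_derivative cis (of_int n * \<theta>)) (at \<theta> within {- pi..pi})"
      unfolding F_def e by (rule has_vector_derivative_real_field)
  qed (auto intro!: continuous_intros)
  moreover have "F pi = F (- pi)"
  proof -
    have "cis (of_int n * pi) = cis (of_int n * (- pi))"
      using sin_npi_int[of n] by (simp add: complex_eq_iff mult.commute)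
    then show ?thesis unfolding F_def e[symmetric] by simp
  qed
  ultimately show ?thesis using False by simp
qed

section \<open>Measures from the moments of the Cayley transform\<close>

context self_adjoint_operator
begin

text \<open>The Fejer means of the Fourier coefficients \<open>\<langle>x, U\<^sup>m x\<rangle>\<close> are positive densities; a weak limit has
  exactly these coefficients.\<close>

lemma circle_moments_unit:
  assumes x: "x \<in> V" and unit: "nm x = 1"
  shows "\<exists>M. real_distribution M \<and> (\<forall>m::nat. (LINT \<theta>|M. cis (real m * \<theta>)) = ip x ((U ^^ m) x))"
proof -
  \<comment> \<open>Divided by \<open>2 * pi * N\<close>, the squared norm of this trigonometric
    polynomial is the Fejer mean of order \<open>N\<close>, which is thereby seen to be
    nonnegative.\<close>
  define g where "g N \<theta> = (\<Sum>k<N. sc (cis (- (real k * \<theta>))) ((U ^^ k) x))" for N :: nat and \<theta> :: real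
  have g_in: "g N \<theta> \<in> V" for N \<theta> unfolding g_def using x by simp
  have g_sq: "complex_of_real ((nm (g N \<theta>))\<^sup>2) * cis (real m * \<theta>) =
      (\<Sum>j<N. \<Sum>k<N. cis (of_int (int j - int k + int m) * \<theta>) * ip ((U ^^ j) x) ((U ^^ k) x))" for N m \<theta>
  proof -
    have "complex_of_real ((nm (g N \<theta>))\<^sup>2) = ip (g N \<theta>) (g N \<theta>)"
      using inner_self[OF g_in] by simp
    also have "\<dots> = (\<Sum>j<N. \<Sum>k<N. cnj (cis (- (real j * \<theta>))) * (cis (- (real k * \<theta>)) * ip ((U ^^ j) x) ((U ^^ k) x)))"
      unfolding g_def using x by (subst inner_sum_sum) (auto simp: inner_simps mult.left_commute)
    finally have "complex_of_real ((nm (g N \<theta>))\<^sup>2) * cis (real m * \<theta>) =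
        (\<Sum>j<N. \<Sum>k<N. cnj (cis (- (real j * \<theta>))) * (cis (- (real k * \<theta>)) * ip ((U ^^ j) x) ((U ^^ k) x)) * cis (real m * \<theta>))"
      by (simp add: sum_distrib_right)
    also have "\<dots> = (\<Sum>j<N. \<Sum>k<N. cis (of_int (int j - int k + int m) * \<theta>) * ip ((U ^^ j) x) ((U ^^ k) x))"
    proof (intro sum.cong refl)
      fix j k
      have e: "cnj (cis (- (real j * \<theta>))) * cis (- (real k * \<theta>)) * cis (real m * \<theta>) = cis (of_int (int j - int k + int m) * \<theta>)"
        by (simp add: cis_cnj cis_mult algebra_simps)
      show "cnj (cis (- (real j * \<theta>))) * (cis (- (real k * \<theta>)) * ip ((U ^^ j) x) ((U ^^ k) x)) * cis (real m * \<theta>) =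
          cis (of_int (int j - int k + int m) * \<theta>) * ip ((U ^^ j) x) ((U ^^ k) x)"
        unfolding e[symmetric] by (simp only: mult_ac)
    qed
    finally show ?thesis .
  qed
  have bochner: "has_bochner_integral lborel
      (\<lambda>\<theta>. indicator {- pi..pi} \<theta> *\<^sub>R (complex_of_real ((nm (g N \<theta>))\<^sup>2) * cis (real m * \<theta>)))
      (2 * pi * real (N - m) * ip x ((U ^^ m) x))" for N m
  proof -
    have "has_bochner_integral lborel
        (\<lambda>\<theta>. \<Sum>j<N. \<Sum>k<N. (indicator {- pi..pi} \<theta> *\<^sub>R cis (of_int (int j - int k + int m) * \<theta>)) * ip ((U ^^ j) x) ((U ^^ k) x))
        (\<Sum>j<N. \<Sum>k<N. (if int j - int k + int m = 0 then complex_of_real (2 * pi) else 0) * ip ((U ^^ j) x) ((U ^^ k) x))"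
      by (intro has_bochner_integral_sum has_bochner_integral_mult_left cis_has_bochner_integral)
    also have "(\<Sum>j<N. \<Sum>k<N. (if int j - int k + int m = 0 then complex_of_real (2 * pi) else 0) * ip ((U ^^ j) x) ((U ^^ k) x)) =
        (\<Sum>j<N. \<Sum>k<N. if k = j + m then 2 * pi * ip x ((U ^^ m) x) else 0)"
    proof (intro sum.cong refl)
      fix j k :: nat
      have "int j - int k + int m = 0 \<longleftrightarrow> k = j + m" by linarith
      moreover have "ip ((U ^^ j) x) ((U ^^ (j + m)) x) = ip x ((U ^^ m) x)"
        using inner_U_pow[of x "(U ^^ m) x" j] x by (simp add: funpow_add)
      ultimately show "(if int j - int k + int m = 0 then complex_of_real (2 * pi) else 0) * ip ((U ^^ j) x) ((U ^^ k) x) =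
          (if k = j + m then 2 * pi * ip x ((U ^^ m) x) else 0)" by auto
    qed
    also have "\<dots> = (\<Sum>j<N. if j + m < N then 2 * pi * ip x ((U ^^ m) x) else 0)"
      by simp
    also have "\<dots> = (\<Sum>j\<in>{..<N - m}. 2 * pi * ip x ((U ^^ m) x))"
      by (rule sum.mono_neutral_cong_right) auto
    also have "\<dots> = 2 * pi * real (N - m) * ip x ((U ^^ m) x)" by simp
    finally show ?thesis
      unfolding g_sq by (simp add: scaleR_sum_right)
  qed
  define dens where "dens N \<theta> = indicator {- pi..pi} \<theta> * (nm (g N \<theta>))\<^sup>2 / (2 * pi * real N)" for N \<theta>
  have dens_nonneg: "0 \<le> dens N \<theta>" for N \<theta> unfolding dens_def by simp
  \<comment> \<open>Truncated subtraction is intended: for \<open>m \<ge> N\<close> no two indices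
    below \<open>N\<close> differ by \<open>m\<close>, and the coefficient is 0.\<close>
  have dens_bochner: "has_bochner_integral lborel (\<lambda>\<theta>. dens N \<theta> *\<^sub>R cis (real m * \<theta>))
      (real (N - m) / real N * ip x ((U ^^ m) x))" if "N > 0" for N m
  proof -
    have "has_bochner_integral lborel
       (\<lambda>\<theta>. (1 / (2 * pi * real N)) *\<^sub>R (indicator {- pi..pi} \<theta> *\<^sub>R (complex_of_real ((nm (g N \<theta>))\<^sup>2) * cis (real m * \<theta>))))
      ((1 / (2 * pi * real N)) *\<^sub>R (2 * pi * real (N - m) * ip x ((U ^^ m) x)))"
      by (intro has_bochner_integral_scaleR_right bochner)
    then show ?thesis
      unfolding dens_def using that by (simp add: scaleR_conv_of_real mult.assoc)
  qed
  have dens_int: "has_bochner_integral lborel (dens N) 1" if "N > 0" for N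
  proof -
    have "has_bochner_integral lborel (\<lambda>\<theta>. Re (dens N \<theta> *\<^sub>R cis (real 0 * \<theta>))) (Re (real (N - 0) / real N * ip x ((U ^^ 0) x)))"
      by (intro has_bochner_integral_Re dens_bochner that)
    then show ?thesis using that x unit by (simp add: inner_self)
  qed
  have dens_meas [measurable]: "dens (Suc n) \<in> borel_measurable lborel" for n
    using dens_int[of "Suc n"] borel_measurable_integrable[of lborel "dens (Suc n)"]
    by (simp add: has_bochner_integral_iff)
  \<comment> \<open>\<open>Suc n\<close> avoids the division by 0 in \<open>dens 0\<close>.\<close>
  define M where "M n = density lborel (\<lambda>\<theta>. ennreal (dens (Suc n) \<theta>))" for n
  have M_moment: "(LINT \<theta>|M n. cis (real m * \<theta>)) = real (Suc n - m) / real (Suc n) * ip x ((U ^^ m) x)" for n m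
  proof -
    have "(\<lambda>\<theta>. cis (real m * \<theta>)) \<in> borel_measurable borel"
      by (intro borel_measurable_continuous_onI continuous_intros)
    then have "(LINT \<theta>|M n. cis (real m * \<theta>)) = (LINT \<theta>|lborel. dens (Suc n) \<theta> *\<^sub>R cis (real m * \<theta>))"
      unfolding M_def using dens_nonneg by (intro integral_density) auto
    then show ?thesis
      using has_bochner_integral_integral_eq[OF dens_bochner[of "Suc n" m]] by simp
  qed
  have mass: "emeasure (M n) S = 1" if "{- pi..pi} \<subseteq> S" "S \<in> sets borel" for n S
  proof -
    have "emeasure (M n) S = (\<integral>\<^sup>+\<theta>. ennreal (dens (Suc n) \<theta>) * indicator S \<theta> \<partial>lborel)"
      unfolding M_def using that by (intro emeasure_density) auto
    also have "\<dots> = (\<integral>\<^sup>+\<theta>. ennreal (dens (Suc n) \<theta>) \<partial>lborel)"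
      using that by (intro nn_integral_cong) (auto simp: dens_def indicator_def)
    also have "\<dots> = ennreal (LINT \<theta>|lborel. dens (Suc n) \<theta>)"
      using dens_int[of "Suc n"] dens_nonneg by (intro nn_integral_eq_integral) (auto simp: has_bochner_integral_iff)
    also have "\<dots> = 1" using has_bochner_integral_integral_eq[OF dens_int[of "Suc n"]] by simp
    finally show ?thesis .
  qed
  have rd: "real_distribution (M n)" for n
  proof -
    have "sets (M n) = sets borel" by (simp add: M_def)
    moreover from this have "prob_space (M n)"
      using mass[of UNIV n] sets_eq_imp_space_eq[of "M n" borel] by (intro prob_spaceI) simp
    ultimately show ?thesis unfolding real_distribution_def real_distribution_axioms_def by simp
  qed
  \<comment> \<open>All \<open>M n\<close> live on \<open>{- pi..pi}\<close>, so
    \<open>{- 4<..4}\<close> carries their whole mass.\<close>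
  have "tight M"
    unfolding tight_def
  proof (intro conjI allI impI)
    fix e :: real assume "e > 0"
    have "{- pi..pi} \<subseteq> {- 4<..4}" using pi_less_4 by auto
    then have "measure (M n) {- 4<..4} = 1" for n
      using mass[of "{- 4<..4}" n] by (simp add: measure_def)
    then show "\<exists>a b. a < b \<and> (\<forall>n. measure (M n) {a<..b} > 1 - e)"
      using \<open>e > 0\<close> by (intro exI[of _ "- 4"] exI[of _ 4]) auto
  qed (rule rd)
  from tight_imp_convergent_subsubsequence[OF this strict_mono_id]
  obtain r M' where r: "strict_mono r" and M': "real_distribution M'" and conv: "weak_conv_m (M \<circ> r) M'"
    by (auto simp: comp_def)
  have "(LINT \<theta>|M'. cis (real m * \<theta>)) = ip x ((U ^^ m) x)" for m
  proof (rule LIMSEQ_unique)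
    have "continuous_on UNIV (\<lambda>\<theta>. cis (real m * \<theta>))" by (intro continuous_intros)
    then have cont: "isCont (\<lambda>\<theta>. cis (real m * \<theta>)) \<theta>" for \<theta>
      by (simp add: continuous_on_eq_continuous_at)
    show "(\<lambda>n. LINT \<theta>|(M \<circ> r) n. cis (real m * \<theta>)) \<longlonglongrightarrow> (LINT \<theta>|M'. cis (real m * \<theta>))"
      by (rule weak_conv_imp_integral_bdd_continuous_conv[OF _ M' conv cont, of 1])
        (use rd in auto)
    have "(\<lambda>n. real (Suc n - m) / real (Suc n)) \<longlonglongrightarrow> 1"
    proof (rule Lim_transform_eventually)
      show "\<forall>\<^sub>F n in sequentially. 1 - real m / real (Suc n) = real (Suc n - m) / real (Suc n)"
        using eventually_ge_at_top[of m] by eventually_elim (simp add: of_nat_diff field_simps)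
      have "(\<lambda>n. 1 - real m * inverse (real (Suc n))) \<longlonglongrightarrow> 1 - real m * 0"
        by (intro tendsto_intros LIMSEQ_inverse_real_of_nat)
      then show "(\<lambda>n. 1 - real m / real (Suc n)) \<longlonglongrightarrow> 1" by (simp add: divide_inverse)
    qed
    then have "(\<lambda>n. complex_of_real (real (Suc (r n) - m) / real (Suc (r n))) * ip x ((U ^^ m) x)) \<longlonglongrightarrow>
        complex_of_real 1 * ip x ((U ^^ m) x)"
      by (intro tendsto_intros tendsto_of_real LIMSEQ_subseq_LIMSEQ[OF _ r, unfolded comp_def])
    then show "(\<lambda>n. LINT \<theta>|(M \<circ> r) n. cis (real m * \<theta>)) \<longlonglongrightarrow> ip x ((U ^^ m) x)"
      by (simp add: M_moment)
  qed
  then show ?thesis using M' by blast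
qed

text \<open>Scaling reduces to unit vectors. Moments with \<open>j \<le> k\<close> reduce to one
  power because \<open>U\<close> preserves inner products; the others follow by conjugation.\<close>

lemma circle_moments:
  assumes x: "x \<in> V"
  obtains M where "finite_measure M" "sets M = sets borel" "emeasure M UNIV = ennreal ((nm x)\<^sup>2)"
    "\<And>j k. (LINT \<theta>|M. cnj (cis \<theta>) ^ j * cis \<theta> ^ k) = ip ((U ^^ j) x) ((U ^^ k) x)"
proof -
  have "\<exists>M. prob_space M \<and> sets M = sets (borel :: real measure) \<and>
      (\<forall>m::nat. complex_of_real ((nm x)\<^sup>2) * (LINT \<theta>|M. cis (real m * \<theta>)) = ip x ((U ^^ m) x))"
  proof (cases "x = 0")
    case True
    \<comment> \<open>The zero vector cannot be normalized, but any probability measure serves, as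
      it is scaled by 0.\<close>
    have "prob_space (return borel (0::real))" by (rule prob_space_return) simp
    then show ?thesis using True x by (intro exI[of _ "return borel 0"]) auto
  next
    case False
    then have p: "nm x > 0" using x hnorm_nonneg[OF x] by (simp add: hnorm_eq_zero less_le)
    define u where "u = sc (complex_of_real (1 / nm x)) x"
    have u: "u \<in> V" "nm u = 1" using p x by (simp_all add: u_def hnorm_scale norm_divide)
    obtain M where M: "real_distribution M" "\<And>m::nat. (LINT \<theta>|M. cis (real m * \<theta>)) = ip u ((U ^^ m) u)"
      using circle_moments_unit[OF u] by blast
    have "complex_of_real ((nm x)\<^sup>2) * ip u ((U ^^ m) u) = ip x ((U ^^ m) x)" for m
      using p x unfolding u_def
      by (simp add: bounded_operatorD(3)[OF U_pow_bop] inner_simps power2_eq_square)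
    then show ?thesis
      using M by (intro exI[of _ M]) (auto simp: real_distribution_def real_distribution_axioms_def)
  qed
  then obtain M1 where M1: "prob_space M1" "sets M1 = sets borel"
    "\<And>m::nat. complex_of_real ((nm x)\<^sup>2) * (LINT \<theta>|M1. cis (real m * \<theta>)) = ip x ((U ^^ m) x)" by blast
  interpret M1: prob_space M1 by (rule M1)
  have bm: "borel_measurable M1 = (borel_measurable borel :: (real \<Rightarrow> complex) set)"
    by (rule measurable_cong_sets) (simp_all add: M1)
  define M where "M = density M1 (\<lambda>_. ennreal ((nm x)\<^sup>2))"
  have sM: "sets M = sets borel" unfolding M_def using M1 by simp
  have spM1: "space M1 = UNIV" using sets_eq_imp_space_eq[OF M1(2)] by simp
  have eM: "emeasure M UNIV = ennreal ((nm x)\<^sup>2)"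
    unfolding M_def using M1.emeasure_space_1 spM1 M1(2) by (subst emeasure_density) auto
  have moment: "(LINT \<theta>|M. cis (real m * \<theta>)) = ip x ((U ^^ m) x)" for m
  proof -
    have "(\<lambda>\<theta>. cis (real m * \<theta>)) \<in> borel_measurable M1"
      unfolding bm by (intro borel_measurable_continuous_onI continuous_intros)
    then have "(LINT \<theta>|M. cis (real m * \<theta>)) = (LINT \<theta>|M1. (nm x)\<^sup>2 *\<^sub>R cis (real m * \<theta>))"
      unfolding M_def by (intro integral_density) auto
    then show ?thesis using M1(3)[of m] by (simp add: scaleR_conv_of_real)
  qed
  have fin: "finite_measure M"
    using eM sets_eq_imp_space_eq[OF sM] by (intro finite_measureI) simp
  have le: "(LINT \<theta>|M. cnj (cis \<theta>) ^ j * cis \<theta> ^ k) = ip ((U ^^ j) x) ((U ^^ k) x)" if "j \<le> k" for j k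
  proof -
    have "cnj (cis \<theta>) ^ j * cis \<theta> ^ k = cis (real (k - j) * \<theta>)" for \<theta>
    proof -
      have "cis \<theta> ^ k = cis \<theta> ^ j * cis \<theta> ^ (k - j)"
        using that by (simp flip: power_add)
      then have "cnj (cis \<theta>) ^ j * cis \<theta> ^ k = (cnj (cis \<theta>) * cis \<theta>) ^ j * cis \<theta> ^ (k - j)"
        by (simp only: power_mult_distrib mult.assoc)
      then show ?thesis using Complex.DeMoivre[of \<theta> "k - j"] by (simp add: cnj_mult_self)
    qed
    moreover have "ip ((U ^^ j) x) ((U ^^ k) x) = ip x ((U ^^ (k - j)) x)"
      using inner_U_pow[of x "(U ^^ (k - j)) x" j] x that by (simp flip: funpow_add[unfolded comp_def, THEN fun_cong])
    ultimately show ?thesis by (simp add: moment)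
  qed
  have "(LINT \<theta>|M. cnj (cis \<theta>) ^ j * cis \<theta> ^ k) = ip ((U ^^ j) x) ((U ^^ k) x)" for j k
  proof (cases "j \<le> k")
    case False
    have "(LINT \<theta>|M. cnj (cis \<theta>) ^ j * cis \<theta> ^ k) = (LINT \<theta>|M. cnj (cnj (cis \<theta>) ^ k * cis \<theta> ^ j))"
      by (simp add: mult.commute)
    also have "\<dots> = cnj (LINT \<theta>|M. cnj (cis \<theta>) ^ k * cis \<theta> ^ j)" by (rule Bochner_Integration.integral_cnj)
    also have "\<dots> = ip ((U ^^ j) x) ((U ^^ k) x)"
      using le[of k j] False inner_commute[of "(U ^^ j) x" "(U ^^ k) x"] x by simp
    finally show ?thesis .
  qed (rule le)
  with fin sM eM show ?thesis using that by blast
qed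

text \<open>The point 1 is the image of infinity under the Cayley map, so an atom there would have
  no place on the line. Where \<open>cis \<theta> = 1\<close>, a sum of \<open>N\<close> powers
  equals \<open>N\<close>; hence the atom is at most the squared norm of the ergodic average of
  \<open>x\<close>, which tends to 0.\<close>

lemma no_atom_at_one:
  assumes x: "x \<in> V" and M: "finite_measure M" "sets M = sets borel"
    and moments: "\<And>j k. (LINT \<theta>|M. cnj (cis \<theta>) ^ j * cis \<theta> ^ k) = ip ((U ^^ j) x) ((U ^^ k) x)"
  shows "AE \<theta> in M. cis \<theta> \<noteq> 1"
proof -
  interpret finite_measure M by (rule M)
  have sp: "space M = UNIV" using sets_eq_imp_space_eq[OF M(2)] by simp
  have bm: "borel_measurable M = (borel_measurable borel :: (real \<Rightarrow> complex) set)"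
    by (rule measurable_cong_sets) (simp_all add: M)
  define Z where "Z = {\<theta>. cis \<theta> = 1}"
  have "closed Z" unfolding Z_def by (intro closed_Collect_eq continuous_intros)
  then have Z: "Z \<in> sets M" using M(2) by simp
  have int: "integrable M (\<lambda>\<theta>. cnj (cis \<theta>) ^ j * cis \<theta> ^ k)" for j k
    by (rule integrable_const_bound[of _ 1])
      (auto simp: norm_mult norm_power bm intro!: borel_measurable_continuous_onI continuous_intros)
  have bound: "measure M Z \<le> (nm (\<Sum>k<N. (U ^^ k) x) / real N)\<^sup>2" if N: "N > 0" for N
  proof -
    define S where "S \<theta> = (\<Sum>k<N. cis \<theta> ^ k)" for \<theta> :: real
    have S: "complex_of_real ((cmod (S \<theta>))\<^sup>2) = (\<Sum>j<N. \<Sum>k<N. cnj (cis \<theta>) ^ j * cis \<theta> ^ k)" for \<theta>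
      unfolding cnj_mult_self[symmetric] S_def by (simp add: sum_product)
    have "(LINT \<theta>|M. complex_of_real ((cmod (S \<theta>))\<^sup>2)) = (\<Sum>j<N. \<Sum>k<N. ip ((U ^^ j) x) ((U ^^ k) x))"
      unfolding S using int by (simp add: moments)
    also have "\<dots> = complex_of_real ((nm (\<Sum>k<N. (U ^^ k) x))\<^sup>2)"
      using x by (subst inner_self[symmetric]) (simp_all add: inner_sum_sum)
    finally have S_int: "(LINT \<theta>|M. (cmod (S \<theta>))\<^sup>2) = (nm (\<Sum>k<N. (U ^^ k) x))\<^sup>2"
      unfolding integral_complex_of_real of_real_eq_iff .
    have "integrable M (\<lambda>\<theta>. \<Sum>j<N. \<Sum>k<N. cnj (cis \<theta>) ^ j * cis \<theta> ^ k)"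
      using int by simp
    then have iS: "integrable M (\<lambda>\<theta>. (cmod (S \<theta>))\<^sup>2)"
      unfolding S[symmetric] by (simp only: complex_of_real_integrable_eq)
    have "(real N)\<^sup>2 * measure M Z = (LINT \<theta>|M. (real N)\<^sup>2 * indicator Z \<theta>)"
      using sp by simp
    also have "\<dots> \<le> (LINT \<theta>|M. (cmod (S \<theta>))\<^sup>2)"
    proof (rule integral_mono[OF _ iS])
      show "integrable M (\<lambda>\<theta>. (real N)\<^sup>2 * indicator Z \<theta>)"
        using Z by (intro integrable_mult_right integrable_real_indicator) (auto simp: emeasure_finite less_top[symmetric])
      show "(real N)\<^sup>2 * indicator Z \<theta> \<le> (cmod (S \<theta>))\<^sup>2" for \<theta>
        unfolding S_def Z_def by (auto simp: indicator_def)
    qed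
    finally show ?thesis using N S_int by (simp add: power_divide field_simps)
  qed
  have lim: "(\<lambda>N. (nm (\<Sum>k<N. (U ^^ k) x) / real N)\<^sup>2) \<longlonglongrightarrow> 0\<^sup>2"
    by (intro tendsto_intros U_average_tendsto x)
  have "measure M Z \<le> 0\<^sup>2"
    using bound by (intro LIMSEQ_le_const[OF lim] exI[of _ 1]) auto
  then have "measure M Z = 0" by (simp add: measure_le_0_iff)
  then have "Z \<in> null_sets M" using Z by (simp add: null_sets_def emeasure_eq_measure)
  then show ?thesis by (rule AE_I') (auto simp: Z_def)
qed

text \<open>The scalar Cayley map \<open>(s + \<i>) / (s - \<i>)\<close>, in the form that mirrors
  \<open>U\<close>.\<close>

definition cayley :: "real \<Rightarrow> complex" where
  "cayley s = 1 + 2 * \<i> * rsv \<i> s"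

lemma bounded_borel_cayley: "bounded_borel cayley"
  unfolding cayley_def
  by (intro bounded_borel_add bounded_borel_mult bounded_borel_const bounded_borel_rsv) simp

lemma line_moments:
  assumes x: "x \<in> V"
  shows "\<exists>M. sets M = sets borel \<and> emeasure M UNIV = ennreal ((nm x)\<^sup>2) \<and>
    (\<forall>j k. (LINT s|M. cnj (cayley s) ^ j * cayley s ^ k) = ip ((U ^^ j) x) ((U ^^ k) x))"
proof -
  obtain M where M: "finite_measure M" "sets M = sets borel" "emeasure M UNIV = ennreal ((nm x)\<^sup>2)"
    "\<And>j k. (LINT \<theta>|M. cnj (cis \<theta>) ^ j * cis \<theta> ^ k) = ip ((U ^^ j) x) ((U ^^ k) x)"
    by (rule circle_moments[OF x], rule that)
  have AE: "AE \<theta> in M. cis \<theta> \<noteq> 1" by (rule no_atom_at_one[OF x M(1,2,4)])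
  \<comment> \<open>The inverse Cayley map; it is real on the circle, so \<open>Re\<close> only
    changes the type. At \<open>cis \<theta> = 1\<close> it has the default value 0, but only on a
    null set.\<close>
  define h where "h \<theta> = Re (\<i> * (cis \<theta> + 1) / (cis \<theta> - 1))" for \<theta>
  have bm: "borel_measurable M = (borel_measurable borel :: (real \<Rightarrow> real) set)"
    "borel_measurable M = (borel_measurable borel :: (real \<Rightarrow> complex) set)"
    by (rule measurable_cong_sets; simp add: M)+
  have cis: "cis \<in> borel_measurable borel"
    by (intro borel_measurable_continuous_onI continuous_intros)
  have h: "h \<in> borel_measurable M"
    unfolding bm h_def using cis by measurable
  have h_cayley: "cayley (h \<theta>) = cis \<theta>" if "cis \<theta> \<noteq> 1" for \<theta>
  proof -
    define w where "w = cis \<theta>"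
    define v where "v = \<i> * (w + 1) / (w - 1)"
    have w: "w \<noteq> 1" "w \<noteq> 0" "cnj w = 1 / w"
      using that unfolding w_def by (simp_all add: cis_cnj flip: cis_inverse divide_inverse inverse_eq_divide)
    have "cnj v = v"
      unfolding v_def using w by (simp add: divide_simps) (simp add: algebra_simps)
    then have "complex_of_real (Re v) = v" by (simp add: complex_eq_iff)
    moreover have "v - \<i> = 2 * \<i> / (w - 1)"
      unfolding v_def using w by (simp add: divide_simps) (simp add: algebra_simps)
    ultimately have "cayley (Re v) = w"
      unfolding cayley_def rsv_def using w by simp
    then show ?thesis unfolding h_def v_def w_def by simp
  qed
  define M' where "M' = distr M borel h"
  have "(LINT s|M'. cnj (cayley s) ^ j * cayley s ^ k) = ip ((U ^^ j) x) ((U ^^ k) x)" for j k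
  proof -
    have cm: "(\<lambda>s. cnj (cayley s) ^ j * cayley s ^ k) \<in> borel_measurable borel"
      using bounded_borel_measurable[OF bounded_borel_cayley]
        bounded_borel_measurable[OF bounded_borel_cnj[OF bounded_borel_cayley]] by measurable
    have "(LINT s|M'. cnj (cayley s) ^ j * cayley s ^ k) = (LINT \<theta>|M. cnj (cayley (h \<theta>)) ^ j * cayley (h \<theta>) ^ k)"
      unfolding M'_def by (rule integral_distr[OF h cm])
    also have "\<dots> = (LINT \<theta>|M. cnj (cis \<theta>) ^ j * cis \<theta> ^ k)"
    proof (rule integral_cong_AE)
      show "AE \<theta> in M. cnj (cayley (h \<theta>)) ^ j * cayley (h \<theta>) ^ k = cnj (cis \<theta>) ^ j * cis \<theta> ^ k"
        using AE by eventually_elim (simp add: h_cayley)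
      show "(\<lambda>\<theta>. cnj (cayley (h \<theta>)) ^ j * cayley (h \<theta>) ^ k) \<in> borel_measurable M"
        using measurable_compose[OF h cm] .
      show "(\<lambda>\<theta>. cnj (cis \<theta>) ^ j * cis \<theta> ^ k) \<in> borel_measurable M"
        unfolding bm by (intro borel_measurable_continuous_onI continuous_intros)
    qed
    finally show ?thesis by (simp add: M)
  qed
  moreover have "emeasure M' UNIV = ennreal ((nm x)\<^sup>2)"
    unfolding M'_def using h M(3) sets_eq_imp_space_eq[OF M(2)] by (subst emeasure_distr) auto
  moreover have "sets M' = sets borel" unfolding M'_def by simp
  ultimately show ?thesis by blast
qed

definition line_measure :: "'a \<Rightarrow> real measure" where
  "line_measure x = (SOME M. sets M = sets borel \<and> emeasure M UNIV = ennreal ((nm x)\<^sup>2) \<and>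
    (\<forall>j k. (LINT s|M. cnj (cayley s) ^ j * cayley s ^ k) = ip ((U ^^ j) x) ((U ^^ k) x)))"

lemma line_measure:
  assumes "x \<in> V"
  shows "sets (line_measure x) = sets borel" "emeasure (line_measure x) UNIV = ennreal ((nm x)\<^sup>2)"
    "(LINT s|line_measure x. cnj (cayley s) ^ j * cayley s ^ k) = ip ((U ^^ j) x) ((U ^^ k) x)"
  using someI_ex[OF line_moments[OF assms]] unfolding line_measure_def[symmetric] by blast+

sublocale fam: measure_family H line_measure
  by unfold_locales (simp_all add: line_measure)

text \<open>\<open>compatible f T\<close> strengthens \<open>fam.represents f T\<close> so that it is preserved when \<open>f\<close> is multiplied
  by \<open>rsv (\<plusminus>\<i>)\<close>; the quadratic form of \<open>T\<close> alone does not determine that of \<open>R \<circ> T\<close>.\<close>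

definition compatible :: "(real \<Rightarrow> complex) \<Rightarrow> ('a \<Rightarrow> 'a) \<Rightarrow> bool" where
  "compatible f T \<longleftrightarrow> bounded_borel f \<and> bop T \<and> (\<forall>x\<in>V. T (U x) = U (T x)) \<and>
     (\<forall>j k. \<forall>x\<in>V. (LINT s|line_measure x. f s * (cnj (cayley s) ^ j * cayley s ^ k)) =
        ip ((U ^^ j) x) (T ((U ^^ k) x)))"

lemma compatibleD:
  assumes "compatible f T"
  shows "bounded_borel f" "bop T" "x \<in> V \<Longrightarrow> T (U x) = U (T x)" "x \<in> V \<Longrightarrow> T x \<in> V"
    "x \<in> V \<Longrightarrow> (LINT s|line_measure x. f s * (cnj (cayley s) ^ j * cayley s ^ k)) = ip ((U ^^ j) x) (T ((U ^^ k) x))"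
  using assms bounded_operatorD(1)[of H H T x] unfolding compatible_def by blast+

lemma represents_if_compatible: "compatible f T \<Longrightarrow> fam.represents f T"
  using compatibleD(5)[of f T _ 0 0] compatibleD(1,2)[of f T] unfolding fam.represents_def by simp

lemma bounded_borel_cayley_pow: "bounded_borel (\<lambda>s. cnj (cayley s) ^ j * cayley s ^ k)"
proof -
  have "bounded_borel (\<lambda>s. f s ^ n)" if "bounded_borel f" for f n
    by (induction n) (use that in \<open>auto intro: bounded_borel_mult\<close>)
  then show ?thesis
    by (intro bounded_borel_mult) (use bounded_borel_cayley bounded_borel_cnj in auto)
qed

lemma integrable_compatible:
  "bounded_borel f \<Longrightarrow> x \<in> V \<Longrightarrow> integrable (line_measure x) (\<lambda>s. f s * (cnj (cayley s) ^ j * cayley s ^ k))"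
  by (intro fam.integrable_family bounded_borel_mult bounded_borel_cayley_pow)

lemma compatible_id: "compatible (\<lambda>s. 1) (\<lambda>x. x)"
  unfolding compatible_def by (simp add: bop_id line_measure)

lemma compatible_scale:
  assumes T: "compatible f T"
  shows "compatible (\<lambda>s. c * f s) (\<lambda>x. sc c (T x))"
proof -
  note D = compatibleD[OF T] and UD = bounded_operatorD[OF bop_U]
  have "(LINT s|line_measure x. c * f s * (cnj (cayley s) ^ j * cayley s ^ k)) = ip ((U ^^ j) x) (sc c (T ((U ^^ k) x)))"
    if x: "x \<in> V" for x j k
    using D(5)[OF x, of j k] x D(4) by (simp add: inner_simps mult.assoc)
  then show ?thesis
    unfolding compatible_def using D UD by (auto intro!: bop_scale)
qed

lemma compatible_add:
  assumes T: "compatible f T" and S: "compatible g S"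
  shows "compatible (\<lambda>s. f s + g s) (\<lambda>x. T x + S x)"
proof -
  note D = compatibleD[OF T] and D' = compatibleD[OF S] and UD = bounded_operatorD[OF bop_U]
  have "(LINT s|line_measure x. (f s + g s) * (cnj (cayley s) ^ j * cayley s ^ k)) =
      ip ((U ^^ j) x) (T ((U ^^ k) x) + S ((U ^^ k) x))" if x: "x \<in> V" for x j k
    using D(5)[OF x, of j k] D'(5)[OF x, of j k] integrable_compatible[OF D(1) x] integrable_compatible[OF D'(1) x]
      x D(4) D'(4) by (simp add: inner_simps distrib_right)
  then show ?thesis
    unfolding compatible_def using D D' UD by (auto intro!: bop_add)
qed

text \<open>Multiplication by \<open>cayley\<close> raises the exponent \<open>k\<close> by one;
  since \<open>T\<close> commutes with \<open>U\<close>, the additional \<open>U\<close> can be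
  moved out of the argument of \<open>T\<close>.\<close>

lemma compatible_cayley:
  assumes T: "compatible f T"
  shows "compatible (\<lambda>s. cayley s * f s) (\<lambda>x. U (T x))"
proof -
  note D = compatibleD[OF T] and UD = bounded_operatorD[OF bop_U]
  have "(LINT s|line_measure x. cayley s * f s * (cnj (cayley s) ^ j * cayley s ^ k)) = ip ((U ^^ j) x) (U (T ((U ^^ k) x)))"
    if x: "x \<in> V" for x j k
    using D(5)[OF x, of j "Suc k"] D(3)[of "(U ^^ k) x"] x by (simp add: mult_ac)
  then show ?thesis
    unfolding compatible_def using D UD bounded_borel_cayley by (auto intro!: bop_comp[OF bop_U])
qed

lemma compatible_cnj_cayley:
  assumes T: "compatible f T"
  shows "compatible (\<lambda>s. cnj (cayley s) * f s) (\<lambda>x. Ui (T x))"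
proof -
  note D = compatibleD[OF T] and UD = bounded_operatorD[OF bop_U]
  have "(LINT s|line_measure x. cnj (cayley s) * f s * (cnj (cayley s) ^ j * cayley s ^ k)) = ip ((U ^^ j) x) (Ui (T ((U ^^ k) x)))"
    if x: "x \<in> V" for x j k
    using D(5)[OF x, of "Suc j" k] inner_U_left[of "(U ^^ j) x" "T ((U ^^ k) x)"] x D(4) by (simp add: mult_ac)
  moreover have "Ui (T (U x)) = U (Ui (T x))" if "x \<in> V" for x
    using that D(3,4) by (simp add: Ui)
  ultimately show ?thesis
    unfolding compatible_def using D UD bounded_borel_cayley by (auto intro!: bop_comp[OF bop_Ui])
qed

lemma rsv_eq_cayley: "rsv \<i> s = 1 / (2 * \<i>) * (cayley s + (- 1) * 1)"
  unfolding cayley_def by simp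

lemma compatible_rsv:
  assumes T: "compatible f T"
  shows "compatible (\<lambda>s. rsv \<i> s * f s) (\<lambda>x. sc (1 / (2 * \<i>)) (U (T x) + sc (- 1) (T x)))"
proof -
  have "(\<lambda>s. rsv \<i> s * f s) = (\<lambda>s. 1 / (2 * \<i>) * (cayley s * f s + (- 1) * f s))"
    unfolding rsv_eq_cayley by (rule ext) (simp add: field_simps)
  then show ?thesis
    using compatible_scale[OF compatible_add[OF compatible_cayley[OF T] compatible_scale[OF T, of "- 1"]], of "1 / (2 * \<i>)"]
    by simp
qed

lemma compatible_rsv_cnj:
  assumes T: "compatible f T"
  shows "compatible (\<lambda>s. rsv (cnj \<i>) s * f s) (\<lambda>x. sc (cnj (1 / (2 * \<i>))) (Ui (T x) + sc (- 1) (T x)))"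
proof -
  have "(\<lambda>s. rsv (cnj \<i>) s * f s) = (\<lambda>s. cnj (1 / (2 * \<i>)) * (cnj (cayley s) * f s + (- 1) * f s))"
    unfolding cnj_rsv[symmetric] rsv_eq_cayley by (rule ext) (simp add: field_simps)
  then show ?thesis
    using compatible_scale[OF compatible_add[OF compatible_cnj_cayley[OF T] compatible_scale[OF T, of "- 1"]], of "cnj (1 / (2 * \<i>))"]
    by simp
qed

text \<open>\<open>T\<close> is chosen before \<open>h\<close> and \<open>S\<close>. Taking the
  identity for \<open>S\<close> gives an operator for \<open>f\<close>; taking the operator of
  another element gives multiplicativity.\<close>

lemma resolvent_algebra_compatible:
  assumes "f \<in> resolvent_algebra \<i>"
  shows "\<exists>T. \<forall>h S. compatible h S \<longrightarrow> compatible (\<lambda>s. f s * h s) (\<lambda>x. T (S x))"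
  using assms
proof (induction rule: resolvent_algebra.induct)
  case (const c)
  show ?case by (rule exI[of _ "sc c"]) (auto intro: compatible_scale)
next
  case (add f g)
  then obtain T T' where "\<forall>h S. compatible h S \<longrightarrow> compatible (\<lambda>s. f s * h s) (\<lambda>x. T (S x))"
    "\<forall>h S. compatible h S \<longrightarrow> compatible (\<lambda>s. g s * h s) (\<lambda>x. T' (S x))" by blast
  then have "compatible (\<lambda>s. f s * h s + g s * h s) (\<lambda>x. T (S x) + T' (S x))" if "compatible h S" for h S
    using that by (intro compatible_add) auto
  then show ?case by (intro exI[of _ "\<lambda>x. T x + T' x"]) (simp add: distrib_right)
next
  case (rsv f)
  then obtain T where T: "\<forall>h S. compatible h S \<longrightarrow> compatible (\<lambda>s. f s * h s) (\<lambda>x. T (S x))" by blast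
  show ?case
  proof (intro exI[of _ "\<lambda>x. sc (1 / (2 * \<i>)) (U (T x) + sc (- 1) (T x))"] allI impI)
    fix h S assume "compatible h S"
    with T have "compatible (\<lambda>s. f s * h s) (\<lambda>x. T (S x))" by blast
    from compatible_rsv[OF this]
    show "compatible (\<lambda>s. rsv \<i> s * f s * h s) (\<lambda>x. sc (1 / (2 * \<i>)) (U (T (S x)) + sc (- 1) (T (S x))))"
      by (simp only: mult.assoc)
  qed
next
  case (rsv_cnj f)
  then obtain T where T: "\<forall>h S. compatible h S \<longrightarrow> compatible (\<lambda>s. f s * h s) (\<lambda>x. T (S x))" by blast
  show ?case
  proof (intro exI[of _ "\<lambda>x. sc (cnj (1 / (2 * \<i>))) (Ui (T x) + sc (- 1) (T x))"] allI impI)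
    fix h S assume "compatible h S"
    with T have "compatible (\<lambda>s. f s * h s) (\<lambda>x. T (S x))" by blast
    from compatible_rsv_cnj[OF this]
    show "compatible (\<lambda>s. rsv (cnj \<i>) s * f s * h s) (\<lambda>x. sc (cnj (1 / (2 * \<i>))) (Ui (T (S x)) + sc (- 1) (T (S x))))"
      by (simp only: mult.assoc)
  qed
qed

sublocale calc: spectral_calculus H line_measure
proof
  have gen: "generating (resolvent_algebra \<i>)" by (rule generating_resolvent_algebra) simp
  have ex: "\<exists>T. fam.represents f T" if f: "f \<in> resolvent_algebra \<i>" for f
  proof -
    obtain T where T: "\<forall>h S. compatible h S \<longrightarrow> compatible (\<lambda>s. f s * h s) (\<lambda>x. T (S x))"
      using resolvent_algebra_compatible[OF f] by blast
    from T[rule_format, OF compatible_id] have "compatible f T" by simp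
    then show ?thesis by (intro exI[of _ T] represents_if_compatible)
  qed
  have mult: "fam.represents (\<lambda>s. f s * g s) (\<lambda>x. T (S x))"
    if f: "f \<in> resolvent_algebra \<i>" and g: "g \<in> resolvent_algebra \<i>"
      and T: "fam.represents f T" and S: "fam.represents g S" for f g T S
  proof -
    obtain T0 where T0: "\<forall>h S. compatible h S \<longrightarrow> compatible (\<lambda>s. f s * h s) (\<lambda>x. T0 (S x))"
      using resolvent_algebra_compatible[OF f] by blast
    obtain S0 where S0: "\<forall>h S. compatible h S \<longrightarrow> compatible (\<lambda>s. g s * h s) (\<lambda>x. S0 (S x))"
      using resolvent_algebra_compatible[OF g] by blast
    from S0[rule_format, OF compatible_id] have cS: "compatible g S0" by simp
    from T0[rule_format, OF compatible_id] have cT: "compatible f T0" by simp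
    \<comment> \<open>The given operators can differ from the constructed ones only outside the
      carrier.\<close>
    have eq: "T (S x) = T0 (S0 x)" if x: "x \<in> V" for x
      using fam.represents_unique[OF S represents_if_compatible[OF cS] x]
        fam.represents_unique[OF T represents_if_compatible[OF cT], of "S0 x"] compatibleD(4)[OF cS x] by simp
    show ?thesis
      by (rule fam.represents_cong[OF represents_if_compatible[OF T0[rule_format, OF cS]] eq])
  qed
  show "\<exists>T. fam.represents f T" if "bounded_borel f" for f
    by (rule fam.calculus_extension_exists[OF gen]) (erule ex, erule (3) mult, rule that)
  show "fam.represents (\<lambda>s. f s * g s) (\<lambda>x. T (S x))" if "fam.represents f T" "fam.represents g S" for f g T S
    by (rule fam.calculus_extension_mult[OF gen _ _ that]) (erule ex, erule (3) mult)
qed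

lemma fc_rsv_eq_R: "x \<in> V \<Longrightarrow> calc.fc (rsv \<i>) x = R x"
proof -
  assume x: "x \<in> V"
  have "fam.represents (rsv \<i>) (\<lambda>x. sc (1 / (2 * \<i>)) (U x + sc (- 1) x))"
    using represents_if_compatible[OF compatible_rsv[OF compatible_id]] by simp
  from calc.fc_eq[OF this x] show ?thesis using R_eq_U[OF x] by simp
qed

theorem spectral_theorem:
  "\<exists>E. projection_valued_measure H E \<and> is_spectral_integral H E complex_of_real A"
proof (intro exI conjI)
  show "projection_valued_measure H (\<lambda>B. calc.fc (indicator B))"
    by (rule calc.projection_valued_measure_fc)
  show "is_spectral_integral H (\<lambda>B. calc.fc (indicator B)) complex_of_real A"
  proof (rule calc.is_spectral_integral_identity[OF A_linear])
    show "calc.fc (rsv \<i>) y \<in> D \<and> Aop (calc.fc (rsv \<i>) y) = y + sc \<i> (calc.fc (rsv \<i>) y)" if "y \<in> V" for y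
      using that R_in_D A_R by (simp add: fc_rsv_eq_R)
    show "\<exists>y\<in>V. x = calc.fc (rsv \<i>) y" if "x \<in> D" for x
      using R_eqI[OF that] that A_simps by (intro bexI[of _ "Aop x - sc \<i> x"]) (simp_all add: fc_rsv_eq_R)
  qed
qed

lemma spectral_resolution: "spectral_resolution H (spectral_measure H A) A"
  using someI_ex[OF spectral_theorem] unfolding spectral_measure_def[symmetric]
  by unfold_locales auto

end

section \<open>Convergence of functions of the operators\<close>

context self_adjoint_operator
begin

sublocale spec: spectral_resolution H "spectral_measure H A" A
  by (rule spectral_resolution)

text \<open>Existence of a spectral integral makes the choice in \<open>functional_calculus\<close>
  admissible, uniqueness evaluates it.\<close>

lemma exp_operator_eq_fc:
  assumes g: "bounded_borel g" and eq: "\<And>x. x \<in> V \<Longrightarrow> AE s in spec.\<nu> x. exp (c * complex_of_real s) = g s"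
    and x: "x \<in> V"
  shows "exp_operator H c A x = spec.fc g x"
proof -
  have m: "(\<lambda>s. exp (c * complex_of_real s)) \<in> borel_measurable borel"
    by (intro borel_measurable_continuous_onI continuous_intros)
  have "is_spectral_integral H (spectral_measure H A) (\<lambda>s. exp (c * complex_of_real s))
      (functional_calculus H A (\<lambda>s. exp (c * complex_of_real s)))"
    unfolding functional_calculus_def
    by (rule someI) (rule spec.is_spectral_integral_fc(1)[OF m g eq])
  from spec.is_spectral_integral_fc(2)[OF m g eq this x] show ?thesis
    by (simp add: exp_operator_def)
qed

lemma fc_Im_form:
  assumes g: "bounded_borel g" and im: "\<And>s. Im (g s) = b * (cmod (g s))\<^sup>2" and x: "x \<in> V"
  shows "Im (ip x (spec.fc g x)) = b * (nm (spec.fc g x))\<^sup>2"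
proof -
  have "Im (ip x (spec.fc g x)) = (LINT s|spec.\<nu> x. Im (g s))"
    unfolding spec.fc_form[OF g x] by (rule integral_Im[symmetric]) (rule spec.fam.integrable_family[OF g x])
  then show ?thesis by (simp add: im spec.fc_norm[OF g x])
qed

lemma fc_rsv_range_dense:
  assumes z: "Im z \<noteq> 0" and x: "x \<in> V" and e: "e > 0"
  shows "\<exists>y\<in>V. nm (x - spec.fc (rsv z) y) < e"
proof -
  obtain d where d: "d \<in> D" "nm (x - d) < e"
    using self_adjoint x e unfolding self_adjoint_def hdense_def by blast
  then obtain y where "y \<in> V" "d = spec.fc (rsv z) y"
    using spec.fc_rsv_range_if_integrable[OF z, of d] spec.A_dom by auto
  then show ?thesis using d by blast
qed

end

locale operator_sequence = self_adjoint_operator H A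
  for H :: "'a::ab_group_add hilbert" and A +
  fixes Hn :: "nat \<Rightarrow> 'b::ab_group_add hilbert" and J :: "nat \<Rightarrow> 'a \<Rightarrow> 'b" and An :: "nat \<Rightarrow> 'b operator"
    and C :: real
  assumes An: "\<And>n. self_adjoint_operator (Hn n) (An n)"
    and J: "\<And>n. bounded_operator H (Hn n) (J n)"
    and J_bound: "\<And>n x. x \<in> hcarrier H \<Longrightarrow> hnorm (Hn n) (J n x) \<le> C * hnorm H x"
    and C_nonneg: "C \<ge> 0"
begin

sublocale K: self_adjoint_operator "Hn n" "An n" for n
  by (rule An)

sublocale P: hilbert_space_pair H "Hn n" for n ..

abbreviation "Js n \<equiv> bounded_adjoint H (Hn n) (J n)"

lemmas JD = bounded_operatorD[OF J]

lemma J_diff: "x \<in> V \<Longrightarrow> y \<in> V \<Longrightarrow> J n (x - y) = J n x - J n y"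
  using P.bounded_operator_diff[OF J] .

lemma J_in [simp]: "x \<in> V \<Longrightarrow> J n x \<in> hcarrier (Hn n)"
  using JD(1) .

lemma Js_in [simp]: "y \<in> hcarrier (Hn n) \<Longrightarrow> Js n y \<in> V"
  using P.bounded_adjoint_in[OF J] .

lemma Js_bound: "y \<in> hcarrier (Hn n) \<Longrightarrow> nm (Js n y) \<le> C * hnorm (Hn n) y"
  using P.hnorm_bounded_adjoint_le[OF J _ C_nonneg J_bound] .

lemma inner_Js_left: "y \<in> hcarrier (Hn n) \<Longrightarrow> x \<in> V \<Longrightarrow> ip (Js n y) x = hinner (Hn n) y (J n x)"
  using P.inner_bounded_adjoint[OF J] .

lemma inner_Js_right: "y \<in> hcarrier (Hn n) \<Longrightarrow> x \<in> V \<Longrightarrow> ip x (Js n y) = hinner (Hn n) (J n x) y"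
  using inner_Js_left[of y n x] inner_commute[of x "Js n y"] K.inner_commute[of "J n x" n y] by simp

end

text \<open>The sequences in \<open>X\<close> are the constant ones for strong convergence and all bounded ones for norm
  convergence; this allows a common treatment. The set \<open>L\<close> carries all the spectral measures.\<close>

locale resolvent_convergence = operator_sequence +
  fixes z :: complex and L :: "real set" and \<delta> :: real and X :: "(nat \<Rightarrow> 'a) set"
  assumes L: "closed L" and \<delta>: "\<delta> > 0" "\<And>s. s \<in> L \<Longrightarrow> \<delta> \<le> cmod (complex_of_real s - z)"
    and AE_L: "\<And>x. x \<in> V \<Longrightarrow> AE s in spec.\<nu> x. s \<in> L"
    and AE_Ln: "\<And>n x. x \<in> hcarrier (Hn n) \<Longrightarrow> AE s in K.spec.\<nu> n x. s \<in> L"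
    and X_in: "\<And>xs n. xs \<in> X \<Longrightarrow> xs n \<in> V"
    and X_bounded: "\<And>xs. xs \<in> X \<Longrightarrow> \<exists>B. \<forall>n. nm (xs n) \<le> B"
    and X_image: "\<And>xs T. xs \<in> X \<Longrightarrow> bop T \<Longrightarrow> (\<lambda>n. T (xs n)) \<in> X"
    and JsJ: "\<And>xs. xs \<in> X \<Longrightarrow> (\<lambda>n. nm (Js n (J n (xs n)) - xs n)) \<longlonglongrightarrow> 0"
begin

definition converges :: "(real \<Rightarrow> complex) \<Rightarrow> bool" where
  "converges f \<longleftrightarrow> bounded_borel f \<and>
     (\<forall>xs\<in>X. (\<lambda>n. hnorm (Hn n) (K.spec.fc n f (J n (xs n)) - J n (spec.fc f (xs n)))) \<longlonglongrightarrow> 0)"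

text \<open>\<open>rsv z\<close> for real \<open>z\<close>, or \<open>exp (- t * s)\<close> when
  \<open>L\<close> lies in a half line \<open>{\<gamma>..}\<close>, is bounded on \<open>L\<close>
  but in general not on the line; values off \<open>L\<close> do not matter to the spectral
  measures.\<close>

definition cut :: "(real \<Rightarrow> complex) \<Rightarrow> real \<Rightarrow> complex" where
  "cut f s = f s * indicator L s"

lemma L_borel: "L \<in> sets borel"
  using L by simp

lemma bounded_borel_cut_rsv: "bounded_borel (cut (rsv z))"
  unfolding bounded_borel_def
proof (intro conjI exI allI)
  show "cut (rsv z) \<in> borel_measurable borel"
    unfolding cut_def using L_borel by measurable
  show "cmod (cut (rsv z) s) \<le> 1 / \<delta>" for s
    using \<delta>(1) \<delta>(2)[of s] by (auto simp: cut_def rsv_def indicator_def norm_divide frac_le)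
qed

lemma cut_rsv_cnj: "cut (rsv (cnj z)) = (\<lambda>s. cnj (cut (rsv z) s))"
  by (rule ext) (simp add: cut_def cnj_rsv indicator_def)

lemma converges_const: "converges (\<lambda>s. c)"
  unfolding converges_def using X_in by (auto simp: spec.fc_const K.spec.fc_const JD)

lemma converges_add:
  assumes f: "converges f" and g: "converges g"
  shows "converges (\<lambda>s. f s + g s)"
  unfolding converges_def
proof (intro conjI ballI)
  have b: "bounded_borel f" "bounded_borel g" using f g unfolding converges_def by auto
  then show bs: "bounded_borel (\<lambda>s. f s + g s)" by auto
  fix xs assume xs: "xs \<in> X"
  let ?d = "\<lambda>f n. K.spec.fc n f (J n (xs n)) - J n (spec.fc f (xs n))"
  have "(\<lambda>n. hnorm (Hn n) (?d f n) + hnorm (Hn n) (?d g n)) \<longlonglongrightarrow> 0 + 0"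
    using f g xs unfolding converges_def by (intro tendsto_add) auto
  moreover have "hnorm (Hn n) (?d (\<lambda>s. f s + g s) n) \<le> hnorm (Hn n) (?d f n) + hnorm (Hn n) (?d g n)" for n
  proof -
    have "?d (\<lambda>s. f s + g s) n = ?d f n + ?d g n"
      using X_in[OF xs, of n] b by (simp add: spec.fc_add K.spec.fc_add JD)
    then show ?thesis using X_in[OF xs, of n] b K.hnorm_triangle by simp
  qed
  moreover have "0 \<le> hnorm (Hn n) (?d (\<lambda>s. f s + g s) n)" for n
    using X_in[OF xs, of n] bs by (intro K.hnorm_nonneg) auto
  ultimately show "(\<lambda>n. hnorm (Hn n) (?d (\<lambda>s. f s + g s) n)) \<longlonglongrightarrow> 0"
    by (intro Lim_null_comparison[of "\<lambda>n. hnorm (Hn n) (?d (\<lambda>s. f s + g s) n)"]) auto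
qed

text \<open>Product rule: the defect of \<open>f * g\<close> is \<open>f\<close> applied to the
  defect of \<open>g\<close>, plus the defect of \<open>f\<close> along the vectors
  \<open>spec.fc g (xs n)\<close>. These must form a sequence in \<open>X\<close> again, which is
  the purpose of \<open>X_image\<close>.\<close>

lemma converges_mult:
  assumes f: "converges f" and g: "converges g"
  shows "converges (\<lambda>s. f s * g s)"
  unfolding converges_def
proof (intro conjI ballI)
  have b: "bounded_borel f" "bounded_borel g" using f g unfolding converges_def by auto
  then show bs: "bounded_borel (\<lambda>s. f s * g s)" by auto
  obtain B where B: "B \<ge> 0" "\<And>s. cmod (f s) \<le> B" using bounded_borel_bound[OF b(1)] by metis
  fix xs assume xs: "xs \<in> X"
  define ys where "ys n = spec.fc g (xs n)" for n
  have ys: "ys \<in> X" unfolding ys_def by (rule X_image[OF xs spec.fc_bop[OF b(2)]])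
  let ?d = "\<lambda>f xs n. K.spec.fc n f (J n (xs n)) - J n (spec.fc f (xs n))"
  have "(\<lambda>n. B * hnorm (Hn n) (?d g xs n) + hnorm (Hn n) (?d f ys n)) \<longlonglongrightarrow> B * 0 + 0"
    using f g xs ys unfolding converges_def by (intro tendsto_add tendsto_mult tendsto_const) auto
  moreover have "hnorm (Hn n) (?d (\<lambda>s. f s * g s) xs n) \<le> B * hnorm (Hn n) (?d g xs n) + hnorm (Hn n) (?d f ys n)" for n
  proof -
    have V: "xs n \<in> V" "ys n \<in> V" using X_in xs ys by auto
    have "?d (\<lambda>s. f s * g s) xs n = K.spec.fc n f (?d g xs n) + ?d f ys n"
      using V b by (simp add: spec.fc_mult K.spec.fc_mult K.self.bounded_operator_diff[OF K.spec.fc_bop[OF b(1)]] ys_def[symmetric])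
    moreover have "hnorm (Hn n) (K.spec.fc n f (?d g xs n)) \<le> B * hnorm (Hn n) (?d g xs n)"
      using V b B by (intro K.spec.fc_norm_le) auto
    ultimately show ?thesis
      using V b K.hnorm_triangle[of "K.spec.fc n f (?d g xs n)" n "?d f ys n"] by simp
  qed
  moreover have "0 \<le> hnorm (Hn n) (?d (\<lambda>s. f s * g s) xs n)" for n
    using X_in[OF xs, of n] bs by (intro K.hnorm_nonneg) auto
  ultimately show "(\<lambda>n. hnorm (Hn n) (?d (\<lambda>s. f s * g s) xs n)) \<longlonglongrightarrow> 0"
    by (intro Lim_null_comparison[of "\<lambda>n. hnorm (Hn n) (?d (\<lambda>s. f s * g s) xs n)"]) auto
qed

lemma converges_uniform_limit:
  assumes f: "bounded_borel f" and lim: "\<And>e. e > 0 \<Longrightarrow> \<exists>p. converges p \<and> (\<forall>s\<in>L. cmod (f s - p s) < e)"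
  shows "converges f"
  unfolding converges_def
proof (intro conjI ballI f)
  fix xs assume xs: "xs \<in> X"
  obtain B where B: "\<And>n. nm (xs n) \<le> B" using X_bounded[OF xs] by blast
  have Bp: "B \<ge> 0" using B[of 0] X_in[OF xs, of 0] hnorm_nonneg order_trans by blast
  let ?d = "\<lambda>f n. K.spec.fc n f (J n (xs n)) - J n (spec.fc f (xs n))"
  show "(\<lambda>n. hnorm (Hn n) (?d f n)) \<longlonglongrightarrow> 0"
  proof (rule LIMSEQ_I)
    fix e :: real assume e: "e > 0"
    \<comment> \<open>Replacing \<open>f\<close> by \<open>p\<close> costs \<open>C * B * e'\<close>
      in each of two terms, together at most \<open>e / 2\<close>; the summand 1 keeps the
      denominator positive.\<close>
    define e' where "e' = e / (2 * (2 * C * B + 1))"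
    have q: "2 * C * B + 1 > 0" using C_nonneg Bp by (simp add: add_nonneg_pos)
    then have e': "e' > 0" unfolding e'_def using e by simp
    have small: "2 * C * B * e' \<le> e / 2"
      unfolding e'_def using e q C_nonneg Bp by (simp add: field_simps)
    obtain p where p: "converges p" "\<And>s. s \<in> L \<Longrightarrow> cmod (f s - p s) < e'" using lim[OF e'] by blast
    have bp: "bounded_borel p" using p unfolding converges_def by simp
    have bd: "bounded_borel (\<lambda>s. f s - p s)" using f bp by auto
    have "(\<lambda>n. hnorm (Hn n) (?d p n)) \<longlonglongrightarrow> 0" using p(1) xs unfolding converges_def by blast
    from order_tendstoD(2)[OF this half_gt_zero[OF e]]
    obtain N where N: "\<And>n. n \<ge> N \<Longrightarrow> hnorm (Hn n) (?d p n) < e / 2"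
      unfolding eventually_sequentially by blast
    have "norm (hnorm (Hn n) (?d f n) - 0) < e" if n: "n \<ge> N" for n
    proof -
      have V: "xs n \<in> V" using X_in xs by auto
      have 1: "hnorm (Hn n) (K.spec.fc n (\<lambda>s. f s - p s) (J n (xs n))) \<le> C * B * e'"
      proof -
        have "hnorm (Hn n) (K.spec.fc n (\<lambda>s. f s - p s) (J n (xs n))) \<le> e' * hnorm (Hn n) (J n (xs n))"
        proof (rule K.spec.fc_norm_le[OF bd J_in[OF V]])
          show "AE s in K.spec.\<nu> n (J n (xs n)). cmod (f s - p s) \<le> e'"
            using AE_Ln[OF J_in[OF V]] by (rule eventually_mono) (use p(2) less_imp_le in blast)
        qed (use e' in simp)
        also have "\<dots> \<le> e' * (C * B)"
          using e' J_bound[OF V, of n] B[of n] C_nonneg by (intro mult_left_mono) (auto intro: order_trans mult_left_mono)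
        finally show ?thesis by (simp add: mult_ac)
      qed
      have 2: "hnorm (Hn n) (J n (spec.fc (\<lambda>s. f s - p s) (xs n))) \<le> C * B * e'"
      proof -
        have "nm (spec.fc (\<lambda>s. f s - p s) (xs n)) \<le> e' * nm (xs n)"
        proof (rule spec.fc_norm_le[OF bd V])
          show "AE s in spec.\<nu> (xs n). cmod (f s - p s) \<le> e'"
            using AE_L[OF V] by (rule eventually_mono) (use p(2) less_imp_le in blast)
        qed (use e' in simp)
        also have "\<dots> \<le> e' * B" using e' B by (intro mult_left_mono) auto
        finally have "C * nm (spec.fc (\<lambda>s. f s - p s) (xs n)) \<le> C * (e' * B)" using C_nonneg by (intro mult_left_mono)
        then show ?thesis
          using J_bound[of "spec.fc (\<lambda>s. f s - p s) (xs n)" n] bd V by (simp add: mult_ac)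
      qed
      have eq: "?d f n = (K.spec.fc n (\<lambda>s. f s - p s) (J n (xs n)) - J n (spec.fc (\<lambda>s. f s - p s) (xs n))) + ?d p n"
        using V f bp by (simp add: spec.fc_diff K.spec.fc_diff J_diff)
      have "hnorm (Hn n) (?d f n) \<le>
          hnorm (Hn n) (K.spec.fc n (\<lambda>s. f s - p s) (J n (xs n)) - J n (spec.fc (\<lambda>s. f s - p s) (xs n))) + hnorm (Hn n) (?d p n)"
        unfolding eq using V bd bp by (intro K.hnorm_triangle) auto
      moreover have "hnorm (Hn n) (K.spec.fc n (\<lambda>s. f s - p s) (J n (xs n)) - J n (spec.fc (\<lambda>s. f s - p s) (xs n))) \<le>
          hnorm (Hn n) (K.spec.fc n (\<lambda>s. f s - p s) (J n (xs n))) + hnorm (Hn n) (J n (spec.fc (\<lambda>s. f s - p s) (xs n)))"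
        using V bd by (intro K.hnorm_diff_le) auto
      ultimately have "hnorm (Hn n) (?d f n) \<le> 2 * C * B * e' + hnorm (Hn n) (?d p n)"
        using 1 2 by linarith
      then have "hnorm (Hn n) (?d f n) < e" using small N[OF n] by simp
      moreover have "0 \<le> hnorm (Hn n) (?d f n)" using V f by (intro K.hnorm_nonneg) auto
      ultimately show ?thesis by simp
    qed
    then show "\<exists>no. \<forall>n\<ge>no. norm (hnorm (Hn n) (?d f n) - 0) < e" by blast
  qed
qed

text \<open>Elements of the resolvent algebra may be unbounded off \<open>L\<close>; each is
  replaced by a polynomial in the cut resolvents that agrees with it on \<open>L\<close>.\<close>

lemma converges_vanishing_at_infinity:
  assumes base: "converges (cut (rsv z))" "converges (cut (rsv (cnj z)))"
    and f: "bounded_borel f" "continuous_on L f" and f0: "\<And>e. e > 0 \<Longrightarrow> \<exists>B. \<forall>s\<in>L. \<bar>s\<bar> > B \<longrightarrow> cmod (f s) < e"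
  shows "converges f"
proof (rule converges_uniform_limit[OF f(1)])
  fix e :: real assume e: "e > 0"
  have z: "complex_of_real s \<noteq> z" if "s \<in> L" for s using \<delta>(1) \<delta>(2)[OF that] by auto
  obtain p where p: "p \<in> resolvent_algebra z" "\<And>s. s \<in> L \<Longrightarrow> cmod (f s - p s) < e"
    using resolvent_algebra_dense[OF L z f(2) f0 e] by blast
  have "\<exists>q. converges q \<and> (\<forall>s\<in>L. q s = p s)"
    using p(1)
  proof (induction rule: resolvent_algebra.induct)
    case (const c)
    then show ?case using converges_const by blast
  next
    case (add f g)
    then obtain q q' where "converges q" "converges q'" "\<forall>s\<in>L. q s = f s" "\<forall>s\<in>L. q' s = g s" by blast
    then show ?case by (intro exI[of _ "\<lambda>s. q s + q' s"]) (simp add: converges_add)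
  next
    case (rsv f)
    then obtain q where "converges q" "\<forall>s\<in>L. q s = f s" by blast
    then show ?case using base
      by (intro exI[of _ "\<lambda>s. cut (rsv z) s * q s"]) (simp add: converges_mult, simp add: cut_def)
  next
    case (rsv_cnj f)
    then obtain q where "converges q" "\<forall>s\<in>L. q s = f s" by blast
    then show ?case using base
      by (intro exI[of _ "\<lambda>s. cut (rsv (cnj z)) s * q s"]) (simp add: converges_mult, simp add: cut_def)
  qed
  then show "\<exists>p. converges p \<and> (\<forall>s\<in>L. cmod (f s - p s) < e)"
    using p(2) by metis
qed

text \<open>The compression error is \<open>Js n\<close> of the defect plus
  \<open>Js n (J n y) - y\<close> at \<open>y = spec.fc f (xs n)\<close>.\<close>

lemma converges_compression:
  assumes f: "converges f" and xs: "xs \<in> X"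
  shows "(\<lambda>n. nm (Js n (K.spec.fc n f (J n (xs n))) - spec.fc f (xs n))) \<longlonglongrightarrow> 0"
proof -
  have b: "bounded_borel f" using f unfolding converges_def by auto
  define ys where "ys n = spec.fc f (xs n)" for n
  have ys: "ys \<in> X" unfolding ys_def by (rule X_image[OF xs spec.fc_bop[OF b]])
  let ?d = "\<lambda>n. K.spec.fc n f (J n (xs n)) - J n (ys n)"
  have "(\<lambda>n. C * hnorm (Hn n) (?d n) + nm (Js n (J n (ys n)) - ys n)) \<longlonglongrightarrow> C * 0 + 0"
    using f xs JsJ[OF ys] unfolding converges_def ys_def by (intro tendsto_add tendsto_mult tendsto_const) auto
  moreover have "nm (Js n (K.spec.fc n f (J n (xs n))) - ys n) \<le> C * hnorm (Hn n) (?d n) + nm (Js n (J n (ys n)) - ys n)" for n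
  proof -
    have V: "xs n \<in> V" "ys n \<in> V" using X_in xs ys by auto
    have eq: "Js n (K.spec.fc n f (J n (xs n))) - ys n = Js n (?d n) + (Js n (J n (ys n)) - ys n)"
      using P.bounded_adjoint_diff[OF J, of "K.spec.fc n f (J n (xs n))" n "J n (ys n)"] V b by simp
    show ?thesis
      unfolding eq using hnorm_triangle[of "Js n (?d n)" "Js n (J n (ys n)) - ys n"] Js_bound[of "?d n" n] V b by simp
  qed
  moreover have "0 \<le> nm (Js n (K.spec.fc n f (J n (xs n))) - ys n)" for n
    using X_in[OF xs, of n] X_in[OF ys, of n] b by (intro hnorm_nonneg) auto
  ultimately show ?thesis
    unfolding ys_def[symmetric]
    by (intro Lim_null_comparison[of "\<lambda>n. nm (Js n (K.spec.fc n f (J n (xs n))) - ys n)"]) auto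
qed

end

section \<open>Intertwining of the resolvents\<close>

context operator_sequence
begin

text \<open>Weak convergence together with convergence of the norms is strong convergence.\<close>

lemma strong_intertwining:
  assumes JsJ: "\<And>x. x \<in> V \<Longrightarrow> (\<lambda>n. nm (Js n (J n x) - x)) \<longlonglongrightarrow> 0"
    and h: "bounded_borel h" and x: "x \<in> V"
    and nrm: "(\<lambda>n. (hnorm (Hn n) (K.spec.fc n h (J n x)))\<^sup>2) \<longlonglongrightarrow> (nm (spec.fc h x))\<^sup>2"
    and weak: "\<And>y. y \<in> V \<Longrightarrow> (\<lambda>n. hinner (Hn n) (K.spec.fc n h (J n x)) (J n y)) \<longlonglongrightarrow> ip (spec.fc h x) y"
  shows "(\<lambda>n. hnorm (Hn n) (K.spec.fc n h (J n x) - J n (spec.fc h x))) \<longlonglongrightarrow> 0"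
proof -
  define y where "y = spec.fc h x"
  have y: "y \<in> V" using h x by (simp add: y_def)
  have "(\<lambda>n. ip y (Js n (J n y))) \<longlonglongrightarrow> ip y y"
    using y by (intro inner_tendsto JsJ) auto
  then have "(\<lambda>n. Re (ip y (Js n (J n y)))) \<longlonglongrightarrow> Re (ip y y)" by (rule tendsto_Re)
  then have J: "(\<lambda>n. (hnorm (Hn n) (J n y))\<^sup>2) \<longlonglongrightarrow> (nm y)\<^sup>2"
    using y by (simp add: inner_Js_right K.hnorm_sq hnorm_sq)
  have "(\<lambda>n. Re (hinner (Hn n) (K.spec.fc n h (J n x)) (J n y))) \<longlonglongrightarrow> (nm y)\<^sup>2"
    using tendsto_Re[OF weak[OF y]] y by (simp add: y_def[symmetric] hnorm_sq)
  then have "(\<lambda>n. (hnorm (Hn n) (K.spec.fc n h (J n x)))\<^sup>2 + (hnorm (Hn n) (J n y))\<^sup>2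
      - 2 * Re (hinner (Hn n) (K.spec.fc n h (J n x)) (J n y))) \<longlonglongrightarrow> (nm y)\<^sup>2 + (nm y)\<^sup>2 - 2 * (nm y)\<^sup>2"
    using nrm J unfolding y_def[symmetric] by (intro tendsto_diff tendsto_add tendsto_mult tendsto_const)
  then have "(\<lambda>n. (hnorm (Hn n) (K.spec.fc n h (J n x) - J n y))\<^sup>2) \<longlonglongrightarrow> 0"
    using h x y by (simp add: K.hnorm_diff_sq)
  then have "(\<lambda>n. sqrt ((hnorm (Hn n) (K.spec.fc n h (J n x) - J n y))\<^sup>2)) \<longlonglongrightarrow> sqrt 0"
    by (rule tendsto_real_sqrt)
  then show ?thesis using h x y unfolding y_def[symmetric] by simp
qed

text \<open>\<open>im\<close> encodes the resolvent identity between \<open>z\<close> and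
  \<open>cnj z\<close>, with \<open>b = Im z\<close>. For the conjugate function the norms converge
  as well because the operators are normal, and weak convergence passes to adjoints.\<close>

lemma strong_intertwining_resolvent:
  assumes JsJ: "\<And>x. x \<in> V \<Longrightarrow> (\<lambda>n. nm (Js n (J n x) - x)) \<longlonglongrightarrow> 0"
    and g: "bounded_borel g" and im: "\<And>s. Im (g s) = b * (cmod (g s))\<^sup>2" "b \<noteq> 0"
    and lim: "\<And>x. x \<in> V \<Longrightarrow> (\<lambda>n. nm (Js n (K.spec.fc n g (J n x)) - spec.fc g x)) \<longlonglongrightarrow> 0"
    and x: "x \<in> V"
  shows "(\<lambda>n. hnorm (Hn n) (K.spec.fc n g (J n x) - J n (spec.fc g x))) \<longlonglongrightarrow> 0"
    and "(\<lambda>n. hnorm (Hn n) (K.spec.fc n (\<lambda>s. cnj (g s)) (J n x) - J n (spec.fc (\<lambda>s. cnj (g s)) x))) \<longlonglongrightarrow> 0"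
proof -
  have cg: "bounded_borel (\<lambda>s. cnj (g s))" using g by auto
  have weak: "(\<lambda>n. hinner (Hn n) (J n u) (K.spec.fc n g (J n v))) \<longlonglongrightarrow> ip u (spec.fc g v)"
    if u: "u \<in> V" and v: "v \<in> V" for u v
  proof -
    have "(\<lambda>n. ip u (Js n (K.spec.fc n g (J n v)))) \<longlonglongrightarrow> ip u (spec.fc g v)"
      using u v g by (intro inner_tendsto lim) auto
    then show ?thesis using u v g by (simp add: inner_Js_right)
  qed
  have "(\<lambda>n. Im (hinner (Hn n) (J n x) (K.spec.fc n g (J n x)))) \<longlonglongrightarrow> Im (ip x (spec.fc g x))"
    by (intro tendsto_Im weak x)
  then have "(\<lambda>n. b * (hnorm (Hn n) (K.spec.fc n g (J n x)))\<^sup>2) \<longlonglongrightarrow> b * (nm (spec.fc g x))\<^sup>2"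
    using x by (simp add: K.fc_Im_form[OF g im(1)] fc_Im_form[OF g im(1)])
  then have "(\<lambda>n. inverse b * (b * (hnorm (Hn n) (K.spec.fc n g (J n x)))\<^sup>2)) \<longlonglongrightarrow> inverse b * (b * (nm (spec.fc g x))\<^sup>2)"
    by (rule tendsto_mult_left)
  then have nrm: "(\<lambda>n. (hnorm (Hn n) (K.spec.fc n g (J n x)))\<^sup>2) \<longlonglongrightarrow> (nm (spec.fc g x))\<^sup>2"
    using im(2) by (simp add: mult.assoc[symmetric])
  show "(\<lambda>n. hnorm (Hn n) (K.spec.fc n g (J n x) - J n (spec.fc g x))) \<longlonglongrightarrow> 0"
  proof (rule strong_intertwining[OF JsJ g x nrm])
    fix y assume y: "y \<in> V"
    have "(\<lambda>n. cnj (hinner (Hn n) (J n y) (K.spec.fc n g (J n x)))) \<longlonglongrightarrow> cnj (ip y (spec.fc g x))"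
      by (intro tendsto_cnj weak x y)
    then show "(\<lambda>n. hinner (Hn n) (K.spec.fc n g (J n x)) (J n y)) \<longlonglongrightarrow> ip (spec.fc g x) y"
      using x y g K.inner_commute[of "K.spec.fc n g (J n x)" n "J n y" for n] inner_commute[of "spec.fc g x" y] by simp
  qed
  show "(\<lambda>n. hnorm (Hn n) (K.spec.fc n (\<lambda>s. cnj (g s)) (J n x) - J n (spec.fc (\<lambda>s. cnj (g s)) x))) \<longlonglongrightarrow> 0"
  proof (rule strong_intertwining[OF JsJ cg x])
    show "(\<lambda>n. (hnorm (Hn n) (K.spec.fc n (\<lambda>s. cnj (g s)) (J n x)))\<^sup>2) \<longlonglongrightarrow> (nm (spec.fc (\<lambda>s. cnj (g s)) x))\<^sup>2"
      using nrm x by (simp add: K.spec.fc_norm[OF cg] spec.fc_norm[OF cg] K.spec.fc_norm[OF g] spec.fc_norm[OF g])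
    show "(\<lambda>n. hinner (Hn n) (K.spec.fc n (\<lambda>s. cnj (g s)) (J n x)) (J n y)) \<longlonglongrightarrow> ip (spec.fc (\<lambda>s. cnj (g s)) x) y"
      if y: "y \<in> V" for y
      using weak[OF x y] x y by (simp add: K.spec.fc_adjoint[OF cg] spec.fc_adjoint[OF cg])
  qed
qed

text \<open>The error for \<open>cnj g\<close> is the adjoint of the error for \<open>g\<close>;
  pairing \<open>w\<close> with itself and moving the operator across gives the same bound.\<close>

lemma compression_adjoint_bound:
  assumes g: "bounded_borel g" and u: "u \<in> V"
    and \<kappa>: "\<And>x. x \<in> V \<Longrightarrow> nm (Js n (K.spec.fc n g (J n x)) - spec.fc g x) \<le> \<kappa> * nm x"
  shows "nm (Js n (K.spec.fc n (\<lambda>s. cnj (g s)) (J n u)) - spec.fc (\<lambda>s. cnj (g s)) u) \<le> \<kappa> * nm u"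
proof -
  have cg: "bounded_borel (\<lambda>s. cnj (g s))" using g by auto
  define w where "w = Js n (K.spec.fc n (\<lambda>s. cnj (g s)) (J n u)) - spec.fc (\<lambda>s. cnj (g s)) u"
  have w: "w \<in> V" using cg u by (simp add: w_def)
  have "ip w w = hinner (Hn n) (J n w) (K.spec.fc n (\<lambda>s. cnj (g s)) (J n u)) - ip w (spec.fc (\<lambda>s. cnj (g s)) u)"
    using w cg u by (subst (2) w_def) (simp add: inner_diff_right inner_Js_right)
  also have "\<dots> = hinner (Hn n) (K.spec.fc n g (J n w)) (J n u) - ip (spec.fc g w) u"
    using w u by (simp add: K.spec.fc_adjoint[OF g] spec.fc_adjoint[OF g])
  also have "\<dots> = ip (Js n (K.spec.fc n g (J n w)) - spec.fc g w) u"
    using w g u by (simp add: inner_diff_left inner_Js_left)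
  finally have "(nm w)\<^sup>2 = Re (ip (Js n (K.spec.fc n g (J n w)) - spec.fc g w) u)"
    using w by (simp add: hnorm_sq)
  also have "\<dots> \<le> nm (Js n (K.spec.fc n g (J n w)) - spec.fc g w) * nm u"
    using Cauchy_Schwarz[of "Js n (K.spec.fc n g (J n w)) - spec.fc g w" u] w g u
      complex_Re_le_cmod[of "ip (Js n (K.spec.fc n g (J n w)) - spec.fc g w) u"] by simp
  also have "\<dots> \<le> \<kappa> * nm w * nm u"
    using \<kappa>[OF w] u by (intro mult_right_mono) auto
  finally have "nm w * nm w \<le> (\<kappa> * nm u) * nm w"
    by (simp add: power2_eq_square mult_ac)
  moreover have "0 \<le> \<kappa> * nm u"
    by (rule order_trans[OF hnorm_nonneg \<kappa>[OF u]]) (use g u in simp)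
  ultimately have "nm w \<le> \<kappa> * nm u"
    using hnorm_nonneg[OF w] by (cases "nm w = 0") (auto simp: mult_le_cancel_right)
  then show ?thesis by (simp add: w_def)
qed

lemma uniform_intertwining:
  assumes h: "bounded_borel h" and \<kappa>0: "\<kappa> \<longlonglongrightarrow> 0" and \<eta>0: "\<eta> \<longlonglongrightarrow> 0"
    and \<kappa>: "\<And>n x. x \<in> V \<Longrightarrow> nm (Js n (K.spec.fc n h (J n x)) - spec.fc h x) \<le> \<kappa> n * nm x"
    and \<eta>: "\<And>n y. y \<in> hcarrier (Hn n) \<Longrightarrow> hnorm (Hn n) (J n (Js n y) - y) \<le> \<eta> n * hnorm (Hn n) y"
    and xs: "\<And>n. xs n \<in> V" "\<And>n. nm (xs n) \<le> B"
  shows "(\<lambda>n. hnorm (Hn n) (K.spec.fc n h (J n (xs n)) - J n (spec.fc h (xs n)))) \<longlonglongrightarrow> 0"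
proof -
  obtain M where M: "M \<ge> 0" "\<And>s. cmod (h s) \<le> M" using bounded_borel_bound[OF h] by metis
  have B: "B \<ge> 0" using xs(2)[of 0] hnorm_nonneg[OF xs(1)[of 0]] by linarith
  have bound: "hnorm (Hn n) (K.spec.fc n h (J n (xs n)) - J n (spec.fc h (xs n))) \<le>
      \<bar>\<eta> n\<bar> * (M * (C * B)) + C * (\<bar>\<kappa> n\<bar> * B)" for n
  proof -
    define u where "u = K.spec.fc n h (J n (xs n))"
    define y where "y = spec.fc h (xs n)"
    have V: "u \<in> hcarrier (Hn n)" "y \<in> V" using h xs by (simp_all add: u_def y_def)
    have "hnorm (Hn n) u \<le> M * hnorm (Hn n) (J n (xs n))"
      unfolding u_def by (rule K.spec.fc_norm_le[OF h]) (use M xs in auto)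
    also have "\<dots> \<le> M * (C * B)"
      using J_bound[OF xs(1), of n n] mult_left_mono[OF xs(2) C_nonneg, of n] M by (intro mult_left_mono) auto
    finally have nu: "hnorm (Hn n) u \<le> M * (C * B)" .
    have "hnorm (Hn n) (J n (Js n u) - u) \<le> \<bar>\<eta> n\<bar> * hnorm (Hn n) u"
      using \<eta>[OF V(1)] mult_right_mono[OF abs_ge_self[of "\<eta> n"] K.hnorm_nonneg[OF V(1)]] by linarith
    also have "\<dots> \<le> \<bar>\<eta> n\<bar> * (M * (C * B))" using nu by (intro mult_left_mono) auto
    finally have 1: "hnorm (Hn n) (J n (Js n u) - u) \<le> \<bar>\<eta> n\<bar> * (M * (C * B))" .
    have "nm (Js n u - y) \<le> \<bar>\<kappa> n\<bar> * nm (xs n)"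
      using \<kappa>[OF xs(1), of n n] mult_right_mono[OF abs_ge_self[of "\<kappa> n"] hnorm_nonneg[OF xs(1)], of n]
      unfolding u_def y_def by linarith
    also have "\<dots> \<le> \<bar>\<kappa> n\<bar> * B" using xs(2) by (intro mult_left_mono) auto
    finally have "C * nm (Js n u - y) \<le> C * (\<bar>\<kappa> n\<bar> * B)" using C_nonneg by (intro mult_left_mono)
    then have 2: "hnorm (Hn n) (J n (Js n u - y)) \<le> C * (\<bar>\<kappa> n\<bar> * B)"
      using J_bound[of "Js n u - y" n] V by simp
    \<comment> \<open>Expresses the defect by the compression error and the error of
      \<open>J n (Js n u)\<close> against \<open>u\<close>, both of which are small uniformly on
      bounded sequences.\<close>
    have eq: "u - J n y = J n (Js n u - y) - (J n (Js n u) - u)"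
      using V by (simp add: J_diff)
    have "hnorm (Hn n) (u - J n y) \<le> hnorm (Hn n) (J n (Js n u - y)) + hnorm (Hn n) (J n (Js n u) - u)"
      unfolding eq using V by (intro K.hnorm_diff_le) auto
    then show ?thesis using 1 2 unfolding u_def y_def by linarith
  qed
  have "(\<lambda>n. \<bar>\<eta> n\<bar> * (M * (C * B)) + C * (\<bar>\<kappa> n\<bar> * B)) \<longlonglongrightarrow> \<bar>0\<bar> * (M * (C * B)) + C * (\<bar>0\<bar> * B)"
    by (intro tendsto_intros \<eta>0 \<kappa>0)
  moreover have "0 \<le> hnorm (Hn n) (K.spec.fc n h (J n (xs n)) - J n (spec.fc h (xs n)))" for n
    using h xs by (intro K.hnorm_nonneg) auto
  ultimately show ?thesis
    using bound
    by (intro Lim_null_comparison[of "\<lambda>n. hnorm (Hn n) (K.spec.fc n h (J n (xs n)) - J n (spec.fc h (xs n)))"]) auto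
qed

text \<open>The closure in \<open>common_resolvent_set\<close> provides one radius
  \<open>\<delta>\<close> for all \<open>n\<close>: real points closer than \<open>\<delta>\<close>
  to \<open>z\<close> lie in every resolvent set, so they are null for every spectral measure and
  can be removed from \<open>S\<close>.\<close>

lemma resolvent_convergence_exists:
  assumes z: "z \<in> common_resolvent_set H Hn An A"
    and S: "closed S" "\<And>x. x \<in> V \<Longrightarrow> AE s in spec.\<nu> x. s \<in> S"
      "\<And>n x. x \<in> hcarrier (Hn n) \<Longrightarrow> AE s in K.spec.\<nu> n x. s \<in> S"
    and X: "\<And>xs n. xs \<in> X \<Longrightarrow> xs n \<in> V" "\<And>xs. xs \<in> X \<Longrightarrow> \<exists>B. \<forall>n. nm (xs n) \<le> B"
      "\<And>xs T. xs \<in> X \<Longrightarrow> bop T \<Longrightarrow> (\<lambda>n. T (xs n)) \<in> X"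
      "\<And>xs. xs \<in> X \<Longrightarrow> (\<lambda>n. nm (Js n (J n (xs n)) - xs n)) \<longlonglongrightarrow> 0"
  shows "\<exists>\<delta>. resolvent_convergence H A Hn J An C z (S \<inter> {s. \<delta> \<le> cmod (complex_of_real s - z)}) \<delta> X"
proof -
  have "open (common_resolvent_set H Hn An A)" unfolding common_resolvent_set_def by auto
  then obtain \<delta> where \<delta>: "\<delta> > 0" "ball z \<delta> \<subseteq> common_resolvent_set H Hn An A"
    using z open_contains_ball by blast
  have "w \<in> resolvent_set H A \<and> w \<in> resolvent_set (Hn n) (An n)" if "w \<in> ball z \<delta>" for w n
    using that \<delta>(2) closure_subset[of "spectrum H A \<union> (\<Union>n. spectrum (Hn n) (An n))"]
    unfolding common_resolvent_set_def spectrum_def by blast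
  then have res: "complex_of_real s \<in> resolvent_set H A \<and> complex_of_real s \<in> resolvent_set (Hn n) (An n)"
    if "cmod (complex_of_real s - z) < \<delta>" for s n
    using that by (auto simp: dist_norm norm_minus_commute)
  have open_near: "open {s. cmod (complex_of_real s - z) < \<delta>}"
    by (intro open_Collect_less continuous_intros)
  have "resolvent_convergence H A Hn J An C z (S \<inter> {s. \<delta> \<le> cmod (complex_of_real s - z)}) \<delta> X"
  proof unfold_locales
    show "closed (S \<inter> {s. \<delta> \<le> cmod (complex_of_real s - z)})"
      by (intro closed_Int S closed_Collect_le continuous_intros)
    show "AE s in spec.\<nu> x. s \<in> S \<inter> {s. \<delta> \<le> cmod (complex_of_real s - z)}" if "x \<in> V" for x
      using S(2)[OF that] spec.AE_open_in_resolvent_set[OF open_near _ that] res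
      by (auto elim: eventually_elim2 simp: not_less)
    show "AE s in K.spec.\<nu> n x. s \<in> S \<inter> {s. \<delta> \<le> cmod (complex_of_real s - z)}" if "x \<in> hcarrier (Hn n)" for n x
      using S(3)[OF that] K.spec.AE_open_in_resolvent_set[OF open_near _ that] res
      by (auto elim: eventually_elim2 simp: not_less)
  qed (use X \<delta> in auto)
  then show ?thesis by blast
qed

end

section \<open>The heat semigroup and the unitary group\<close>

context resolvent_convergence
begin

lemma cut_rsv_inverse: "s \<in> L \<Longrightarrow> (complex_of_real s - z) * cut (rsv z) s = 1"
  using \<delta>(1) \<delta>(2)[of s] by (auto simp: cut_def rsv_def)

lemma bounded_borel_of_real_times_cut_rsv: "bounded_borel (\<lambda>s. complex_of_real s * cut (rsv z) s)"
proof -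
  have "(\<lambda>s. complex_of_real s * cut (rsv z) s) = (\<lambda>s. indicator L s + z * cut (rsv z) s)"
  proof (rule ext)
    fix s
    show "complex_of_real s * cut (rsv z) s = indicator L s + z * cut (rsv z) s"
      using cut_rsv_inverse[of s] by (cases "s \<in> L") (simp_all add: left_diff_distrib cut_def diff_eq_eq)
  qed
  then show ?thesis
    using bounded_borel_cut_rsv L_borel
    by (simp only:) (intro bounded_borel_add bounded_borel_mult bounded_borel_const bounded_borel_indicator)
qed

lemma resolvent_eq_fc:
  assumes "z \<in> resolvent_set H A" "x \<in> V"
  shows "resolvent H A z x = spec.fc (cut (rsv z)) x"
  by (rule spec.resolvent_eq_fc[OF assms(1) bounded_borel_cut_rsv bounded_borel_of_real_times_cut_rsv _ assms(2)])
    (rule eventually_mono[OF AE_L], assumption, erule cut_rsv_inverse)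

lemma resolvent_eq_fc_n:
  assumes "z \<in> resolvent_set (Hn n) (An n)" "x \<in> hcarrier (Hn n)"
  shows "resolvent (Hn n) (An n) z x = K.spec.fc n (cut (rsv z)) x"
  by (rule K.spec.resolvent_eq_fc[OF assms(1) bounded_borel_cut_rsv bounded_borel_of_real_times_cut_rsv _ assms(2)])
    (rule eventually_mono[OF AE_Ln], assumption, erule cut_rsv_inverse)

lemma continuous_exp_cut: "continuous_on L (cut (\<lambda>s. exp (c * complex_of_real s) * h s))" if "continuous_on L h"
proof -
  have "continuous_on L (\<lambda>s. exp (c * complex_of_real s) * h s)" by (intro continuous_intros that)
  then show ?thesis by (rule continuous_on_cong[THEN iffD1, rotated 2]) (auto simp: cut_def)
qed

lemma bounded_borel_cut_heat:
  assumes "L \<subseteq> {\<gamma>..}" "t \<ge> 0"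
  shows "bounded_borel (cut (\<lambda>s. exp (- complex_of_real t * complex_of_real s)))"
  unfolding bounded_borel_def
proof (intro conjI exI allI)
  have "(\<lambda>s. exp (- complex_of_real t * complex_of_real s)) \<in> borel_measurable borel"
    by (intro borel_measurable_continuous_onI continuous_intros)
  then show "cut (\<lambda>s. exp (- complex_of_real t * complex_of_real s)) \<in> borel_measurable borel"
    unfolding cut_def using L_borel by measurable
  show "cmod (cut (\<lambda>s. exp (- complex_of_real t * complex_of_real s)) s) \<le> exp (- t * \<gamma>)" for s
    using assms by (auto simp: cut_def indicator_def mult_left_mono)
qed

lemma converges_heat:
  assumes base: "converges (cut (rsv z))" "converges (cut (rsv (cnj z)))"
    and L\<gamma>: "L \<subseteq> {\<gamma>..}" and t: "t \<ge> 0"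
  shows "converges (cut (\<lambda>s. exp (- complex_of_real t * complex_of_real s)))"
proof (cases "t = 0")
  \<comment> \<open>At \<open>t = 0\<close> the function need not vanish at infinity, but it is 1 on
    \<open>L\<close>.\<close>
  case True
  show ?thesis
    by (rule converges_uniform_limit[OF bounded_borel_cut_heat[OF L\<gamma> t]])
      (use True in \<open>auto simp: cut_def intro!: exI[of _ "\<lambda>s. 1"] converges_const\<close>)
next
  case False
  then have t0: "t > 0" using t by simp
  show ?thesis
  proof (rule converges_vanishing_at_infinity[OF base bounded_borel_cut_heat[OF L\<gamma> t]])
    show "continuous_on L (cut (\<lambda>s. exp (- complex_of_real t * complex_of_real s)))"
      using continuous_exp_cut[of "\<lambda>s. 1" "- complex_of_real t"] by simp
    fix e :: real assume e: "e > 0"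
    show "\<exists>B. \<forall>s\<in>L. \<bar>s\<bar> > B \<longrightarrow> cmod (cut (\<lambda>s. exp (- complex_of_real t * complex_of_real s)) s) < e"
    \<comment> \<open>As \<open>s \<ge> \<gamma>\<close>, the condition
      \<open>\<bar>s\<bar> > \<bar>\<gamma>\<bar>\<close> makes \<open>s\<close> positive; then
      \<open>s > \<bar>ln e\<bar> / t\<close> makes the exponential smaller than
      \<open>e\<close>.\<close>
    proof (intro exI[of _ "max \<bar>\<gamma>\<bar> (\<bar>ln e\<bar> / t)"] ballI impI)
      fix s assume s: "s \<in> L" "max \<bar>\<gamma>\<bar> (\<bar>ln e\<bar> / t) < \<bar>s\<bar>"
      have "s \<ge> \<gamma>" using s(1) L\<gamma> by auto
      then have "\<bar>ln e\<bar> / t < s" using s(2) by auto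
      then have "- (t * s) < ln e" using t0 by (simp add: field_simps)
      then have "exp (- (t * s)) < exp (ln e)" by (simp only: exp_less_mono)
      then show "cmod (cut (\<lambda>s. exp (- complex_of_real t * complex_of_real s)) s) < e"
        using s(1) e by (simp add: cut_def)
    qed
  qed
qed

lemma exp_operator_heat:
  assumes "L \<subseteq> {\<gamma>..}" "t \<ge> 0"
  shows "x \<in> V \<Longrightarrow> exp_operator H (- complex_of_real t) A x =
      spec.fc (cut (\<lambda>s. exp (- complex_of_real t * complex_of_real s))) x"
    and "y \<in> hcarrier (Hn n) \<Longrightarrow> exp_operator (Hn n) (- complex_of_real t) (An n) y =
      K.spec.fc n (cut (\<lambda>s. exp (- complex_of_real t * complex_of_real s))) y"
proof -
  show "x \<in> V \<Longrightarrow> exp_operator H (- complex_of_real t) A x =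
      spec.fc (cut (\<lambda>s. exp (- complex_of_real t * complex_of_real s))) x"
    by (rule exp_operator_eq_fc[OF bounded_borel_cut_heat[OF assms]])
      (rule eventually_mono[OF AE_L], assumption, simp add: cut_def)
  show "y \<in> hcarrier (Hn n) \<Longrightarrow> exp_operator (Hn n) (- complex_of_real t) (An n) y =
      K.spec.fc n (cut (\<lambda>s. exp (- complex_of_real t * complex_of_real s))) y"
    by (rule K.exp_operator_eq_fc[OF bounded_borel_cut_heat[OF assms]])
      (rule eventually_mono[OF AE_Ln], assumption, simp add: cut_def)
qed

lemma bounded_borel_unitary: "bounded_borel (\<lambda>s. exp (\<i> * complex_of_real t * complex_of_real s))"
  unfolding bounded_borel_def
proof (intro conjI exI allI)
  show "(\<lambda>s. exp (\<i> * complex_of_real t * complex_of_real s)) \<in> borel_measurable borel"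
    by (intro borel_measurable_continuous_onI continuous_intros)
  show "cmod (exp (\<i> * complex_of_real t * complex_of_real s)) \<le> 1" for s
    by simp
qed

text \<open>The exponential does not vanish at infinity, but its product with the resolvent does, and the range
  of the resolvent is dense.\<close>

lemma converges_unitary:
  assumes base: "converges (cut (rsv z))" "converges (cut (rsv (cnj z)))"
    and z: "Im z \<noteq> 0" and X: "X = {(\<lambda>n. x) | x. x \<in> V}"
  shows "converges (\<lambda>s. exp (\<i> * complex_of_real t * complex_of_real s))"
proof -
  define f where "f s = exp (\<i> * complex_of_real t * complex_of_real s)" for s :: real
  define g where "g = cut (rsv z)"
  have f: "bounded_borel f" unfolding f_def by (rule bounded_borel_unitary)
  have f1: "cmod (f s) = 1" for s unfolding f_def by simp
  have g: "bounded_borel g" unfolding g_def by (rule bounded_borel_cut_rsv)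
  have fg: "bounded_borel (\<lambda>s. f s * g s)" using f g by auto
  have conv_fg: "converges (\<lambda>s. f s * g s)"
  proof (rule converges_vanishing_at_infinity[OF base fg])
    have "continuous_on L (rsv z)"
      unfolding rsv_def using of_real_minus_nonreal[OF z] by (intro continuous_intros) auto
    then have "continuous_on L (cut (\<lambda>s. f s * rsv z s))"
      unfolding f_def by (rule continuous_exp_cut)
    then show "continuous_on L (\<lambda>s. f s * g s)" by (simp add: g_def cut_def[abs_def] mult.assoc)
    fix e :: real assume e: "e > 0"
    show "\<exists>B. \<forall>s\<in>L. \<bar>s\<bar> > B \<longrightarrow> cmod (f s * g s) < e"
    proof (intro exI[of _ "cmod z + 1 / e"] ballI impI)
      fix s assume s: "s \<in> L" "cmod z + 1 / e < \<bar>s\<bar>"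
      have "\<bar>s\<bar> - cmod z \<le> cmod (complex_of_real s - z)"
        using norm_triangle_ineq2[of "complex_of_real s" z] by simp
      then have p: "1 / e < cmod (complex_of_real s - z)" using s(2) by linarith
      then have "0 < cmod (complex_of_real s - z)" using e by (smt (verit) zero_less_divide_1_iff)
      then have "1 / cmod (complex_of_real s - z) < e" using p e by (simp add: field_simps)
      then show "cmod (f s * g s) < e"
        using s(1) by (simp add: norm_mult f1 g_def cut_def rsv_def norm_divide)
    qed
  qed
  let ?d = "\<lambda>n x. K.spec.fc n f (J n x) - J n (spec.fc f x)"
  have dense: "(\<lambda>n. hnorm (Hn n) (?d n (spec.fc g y))) \<longlonglongrightarrow> 0" if y: "y \<in> V" for y
  proof -
    have yX: "(\<lambda>n. y) \<in> X" using X y by blast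
    have "(\<lambda>n. hnorm (Hn n) (K.spec.fc n g (J n y) - J n (spec.fc g y)) +
        hnorm (Hn n) (K.spec.fc n (\<lambda>s. f s * g s) (J n y) - J n (spec.fc (\<lambda>s. f s * g s) y))) \<longlonglongrightarrow> 0 + 0"
      using base(1) conv_fg yX unfolding converges_def g_def[symmetric] by (intro tendsto_add) auto
    moreover have "hnorm (Hn n) (?d n (spec.fc g y)) \<le> hnorm (Hn n) (K.spec.fc n g (J n y) - J n (spec.fc g y)) +
        hnorm (Hn n) (K.spec.fc n (\<lambda>s. f s * g s) (J n y) - J n (spec.fc (\<lambda>s. f s * g s) y))" for n
    proof -
      \<comment> \<open>The product rule solved for the defect of \<open>f\<close> at
        \<open>spec.fc g y\<close>; the remaining defects belong to \<open>g\<close> and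
        \<open>f * g\<close>, which are already treated.\<close>
      have eq: "?d n (spec.fc g y) = (K.spec.fc n (\<lambda>s. f s * g s) (J n y) - J n (spec.fc (\<lambda>s. f s * g s) y))
          - K.spec.fc n f (K.spec.fc n g (J n y) - J n (spec.fc g y))"
        using y f g by (simp add: spec.fc_mult K.spec.fc_mult K.self.bounded_operator_diff[OF K.spec.fc_bop[OF f]])
      have "hnorm (Hn n) (K.spec.fc n f (K.spec.fc n g (J n y) - J n (spec.fc g y))) \<le>
          1 * hnorm (Hn n) (K.spec.fc n g (J n y) - J n (spec.fc g y))"
        by (rule K.spec.fc_norm_le[OF f]) (use y g f1 in auto)
      then show ?thesis
        unfolding eq
        using K.hnorm_diff_le[of "K.spec.fc n (\<lambda>s. f s * g s) (J n y) - J n (spec.fc (\<lambda>s. f s * g s) y)" n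
            "K.spec.fc n f (K.spec.fc n g (J n y) - J n (spec.fc g y))"] y f g fg by simp
    qed
    moreover have "0 \<le> hnorm (Hn n) (?d n (spec.fc g y))" for n
      using y f g by (intro K.hnorm_nonneg) auto
    ultimately show ?thesis
      by (intro Lim_null_comparison[of "\<lambda>n. hnorm (Hn n) (?d n (spec.fc g y))"]) auto
  qed
  have "(\<lambda>n. hnorm (Hn n) (?d n x)) \<longlonglongrightarrow> 0" if x: "x \<in> V" for x
  proof (rule LIMSEQ_I)
    fix e :: real assume e: "e > 0"
    \<comment> \<open>Replacing \<open>x\<close> by a vector in the range of the resolvent costs at
      most \<open>2 * C * e'\<close>; the denominator has \<open>C + 1\<close> because
      \<open>C\<close> may be 0.\<close>
    define e' where "e' = e / (4 * (C + 1))"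
    have e': "e' > 0" "2 * C * e' \<le> e / 2"
      unfolding e'_def using e C_nonneg by (simp_all add: field_simps)
    obtain y where y: "y \<in> V" "nm (x - spec.fc (rsv z) y) < e'"
      using fc_rsv_range_dense[OF z x e'(1)] by blast
    define d where "d = spec.fc g y"
    \<comment> \<open>Density is known for the range of \<open>rsv z\<close>, convergence for its
      cut version; the two agree on \<open>L\<close>.\<close>
    have "AE s in spec.\<nu> y. rsv z s = g s"
      using AE_L[OF y(1)] by (rule eventually_mono) (simp add: g_def cut_def)
    then have "spec.fc (rsv z) y = d"
      unfolding d_def by (rule spec.fc_eq_if_AE[OF bounded_borel_rsv[OF z] g y(1)])
    then have xd: "nm (x - d) < e'" using y by simp
    have d: "d \<in> V" using g y by (simp add: d_def)
    from order_tendstoD(2)[OF dense[OF y(1)] half_gt_zero[OF e]]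
    obtain N where N: "\<And>n. n \<ge> N \<Longrightarrow> hnorm (Hn n) (?d n d) < e / 2"
      unfolding eventually_sequentially d_def by blast
    have "norm (hnorm (Hn n) (?d n x) - 0) < e" if n: "n \<ge> N" for n
    proof -
      have eq: "?d n x = (K.spec.fc n f (J n (x - d)) - J n (spec.fc f (x - d))) + ?d n d"
        using x d f by (simp add: J_diff K.self.bounded_operator_diff[OF K.spec.fc_bop[OF f]]
            self.bounded_operator_diff[OF spec.fc_bop[OF f]])
      have "hnorm (Hn n) (K.spec.fc n f (J n (x - d))) \<le> 1 * hnorm (Hn n) (J n (x - d))"
        by (rule K.spec.fc_norm_le[OF f]) (use x d f1 in auto)
      then have 1: "hnorm (Hn n) (K.spec.fc n f (J n (x - d))) \<le> C * nm (x - d)"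
        using J_bound[of "x - d" n] x d by simp
      have "nm (spec.fc f (x - d)) \<le> 1 * nm (x - d)"
        by (rule spec.fc_norm_le[OF f]) (use x d f1 in auto)
      then have "C * nm (spec.fc f (x - d)) \<le> C * nm (x - d)" using C_nonneg by (intro mult_left_mono) auto
      then have 2: "hnorm (Hn n) (J n (spec.fc f (x - d))) \<le> C * nm (x - d)"
        using J_bound[of "spec.fc f (x - d)" n] x d f by simp
      have "hnorm (Hn n) (?d n x) \<le> hnorm (Hn n) (K.spec.fc n f (J n (x - d)) - J n (spec.fc f (x - d))) + hnorm (Hn n) (?d n d)"
        unfolding eq using x d f by (intro K.hnorm_triangle) auto
      moreover have "hnorm (Hn n) (K.spec.fc n f (J n (x - d)) - J n (spec.fc f (x - d))) \<le>
          hnorm (Hn n) (K.spec.fc n f (J n (x - d))) + hnorm (Hn n) (J n (spec.fc f (x - d)))"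
        using x d f by (intro K.hnorm_diff_le) auto
      moreover have "C * nm (x - d) \<le> C * e'" using xd C_nonneg by (intro mult_left_mono) auto
      ultimately have "hnorm (Hn n) (?d n x) < e" using 1 2 e'(2) N[OF n] by linarith
      moreover have "0 \<le> hnorm (Hn n) (?d n x)" using x f by (intro K.hnorm_nonneg) auto
      ultimately show ?thesis by simp
    qed
    then show "\<exists>no. \<forall>n\<ge>no. norm (hnorm (Hn n) (?d n x) - 0) < e" by blast
  qed
  then show ?thesis
    unfolding converges_def f_def[symmetric] using f X by auto
qed

lemma exp_operator_unitary:
  shows "x \<in> V \<Longrightarrow> exp_operator H (\<i> * complex_of_real t) A x =
      spec.fc (\<lambda>s. exp (\<i> * complex_of_real t * complex_of_real s)) x"
    and "y \<in> hcarrier (Hn n) \<Longrightarrow> exp_operator (Hn n) (\<i> * complex_of_real t) (An n) y =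
      K.spec.fc n (\<lambda>s. exp (\<i> * complex_of_real t * complex_of_real s)) y"
  by (rule exp_operator_eq_fc[OF bounded_borel_unitary], simp, assumption)
    (rule K.exp_operator_eq_fc[OF bounded_borel_unitary], simp, assumption)

lemma Im_cut_rsv: "Im (cut (rsv z) s) = Im z * (cmod (cut (rsv z) s))\<^sup>2"
  by (cases "s \<in> L") (simp_all add: cut_def rsv_def Im_divide norm_divide power_divide cmod_power2)

lemma converges_resolvent_strong:
  assumes X: "X = {(\<lambda>n. x) | x. x \<in> V}" and z: "Im z \<noteq> 0"
    and res: "z \<in> resolvent_set H A" "\<And>n. z \<in> resolvent_set (Hn n) (An n)"
    and lim: "\<And>x. x \<in> V \<Longrightarrow> (\<lambda>n. nm (Js n (resolvent (Hn n) (An n) z (J n x)) - resolvent H A z x)) \<longlonglongrightarrow> 0"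
  shows "converges (cut (rsv z))" "converges (cut (rsv (cnj z)))"
proof -
  have JsJ': "(\<lambda>n. nm (Js n (J n x) - x)) \<longlonglongrightarrow> 0" if "x \<in> V" for x
    using JsJ[of "\<lambda>n. x"] X that by blast
  have lim': "(\<lambda>n. nm (Js n (K.spec.fc n (cut (rsv z)) (J n x)) - spec.fc (cut (rsv z)) x)) \<longlonglongrightarrow> 0" if "x \<in> V" for x
    using lim[OF that] that by (simp add: resolvent_eq_fc[OF res(1)] resolvent_eq_fc_n[OF res(2)])
  note si = strong_intertwining_resolvent[OF JsJ' bounded_borel_cut_rsv Im_cut_rsv z lim']
  show "converges (cut (rsv z))"
    unfolding converges_def using X si(1) bounded_borel_cut_rsv by auto
  show "converges (cut (rsv (cnj z)))"
    unfolding converges_def cut_rsv_cnj using X si(2) bounded_borel_cnj[OF bounded_borel_cut_rsv] by auto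
qed

lemma bop_compression: "bounded_borel f \<Longrightarrow> bop (\<lambda>x. Js n (K.spec.fc n f (J n x)) - spec.fc f x)"
  by (intro bop_diff spec.fc_bop bounded_operator_comp[of H "Hn n" H, OF _ _ _ bounded_operator_comp[of H "Hn n" "Hn n"]]
      J K.spec.fc_bop P.bounded_operator_adjoint hilbert_space_axioms K.hilbert_space_axioms)

text \<open>Here \<open>z\<close> may be real: control of \<open>J n (Js n y)\<close> replaces the
  argument with imaginary parts.\<close>

lemma converges_resolvent_uniform:
  assumes res: "z \<in> resolvent_set H A" "\<And>n. z \<in> resolvent_set (Hn n) (An n)"
    and lim: "(\<lambda>n. operator_norm H H (\<lambda>x. Js n (resolvent (Hn n) (An n) z (J n x)) - resolvent H A z x)) \<longlonglongrightarrow> 0"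
    and JJs: "(\<lambda>n. operator_norm (Hn n) (Hn n) (\<lambda>y. J n (Js n y) - y)) \<longlonglongrightarrow> 0"
  shows "converges (cut (rsv z))" "converges (cut (rsv (cnj z)))"
proof -
  define \<kappa> where "\<kappa> n = operator_norm H H (\<lambda>x. Js n (K.spec.fc n (cut (rsv z)) (J n x)) - spec.fc (cut (rsv z)) x)" for n
  define \<eta> where "\<eta> n = operator_norm (Hn n) (Hn n) (\<lambda>y. J n (Js n y) - y)" for n
  have "\<kappa> = (\<lambda>n. operator_norm H H (\<lambda>x. Js n (resolvent (Hn n) (An n) z (J n x)) - resolvent H A z x))"
    unfolding \<kappa>_def by (intro ext operator_norm_cong) (simp add: resolvent_eq_fc[OF res(1)] resolvent_eq_fc_n[OF res(2)])
  then have \<kappa>0: "\<kappa> \<longlonglongrightarrow> 0" using lim by simp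
  have \<eta>0: "\<eta> \<longlonglongrightarrow> 0" using JJs unfolding \<eta>_def .
  have \<kappa>: "nm (Js n (K.spec.fc n (cut (rsv z)) (J n x)) - spec.fc (cut (rsv z)) x) \<le> \<kappa> n * nm x" if "x \<in> V" for n x
    unfolding \<kappa>_def by (rule self.hnorm_le_operator_norm[OF bop_compression[OF bounded_borel_cut_rsv] that])
  have "bounded_operator (Hn n) (Hn n) (\<lambda>y. J n (Js n y) - y)" for n
    by (intro K.bop_diff K.bop_id bounded_operator_comp[of "Hn n" H "Hn n"] J P.bounded_operator_adjoint
        hilbert_space_axioms K.hilbert_space_axioms)
  then have \<eta>: "hnorm (Hn n) (J n (Js n y) - y) \<le> \<eta> n * hnorm (Hn n) y" if "y \<in> hcarrier (Hn n)" for n y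
    unfolding \<eta>_def using K.self.hnorm_le_operator_norm that by blast
  have conv: "converges h" if h: "bounded_borel h"
      "\<And>n x. x \<in> V \<Longrightarrow> nm (Js n (K.spec.fc n h (J n x)) - spec.fc h x) \<le> \<kappa> n * nm x" for h
    unfolding converges_def
  proof (intro conjI ballI h(1))
    fix xs assume xs: "xs \<in> X"
    obtain B where B: "\<And>n. nm (xs n) \<le> B" using X_bounded[OF xs] by blast
    show "(\<lambda>n. hnorm (Hn n) (K.spec.fc n h (J n (xs n)) - J n (spec.fc h (xs n)))) \<longlonglongrightarrow> 0"
      by (rule uniform_intertwining[OF h(1) \<kappa>0 \<eta>0 h(2) \<eta> X_in[OF xs] B])
  qed
  show "converges (cut (rsv z))" by (rule conv[OF bounded_borel_cut_rsv \<kappa>])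
  show "converges (cut (rsv (cnj z)))"
    unfolding cut_rsv_cnj
    by (rule conv[OF bounded_borel_cnj[OF bounded_borel_cut_rsv]
          compression_adjoint_bound[OF bounded_borel_cut_rsv _ \<kappa>]])
qed

end

section \<open>From resolvent convergence to the exponentials\<close>

lemma operator_sequence_exists:
  fixes H :: "'a::ab_group_add hilbert" and Hn :: "nat \<Rightarrow> 'b::ab_group_add hilbert"
  assumes "separable_hilbert_space H" "\<And>n. separable_hilbert_space (Hn n)"
    and J: "\<And>n. bounded_operator H (Hn n) (J n)"
    and "self_adjoint H A" "\<And>n. self_adjoint (Hn n) (An n)"
    and C: "C > 0" "\<And>n. operator_norm H (Hn n) (J n) \<le> C"
  shows "operator_sequence H A Hn J An C"
proof -
  have H: "hilbert_space H" and Hn: "hilbert_space (Hn n)" for n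
    using assms(1,2) by (auto simp: separable_hilbert_space_def)
  interpret A: self_adjoint_operator H A
    using H assms(4) by (intro self_adjoint_operator.intro self_adjoint_operator_axioms.intro)
  interpret P: hilbert_space_pair H "Hn n" for n
    using H Hn by (intro hilbert_space_pair.intro)
  show ?thesis
  proof (intro operator_sequence.intro operator_sequence_axioms.intro A.self_adjoint_operator_axioms)
    show "self_adjoint_operator (Hn n) (An n)" for n
      using Hn assms(5) by (intro self_adjoint_operator.intro self_adjoint_operator_axioms.intro)
    show "bounded_operator H (Hn n) (J n)" for n by (rule J)
    show "hnorm (Hn n) (J n x) \<le> C * hnorm H x" if "x \<in> hcarrier H" for n x
      using P.hnorm_le_operator_norm[OF J that, of n] mult_right_mono[OF C(2) A.hnorm_nonneg[OF that], of n] by linarith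
    show "C \<ge> 0" using C(1) by simp
  qed
qed

lemma mem_resolvent_set_if_common:
  "z \<in> common_resolvent_set H Hn An A \<Longrightarrow> z \<in> resolvent_set H A"
  "z \<in> common_resolvent_set H Hn An A \<Longrightarrow> z \<in> resolvent_set (Hn n) (An n)"
  using closure_subset[of "spectrum H A \<union> (\<Union>n. spectrum (Hn n) (An n))"]
  unfolding common_resolvent_set_def spectrum_def by blast+

context operator_sequence
begin

lemma strong_limits:
  assumes JsJ: "\<And>x. x \<in> V \<Longrightarrow> (\<lambda>n. nm (Js n (J n x) - x)) \<longlonglongrightarrow> 0"
    and z: "z \<in> common_resolvent_set H Hn An A" "z \<notin> \<real>"
    and lim: "\<And>x. x \<in> V \<Longrightarrow> (\<lambda>n. nm (Js n (resolvent (Hn n) (An n) z (J n x)) - resolvent H A z x)) \<longlonglongrightarrow> 0"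
    and x: "x \<in> V"
  shows "(\<lambda>n. nm (Js n (exp_operator (Hn n) (\<i> * complex_of_real t) (An n) (J n x))
      - exp_operator H (\<i> * complex_of_real t) A x)) \<longlonglongrightarrow> 0"
    and "bounded_below H A \<gamma> \<Longrightarrow> (\<And>n. bounded_below (Hn n) (An n) \<gamma>) \<Longrightarrow> t \<ge> 0 \<Longrightarrow>
      (\<lambda>n. nm (Js n (exp_operator (Hn n) (- complex_of_real t) (An n) (J n x))
        - exp_operator H (- complex_of_real t) A x)) \<longlonglongrightarrow> 0"
proof -
  define X where "X = {(\<lambda>n::nat. x) | x. x \<in> V}"
  have X: "xs n \<in> V" "\<exists>B. \<forall>n. nm (xs n) \<le> B" "bop T \<Longrightarrow> (\<lambda>n. T (xs n)) \<in> X"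
    "(\<lambda>n. nm (Js n (J n (xs n)) - xs n)) \<longlonglongrightarrow> 0" if "xs \<in> X" for xs n T
    using that JsJ bounded_operatorD(1)[of H H T] unfolding X_def by auto
  have xX: "(\<lambda>n. x) \<in> X" using x unfolding X_def by blast
  have Imz: "Im z \<noteq> 0" using z(2) by (simp add: complex_is_Real_iff)
  note res = mem_resolvent_set_if_common[OF z(1)]
  show "(\<lambda>n. nm (Js n (exp_operator (Hn n) (\<i> * complex_of_real t) (An n) (J n x))
      - exp_operator H (\<i> * complex_of_real t) A x)) \<longlonglongrightarrow> 0"
  proof -
    \<comment> \<open>Without a lower bound on the operators the measures are confined only by the
      distance from \<open>z\<close>.\<close>
    have "\<exists>\<delta>. resolvent_convergence H A Hn J An C z (UNIV \<inter> {s. \<delta> \<le> cmod (complex_of_real s - z)}) \<delta> X"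
      by (rule resolvent_convergence_exists[where X = X, OF z(1) closed_UNIV]) (simp_all add: X)
    then obtain \<delta> where "resolvent_convergence H A Hn J An C z (UNIV \<inter> {s. \<delta> \<le> cmod (complex_of_real s - z)}) \<delta> X" ..
    then interpret R: resolvent_convergence H A Hn J An C z "UNIV \<inter> {s. \<delta> \<le> cmod (complex_of_real s - z)}" \<delta> X .
    note base = R.converges_resolvent_strong[OF X_def Imz res lim]
    show ?thesis
      using R.converges_compression[OF R.converges_unitary[OF base Imz X_def] xX] x
      by (simp add: R.exp_operator_unitary)
  qed
  assume bb: "bounded_below H A \<gamma>" "\<And>n. bounded_below (Hn n) (An n) \<gamma>" and t: "t \<ge> 0"
  have "\<exists>\<delta>. resolvent_convergence H A Hn J An C z ({\<gamma>..} \<inter> {s. \<delta> \<le> cmod (complex_of_real s - z)}) \<delta> X"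
    by (rule resolvent_convergence_exists[where X = X, OF z(1) closed_atLeast])
      (simp_all add: X spec.AE_ge_if_bounded_below[OF bb(1)] K.spec.AE_ge_if_bounded_below[OF bb(2)])
  then obtain \<delta> where "resolvent_convergence H A Hn J An C z ({\<gamma>..} \<inter> {s. \<delta> \<le> cmod (complex_of_real s - z)}) \<delta> X" ..
  then interpret R: resolvent_convergence H A Hn J An C z "{\<gamma>..} \<inter> {s. \<delta> \<le> cmod (complex_of_real s - z)}" \<delta> X .
  note base = R.converges_resolvent_strong[OF X_def Imz res lim]
  have sub: "{\<gamma>..} \<inter> {s. \<delta> \<le> cmod (complex_of_real s - z)} \<subseteq> {\<gamma>..}" by simp
  show "(\<lambda>n. nm (Js n (exp_operator (Hn n) (- complex_of_real t) (An n) (J n x))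
        - exp_operator H (- complex_of_real t) A x)) \<longlonglongrightarrow> 0"
    using R.converges_compression[OF R.converges_heat[OF base sub t] xX] x
    by (simp add: R.exp_operator_heat[OF sub t])
qed

lemma norm_limit:
  assumes JsJ: "(\<lambda>n. operator_norm H H (\<lambda>x. Js n (J n x) - x)) \<longlonglongrightarrow> 0"
    and JJs: "(\<lambda>n. operator_norm (Hn n) (Hn n) (\<lambda>y. J n (Js n y) - y)) \<longlonglongrightarrow> 0"
    and z: "z \<in> common_resolvent_set H Hn An A"
    and lim: "(\<lambda>n. operator_norm H H (\<lambda>x. Js n (resolvent (Hn n) (An n) z (J n x)) - resolvent H A z x)) \<longlonglongrightarrow> 0"
    and bb: "bounded_below H A \<gamma>" "\<And>n. bounded_below (Hn n) (An n) \<gamma>" and t: "t \<ge> 0"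
  shows "(\<lambda>n. operator_norm H H (\<lambda>x. Js n (exp_operator (Hn n) (- complex_of_real t) (An n) (J n x))
      - exp_operator H (- complex_of_real t) A x)) \<longlonglongrightarrow> 0"
proof -
  \<comment> \<open>All bounded sequences, since the near maximizers behind
    \<open>operator_norm_tendsto_0\<close> vary with \<open>n\<close>.\<close>
  define X where "X = {xs. (\<forall>n::nat. xs n \<in> V) \<and> (\<exists>B. \<forall>n. nm (xs n) \<le> B)}"
  have bJ: "bop (\<lambda>x. Js n (J n x) - x)" for n
    by (intro bop_diff bop_id bounded_operator_comp[of H "Hn n" H] J P.bounded_operator_adjoint
        hilbert_space_axioms K.hilbert_space_axioms)
  have X1: "xs n \<in> V" "\<exists>B. \<forall>n. nm (xs n) \<le> B" if "xs \<in> X" for xs :: "nat \<Rightarrow> 'a" and n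
    using that unfolding X_def by auto
  have X2: "(\<lambda>n. T (xs n)) \<in> X" if xs: "xs \<in> X" and T: "bop T" for xs :: "nat \<Rightarrow> 'a" and T
  proof -
    obtain M where M: "M \<ge> 0" "\<And>x. x \<in> V \<Longrightarrow> nm (T x) \<le> M * nm x"
      using self.bounded_operator_bound[OF T] by metis
    obtain B where B: "\<And>n. nm (xs n) \<le> B" using X1(2)[OF xs] by blast
    have "nm (T (xs n)) \<le> M * B" for n
      using M(2)[OF X1(1)[OF xs], of n] mult_left_mono[OF B M(1), of n] by linarith
    then show ?thesis
      using bounded_operatorD(1)[OF T X1(1)[OF xs]] unfolding X_def by auto
  qed
  have X3: "(\<lambda>n. nm (Js n (J n (xs n)) - xs n)) \<longlonglongrightarrow> 0" if xs: "xs \<in> X" for xs :: "nat \<Rightarrow> 'a"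
  proof -
    obtain B where B: "\<And>n. nm (xs n) \<le> B" using X1(2)[OF xs] by blast
    have "(\<lambda>n. operator_norm H H (\<lambda>x. Js n (J n x) - x) * B) \<longlonglongrightarrow> 0 * B"
      by (intro tendsto_mult JsJ tendsto_const)
    moreover have "nm (Js n (J n (xs n)) - xs n) \<le> operator_norm H H (\<lambda>x. Js n (J n x) - x) * B" for n
      using self.hnorm_le_operator_norm[OF bJ X1(1)[OF xs], of n n]
        mult_left_mono[OF B self.operator_norm_nonneg[OF bJ], of n n] by linarith
    ultimately show ?thesis
      using X1(1)[OF xs]
      by (intro Lim_null_comparison[of "\<lambda>n. nm (Js n (J n (xs n)) - xs n)"]) auto
  qed
  note res = mem_resolvent_set_if_common[OF z]
  have "\<exists>\<delta>. resolvent_convergence H A Hn J An C z ({\<gamma>..} \<inter> {s. \<delta> \<le> cmod (complex_of_real s - z)}) \<delta> X"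
    by (rule resolvent_convergence_exists[where X = X, OF z closed_atLeast])
      (simp_all add: X1 X2 X3 spec.AE_ge_if_bounded_below[OF bb(1)] K.spec.AE_ge_if_bounded_below[OF bb(2)])
  then obtain \<delta> where "resolvent_convergence H A Hn J An C z ({\<gamma>..} \<inter> {s. \<delta> \<le> cmod (complex_of_real s - z)}) \<delta> X" ..
  then interpret R: resolvent_convergence H A Hn J An C z "{\<gamma>..} \<inter> {s. \<delta> \<le> cmod (complex_of_real s - z)}" \<delta> X .
  have sub: "{\<gamma>..} \<inter> {s. \<delta> \<le> cmod (complex_of_real s - z)} \<subseteq> {\<gamma>..}" by simp
  define f where "f = R.cut (\<lambda>s. exp (- complex_of_real t * complex_of_real s))"
  have conv: "R.converges f"
    unfolding f_def by (rule R.converges_heat[OF R.converges_resolvent_uniform[OF res lim JJs] sub t])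
  have f: "bounded_borel f" unfolding f_def by (rule R.bounded_borel_cut_heat[OF sub t])
  have "(\<lambda>n. operator_norm H H (\<lambda>x. Js n (K.spec.fc n f (J n x)) - spec.fc f x)) \<longlonglongrightarrow> 0"
  proof (rule self.operator_norm_tendsto_0)
    show "bop (\<lambda>x. Js n (K.spec.fc n f (J n x)) - spec.fc f x)" for n by (rule R.bop_compression[OF f])
    fix xs :: "nat \<Rightarrow> 'a" assume "\<And>n. xs n \<in> V" "\<And>n. nm (xs n) \<le> 1"
    then have "xs \<in> X" unfolding X_def by blast
    then show "(\<lambda>n. nm (Js n (K.spec.fc n f (J n (xs n))) - spec.fc f (xs n))) \<longlonglongrightarrow> 0"
      by (rule R.converges_compression[OF conv])
  qed
  moreover have "operator_norm H H (\<lambda>x. Js n (exp_operator (Hn n) (- complex_of_real t) (An n) (J n x))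
      - exp_operator H (- complex_of_real t) A x) =
      operator_norm H H (\<lambda>x. Js n (K.spec.fc n f (J n x)) - spec.fc f x)" for n
    unfolding f_def by (rule operator_norm_cong) (simp add: R.exp_operator_heat[OF sub t])
  ultimately show ?thesis by simp
qed

end

theorem corollary2p5:
  fixes H :: "'a::ab_group_add hilbert"
    and Hn :: "nat \<Rightarrow> 'b::ab_group_add hilbert"
    and J :: "nat \<Rightarrow> 'a \<Rightarrow> 'b"
    and A :: "'a operator"
    and An :: "nat \<Rightarrow> 'b operator"
  assumes "separable_hilbert_space H"
    and "\<And>n. separable_hilbert_space (Hn n)"
    and "\<And>n. bounded_operator H (Hn n) (J n)"
    and "self_adjoint H A"
    and "\<And>n. self_adjoint (Hn n) (An n)"
  shows
    "(generalized_strong_resolvent_convergence H Hn J An A \<longrightarrow>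
       (\<forall>t::real. \<forall>x\<in>hcarrier H.
          (\<lambda>n. hnorm H (bounded_adjoint H (Hn n) (J n)
                  (exp_operator (Hn n) (\<i> * complex_of_real t) (An n) (J n x))
                - exp_operator H (\<i> * complex_of_real t) A x)) \<longlonglongrightarrow> 0) \<and>
       ((\<exists>\<gamma>::real. bounded_below H A \<gamma> \<and> (\<forall>n. bounded_below (Hn n) (An n) \<gamma>)) \<longrightarrow>
          (\<forall>t::real. t \<ge> 0 \<longrightarrow> (\<forall>x\<in>hcarrier H.
             (\<lambda>n. hnorm H (bounded_adjoint H (Hn n) (J n)
                     (exp_operator (Hn n) (- complex_of_real t) (An n) (J n x))
                   - exp_operator H (- complex_of_real t) A x)) \<longlonglongrightarrow> 0))))
     \<and>
     (generalized_norm_resolvent_convergence H Hn J An A \<longrightarrow>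
       (\<exists>\<gamma>::real. bounded_below H A \<gamma> \<and> (\<forall>n. bounded_below (Hn n) (An n) \<gamma>)) \<longrightarrow>
       (\<forall>t::real. t \<ge> 0 \<longrightarrow>
          (\<lambda>n. operator_norm H H (\<lambda>x. bounded_adjoint H (Hn n) (J n)
                  (exp_operator (Hn n) (- complex_of_real t) (An n) (J n x))
                - exp_operator H (- complex_of_real t) A x)) \<longlonglongrightarrow> 0))"
proof (intro conjI[of "_ \<longrightarrow> _"] impI)
  assume "generalized_strong_resolvent_convergence H Hn J An A"
  then obtain C z where C: "C > 0" "\<And>n. operator_norm H (Hn n) (J n) \<le> C"
    and JsJ: "\<And>x. x \<in> hcarrier H \<Longrightarrow> (\<lambda>n. hnorm H (bounded_adjoint H (Hn n) (J n) (J n x) - x)) \<longlonglongrightarrow> 0"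
    and z: "z \<in> common_resolvent_set H Hn An A" "z \<notin> \<real>"
    and lim: "\<And>x. x \<in> hcarrier H \<Longrightarrow>
      (\<lambda>n. hnorm H (bounded_adjoint H (Hn n) (J n) (resolvent (Hn n) (An n) z (J n x)) - resolvent H A z x)) \<longlonglongrightarrow> 0"
    unfolding generalized_strong_resolvent_convergence_def by blast
  interpret operator_sequence H A Hn J An C
    by (rule operator_sequence_exists[OF assms C])
  note strong = strong_limits[OF JsJ z lim]
  show "(\<forall>t::real. \<forall>x\<in>hcarrier H.
          (\<lambda>n. hnorm H (bounded_adjoint H (Hn n) (J n)
                  (exp_operator (Hn n) (\<i> * complex_of_real t) (An n) (J n x))
                - exp_operator H (\<i> * complex_of_real t) A x)) \<longlonglongrightarrow> 0) \<and>
       ((\<exists>\<gamma>::real. bounded_below H A \<gamma> \<and> (\<forall>n. bounded_below (Hn n) (An n) \<gamma>)) \<longrightarrow>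
          (\<forall>t::real. t \<ge> 0 \<longrightarrow> (\<forall>x\<in>hcarrier H.
             (\<lambda>n. hnorm H (bounded_adjoint H (Hn n) (J n)
                     (exp_operator (Hn n) (- complex_of_real t) (An n) (J n x))
                   - exp_operator H (- complex_of_real t) A x)) \<longlonglongrightarrow> 0)))"
    using strong by blast
next
  fix t :: real
  assume "generalized_norm_resolvent_convergence H Hn J An A"
    and "\<exists>\<gamma>. bounded_below H A \<gamma> \<and> (\<forall>n. bounded_below (Hn n) (An n) \<gamma>)"
  then obtain C z \<gamma> where C: "C > 0" "\<And>n. operator_norm H (Hn n) (J n) \<le> C"
    and JsJ: "(\<lambda>n. operator_norm H H (\<lambda>x. bounded_adjoint H (Hn n) (J n) (J n x) - x)) \<longlonglongrightarrow> 0"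
    and eq: "\<And>n. operator_norm H H (\<lambda>x. bounded_adjoint H (Hn n) (J n) (J n x) - x) =
          operator_norm (Hn n) (Hn n) (\<lambda>y. J n (bounded_adjoint H (Hn n) (J n) y) - y)"
    and z: "z \<in> common_resolvent_set H Hn An A"
    and lim: "(\<lambda>n. operator_norm H H (\<lambda>x.
           bounded_adjoint H (Hn n) (J n) (resolvent (Hn n) (An n) z (J n x)) - resolvent H A z x)) \<longlonglongrightarrow> 0"
    and bb: "bounded_below H A \<gamma>" "\<And>n. bounded_below (Hn n) (An n) \<gamma>"
    unfolding generalized_norm_resolvent_convergence_def by blast
  interpret operator_sequence H A Hn J An C
    by (rule operator_sequence_exists[OF assms C])
  show "\<forall>t::real. t \<ge> 0 \<longrightarrow>
          (\<lambda>n. operator_norm H H (\<lambda>x. bounded_adjoint H (Hn n) (J n)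
                  (exp_operator (Hn n) (- complex_of_real t) (An n) (J n x))
                - exp_operator H (- complex_of_real t) A x)) \<longlonglongrightarrow> 0"
    \<comment> \<open>The equality of the two norms in the definition carries the limit for
      \<open>Js n (J n x) - x\<close> over to \<open>J n (Js n y) - y\<close>.\<close>
    using norm_limit[OF JsJ JsJ[unfolded eq] z lim bb] by blast
qed

end
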